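(* Let $d$ be either the metric induced by the norm $\|(x_1,x_2,t)\|_{JM}=\sqrt{x_1^2+x_2^2}+|t|$ or the Euclidean metric, here regarded as a metric on $\mathbb{T}(s)\times[0,s]$ (see context). Let $C_d=\sup\{d(x,y):x,y\in[0,1]^3\}$. Let $0<p_1<p_2<1$ and $\varepsilon>0$ be given, and let $\delta=\delta(s)$ be any function with $0<\delta(s)\le s^{-\varepsilon}$. Then, for each $s$, one may construct in a common probability space Poisson processes $\mathcal{P}_1^+,\mathcal{P}_1^-,\mathcal{P}_2^+,\mathcal{P}_2^-$ on $\mathbb{T}(s)\times[0,s]$ of intensities $p_1$, $1-p_1$, $p_2$, $1-p_2$ respectively, with $\mathcal{P}_i^+$ and $\mathcal{P}_i^-$ independent for $i=1,2$, such that the following event $E_{gl}$ has probability $1-o(1)$ as $s\to\infty$: for every piecewise-linear path $P_1\subset\mathbb{T}(s)$ that is black with respect to $(\mathcal{P}_1^+,\mathcal{P}_1^-)$ there is a piecewise-linear path $P_2\subset\mathbb{T}(s)$ that is $(2C_d\delta)$-robustly black with respect to $(\mathcal{P}_2^+,\mathcal{P}_2^-)$, such that every point of $P_2$ is within distance $\log s$ of some point of $P_1$ and vice versa.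
   Context: $\mathbb{T}(s)$ denotes the $s$ by $s$ torus $\mathbb{R}^2/(s\mathbb{Z})^2$; the metric $d$ on $\mathbb{R}^2\times\mathbb{R}$ induces a metric on $\mathbb{T}(s)\times[0,s]$ in the natural way (no wrapping in the third coordinate), and $\mathbb{T}(s)$ is identified with $\mathbb{T}(s)\times\{0\}$. For a pair $(X^+,X^-)$ of discrete subsets of $\mathbb{T}(s)\times[0,s]$, a point $x\in\mathbb{T}(s)$ is black with respect to $(X^+,X^-)$ if $d(x,X^+)\le d(x,X^-)$ (i.e. some nearest point of $X^+\cup X^-$ to $x$ lies in $X^+$), and is $\eta$-robustly black if $d(x,X^+)\le d(x,X^-)-\eta$, i.e. the closest point of $X^+$ is at least $\eta$ closer to $x$ than the closest point of $X^-$. A path is black (resp. $\eta$-robustly black) if each of its points is. *)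

theory Defs
  imports "HOL-Probability.Probability"
begin

type_synonym pt = "real \<times> real \<times> real"

definition JM_norm :: "pt \<Rightarrow> real" where
  "JM_norm = (\<lambda>(x1, x2, t). sqrt (x1^2 + x2^2) + \<bar>t\<bar>)"

definition eucl_norm :: "pt \<Rightarrow> real" where
  "eucl_norm = (\<lambda>(x1, x2, t). sqrt (x1^2 + x2^2 + t^2))"

definition C_d :: "(pt \<Rightarrow> real) \<Rightarrow> real" where
  "C_d N = Sup {N (x - y) | x y. x \<in> {0..1} \<times> {0..1} \<times> {0..1} \<and> y \<in> {0..1} \<times> {0..1} \<times> {0..1}}"

text \<open>T(s) x [0,s] is represented by the fundamental domain [0,s)^2 x [0,s].\<close>
definition region :: "real \<Rightarrow> pt set" where
  "region s = {0..<s} \<times> {0..<s} \<times> {0..s}"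

definition tdist :: "(pt \<Rightarrow> real) \<Rightarrow> real \<Rightarrow> pt \<Rightarrow> pt \<Rightarrow> real" where
  "tdist N s x y = Inf {N (fst x - fst y + s * of_int k1,
                           fst (snd x) - fst (snd y) + s * of_int k2,
                           snd (snd x) - snd (snd y)) | k1 k2. True}"

text \<open>Distance from a point to a set (infinite if the set is empty).\<close>
definition setdist :: "(pt \<Rightarrow> real) \<Rightarrow> real \<Rightarrow> pt \<Rightarrow> pt set \<Rightarrow> ereal" where
  "setdist N s x X = (INF y\<in>X. ereal (tdist N s x y))"

definition black :: "(pt \<Rightarrow> real) \<Rightarrow> real \<Rightarrow> pt set \<Rightarrow> pt set \<Rightarrow> pt \<Rightarrow> bool" where
  "black N s Xp Xm x \<longleftrightarrow> setdist N s x Xp \<le> setdist N s x Xm"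

definition robustly_black ::
  "(pt \<Rightarrow> real) \<Rightarrow> real \<Rightarrow> real \<Rightarrow> pt set \<Rightarrow> pt set \<Rightarrow> pt \<Rightarrow> bool" where
  "robustly_black N s \<eta> Xp Xm x \<longleftrightarrow> setdist N s x Xp \<le> setdist N s x Xm - ereal \<eta>"

text \<open>Reduction mod s, and the point of T(s) = T(s) x {0} represented by a point of the plane.\<close>
definition tmod :: "real \<Rightarrow> real \<Rightarrow> real" where
  "tmod s x = x - s * of_int \<lfloor>x / s\<rfloor>"

definition torus_pt :: "real \<Rightarrow> real \<times> real \<Rightarrow> pt" where
  "torus_pt s z = (tmod s (fst z), tmod s (snd z), 0)"

text \<open>Piecewise-linear path in the plane given by its (nonempty) list of vertices;
  a piecewise-linear path in T(s) is the projection of such a path.\<close>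
definition pl_points :: "(real \<times> real) list \<Rightarrow> (real \<times> real) set" where
  "pl_points vs = set vs \<union> (\<Union>(a, b)\<in>set (zip vs (tl vs)). closed_segment a b)"

definition tpath :: "real \<Rightarrow> (real \<times> real) list \<Rightarrow> pt set" where
  "tpath s vs = torus_pt s ` pl_points vs"

definition cfg_space :: "pt set measure" where
  "cfg_space = sigma UNIV {{X. card (X \<inter> B) = n} | B n. B \<in> sets borel}"

definition poisson_process ::
  "'w measure \<Rightarrow> ('w \<Rightarrow> pt set) \<Rightarrow> pt set \<Rightarrow> real \<Rightarrow> bool" where
  "poisson_process M X R lam \<longleftrightarrow>
     prob_space M \<and> X \<in> M \<rightarrow>\<^sub>M cfg_space \<and>
     (AE \<omega> in M. X \<omega> \<subseteq> R \<and> finite (X \<omega>)) \<and>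
     (\<forall>B \<in> sets borel. B \<subseteq> R \<longrightarrow>
        (\<forall>n::nat. measure M {\<omega> \<in> space M. card (X \<omega> \<inter> B) = n} =
           exp (- (lam * measure lborel B)) * (lam * measure lborel B) ^ n / fact n)) \<and>
     (\<forall>(k::nat) Bs. (\<forall>i<k. Bs i \<in> sets borel \<and> Bs i \<subseteq> R) \<and> disjoint_family_on Bs {..<k} \<longrightarrow>
        prob_space.indep_vars M (\<lambda>_. count_space UNIV) (\<lambda>i \<omega>. card (X \<omega> \<inter> Bs i)) {..<k})"

definition E_gl :: "(pt \<Rightarrow> real) \<Rightarrow> real \<Rightarrow> real \<Rightarrow> pt set \<times> pt set \<times> pt set \<times> pt set \<Rightarrow> bool" where
  "E_gl N s \<delta> \<omega> \<longleftrightarrow> (case \<omega> of (P1p, P1m, P2p, P2m) \<Rightarrow>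
     (\<forall>vs. vs \<noteq> [] \<and> (\<forall>x \<in> tpath s vs. black N s P1p P1m x) \<longrightarrow>
        (\<exists>ws. ws \<noteq> [] \<and> (\<forall>y \<in> tpath s ws. robustly_black N s (2 * C_d N * \<delta>) P2p P2m y) \<and>
              (\<forall>y \<in> tpath s ws. \<exists>x \<in> tpath s vs. tdist N s y x \<le> ln s) \<and>
              (\<forall>x \<in> tpath s vs. \<exists>y \<in> tpath s ws. tdist N s x y \<le> ln s))))"

end

theory Submission
  imports Defs "HOL-Real_Asymp.Real_Asymp"
begin

text \<open>
  The coupling is chosen such that every single point that is black for the first pair is robustly
  black for the second one, so that \<open>P\<^sub>2 = P\<^sub>1\<close> works.

  Contracting the third coordinate raises the intensity of a Poisson process. Pushing the black
  points towards the torus in this way when passing from \<open>p\<^sub>1\<close> to \<open>p\<^sub>2\<close>, and the white points away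
  from it, improves all distances by a power of \<open>s\<close>, except for points that are already within
  height \<open>h = s\<^sup>-\<^sup>3\<^sup>\<gamma>\<close> of the torus. The improvement at a black point \<open>x\<close> fails only if the nearest
  black point and its nearest white competitor are both low.

  Low points are sparse: a square cell of side about \<open>s\<^sup>\<gamma>\<close> contains one with probability \<open>o(1)\<close>. In
  the low layer the numbers of points per cell are therefore coupled monotonically in such a way
  that a cell with a low black point of the first pair has no low white point of the second pair in
  its block of cells. This is possible since a block without black points is much more likely than
  not, so that the white points surviving in the second pair can be taken from such blocks. Doing
  this successively, with intermediate rates, for four shifted tilings by \<open>2 \<times> 2\<close> blocks treats all
  pairs of adjacent cells. Finally, with high probability every point of the torus has a black point
  at distance smaller than half a cell, so only pairs in adjacent cells matter.
\<close>

section \<open>Coupling of Poisson counts\<close>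

text \<open>The low layer needs its own mechanism because contraction by a factor \<kappa> moves a
  point at height \<open>t\<close> only by \<open>(1 - \<kappa>) * t\<close>, which is no uniform
  gain near the torus. The factor there is kept strictly above the ratio of the intensities: part of
  the surplus intensity is spent on moving points, and the rest makes the expected black count per
  cell strictly larger, and the white one strictly smaller, in the second pair. This strictness
  makes the coupling of counts possible once cells are sparse. Above the layer the factor equals the
  ratio, so counts agree exactly and every point moves by at least a fixed multiple of
  \<open>h\<close>.

  The scales are tied together by \<open>y = s powr g\<close>. Cells of side about \<open>y\<close>
  in a layer of height \<open>1 / y ^ 3\<close> have volume at most \<open>1 / y\<close>. A vertical
  gain of order \<open>1 / y ^ 3\<close>, seen from distance of order \<open>y\<close>, shortens
  distances by order \<open>1 / y ^ 7\<close>. Boxes of volume of order \<open>y ^ 3\<close> are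
  empty with probability smaller than any power of \<open>s\<close>.

  Independence is demanded only within each pair, so the two pairs may share the positions of their
  points.\<close>

definition pois :: "real \<Rightarrow> nat pmf" where
  "pois m = (if m = 0 then return_pmf 0 else poisson_pmf m)"

lemma pmf_pois: "0 \<le> m \<Longrightarrow> pmf (pois m) k = exp (- m) * m ^ k / fact k"
  by (cases "m = 0") (auto simp: pois_def indicator_def power_0_left)

lemma measure_pmf_le_cmult:
  assumes "\<And>x. x \<in> A \<Longrightarrow> pmf p x \<le> c * pmf q x"
  shows "measure (measure_pmf p) A \<le> c * measure (measure_pmf q) A"
proof -
  have "(\<integral>x. pmf p x \<partial>count_space A) \<le> (\<integral>x. c * pmf q x \<partial>count_space A)"
    by (intro integral_mono_AE) (auto simp: AE_count_space assms intro!: integrable_pmf)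
  then show ?thesis
    by (simp add: integral_pmf)
qed

text \<open>\<open>\<tau>\<close> is what is left of the measure \<open>c * \<sigma>\<close> after
  each value \<open>l \<noteq> y\<close> has given up the mass \<open>pmf \<sigma>' l\<close>,
  normalised. Its total mass is positive because nothing is taken away at \<open>y\<close>.\<close>

lemma residual_pmf:
  assumes c: "0 < c" and y: "0 < pmf \<sigma> y"
    and le: "\<And>l. l \<noteq> y \<Longrightarrow> pmf \<sigma>' l \<le> c * pmf \<sigma> l"
  obtains \<tau> where "0 < c - (1 - pmf \<sigma>' y)"
    "\<And>l. (c - (1 - pmf \<sigma>' y)) * pmf \<tau> l = c * pmf \<sigma> l - (if l = y then 0 else pmf \<sigma>' l)"
proof -
  define \<rho> where "\<rho> = c - (1 - pmf \<sigma>' y)"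
  define f where "f l = c * pmf \<sigma> l - (if l = y then 0 else pmf \<sigma>' l)" for l
  have co: "measure (measure_pmf p) (- {y}) = 1 - pmf p y" for p :: "'a pmf"
    using measure_pmf.prob_compl[of "{y}" p] by (simp add: measure_pmf_single Compl_eq_Diff_UNIV)
  \<comment> \<open>Summing \<open>le\<close> over all values other than \<open>y\<close>; the
    positive mass \<open>c * pmf \<sigma> y\<close> then makes \<open>\<rho>\<close> strictly
    positive.\<close>
  have "1 - pmf \<sigma>' y \<le> c * (1 - pmf \<sigma> y)"
    using measure_pmf_le_cmult[of "- {y}" \<sigma>' c \<sigma>] le by (auto simp: co)
  moreover have "0 < c * pmf \<sigma> y" using c y by simp
  ultimately have \<rho>: "0 < \<rho>"
    by (simp add: \<rho>_def algebra_simps)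
  have f_nonneg: "0 \<le> f l" for l
    using le[of l] c by (auto simp: f_def)
  have f_eq: "f = (\<lambda>l. c * pmf \<sigma> l - pmf \<sigma>' l + indicator {y} l * pmf \<sigma>' y)"
    by (auto simp: f_def fun_eq_iff indicator_def)
  have int1: "integrable (count_space UNIV) (\<lambda>l. indicator {y} l * pmf \<sigma>' y)"
    by (intro integrable_mult_left integrable_real_indicator) auto
  have int2: "integrable (count_space UNIV) (\<lambda>l. c * pmf \<sigma> l - pmf \<sigma>' l)"
    by (intro Bochner_Integration.integrable_diff integrable_mult_right integrable_pmf)
  have "integrable (count_space UNIV) f"
    unfolding f_eq by (intro Bochner_Integration.integrable_add int1 int2)
  moreover have "(\<integral>l. f l \<partial>count_space UNIV) = \<rho>"
    unfolding f_eq \<rho>_def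
    by (subst Bochner_Integration.integral_add[OF int2 int1], subst Bochner_Integration.integral_diff)
       (simp_all add: integrable_pmf integral_pmf)
  ultimately have nn: "(\<integral>\<^sup>+l. ennreal (f l) \<partial>count_space UNIV) = ennreal \<rho>"
    by (subst nn_integral_eq_integral) (auto simp: f_nonneg)
  have "(\<integral>\<^sup>+l. ennreal (f l / \<rho>) \<partial>count_space UNIV) = 1"
    using \<rho> nn by (simp add: divide_ennreal[symmetric] f_nonneg nn_integral_divide ennreal_divide_self)
  then have "pmf (embed_pmf (\<lambda>l. f l / \<rho>)) l = f l / \<rho>" for l
    using \<rho> f_nonneg by (intro pmf_embed_pmf) auto
  then show ?thesis
    using that[of "embed_pmf (\<lambda>l. f l / \<rho>)"] \<rho> by (simp add: f_def \<rho>_def)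
qed

text \<open>A value \<open>l \<noteq> y\<close> of the second white coordinate is always copied from the pair \<open>(z, l)\<close>, a value
  \<open>k \<noteq> z\<close> of the first black coordinate always to the pair \<open>(k, y)\<close>; all remaining mass goes from
  \<open>z\<close> to \<open>y\<close>, where nothing has to be checked.\<close>
lemma star_coupling:
  assumes z: "0 < pmf \<pi>1 z" and y: "0 < pmf \<sigma>1 y"
    and le1: "\<And>k. k \<noteq> z \<Longrightarrow> pmf \<pi>1 k \<le> pmf \<sigma>2 y * pmf \<pi>2 k"
    and le2: "\<And>l. l \<noteq> y \<Longrightarrow> pmf \<sigma>2 l \<le> pmf \<pi>1 z * pmf \<sigma>1 l"
  shows "rel_pmf (\<lambda>(k1, l1) (k2, l2). (k1 = k2 \<or> k1 = z) \<and> (l2 = l1 \<or> l2 = y) \<and> (k1 \<noteq> z \<longrightarrow> l2 = y))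
           (pair_pmf \<pi>1 \<sigma>1) (pair_pmf \<pi>2 \<sigma>2)"
proof -
  obtain \<tau> where \<rho>: "0 < pmf \<pi>1 z - (1 - pmf \<sigma>2 y)"
    and \<tau>: "\<And>l. (pmf \<pi>1 z - (1 - pmf \<sigma>2 y)) * pmf \<tau> l = pmf \<pi>1 z * pmf \<sigma>1 l - (if l = y then 0 else pmf \<sigma>2 l)"
    using residual_pmf[OF z y le2] by blast
  \<comment> \<open>The probability of keeping the second black value \<open>k\<close>, given that
    the second white value is \<open>y\<close>. It is tuned so that exactly the mass
    \<open>pmf \<pi>1 k\<close> is kept. If \<open>pmf \<pi>2 k = 0\<close>, the quotient is 0, as
    it should be, because \<open>le1\<close> then forces \<open>pmf \<pi>1 k = 0\<close>.\<close>
  define \<theta> where "\<theta> k = (if k = z then 0 else pmf \<pi>1 k / (pmf \<sigma>2 y * pmf \<pi>2 k))" for k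
  have \<theta>01: "0 \<le> \<theta> k" "\<theta> k \<le> 1" for k
    using le1[of k] by (auto simp: \<theta>_def divide_le_eq_1 mult_nonneg_nonneg order_less_le)
  have \<theta>: "pmf \<sigma>2 y * (pmf \<pi>2 k * \<theta> k) = (if k = z then 0 else pmf \<pi>1 k)" for k
    using le1[of k] pmf_nonneg[of \<pi>1 k] by (auto simp: \<theta>_def simp del: pmf_nonneg)
  \<comment> \<open>The coupling is built backwards, as a kernel that produces the first pair from
    the second. When the black value is not kept, the first white value is drawn from the residual
    law \<open>\<tau>\<close>.\<close>
  define W where "W k2 l2 = (if l2 \<noteq> y then return_pmf (z, l2)
      else bind_pmf (bernoulli_pmf (\<theta> k2)) (\<lambda>b. if b then map_pmf (Pair k2) \<sigma>1 else map_pmf (Pair z) \<tau>))"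
    for k2 l2
  have pmf_Pair: "pmf (map_pmf (Pair u) p) (k, l) = (if u = k then pmf p l else 0)" for u k l and p :: "'b pmf"
    by (auto intro: pmf_map_inj' simp: inj_on_def pmf_eq_0_set_pmf)
  have Wy: "pmf (W k2 y) (k, l) = \<theta> k2 * (if k2 = k then pmf \<sigma>1 l else 0) + (1 - \<theta> k2) * (if k = z then pmf \<tau> l else 0)"
    for k2 k l
    using \<theta>01[of k2] by (auto simp: W_def pmf_bind pmf_Pair)
  have inner: "pmf (bind_pmf \<sigma>2 (W k2)) (k, l)
      = pmf \<sigma>2 y * pmf (W k2 y) (k, l) + (if k = z \<and> l \<noteq> y then pmf \<sigma>2 l else 0)" for k2 k l
  proof -
    have "pmf (bind_pmf \<sigma>2 (W k2)) (k, l)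
        = (\<integral>l2. indicator {y} l2 * pmf (W k2 y) (k, l) + indicator {l} l2 * (if k = z \<and> l \<noteq> y then 1 else 0) \<partial>\<sigma>2)"
      unfolding pmf_bind by (intro Bochner_Integration.integral_cong) (auto simp: W_def indicator_def)
    also have "\<dots> = pmf \<sigma>2 y * pmf (W k2 y) (k, l) + (if k = z \<and> l \<noteq> y then pmf \<sigma>2 l else 0)"
      by (subst Bochner_Integration.integral_add)
         (auto simp: measure_pmf_single intro!: integrable_mult_left measure_pmf.integrable_const_bound[where B=1])
    finally show ?thesis .
  qed
  have \<theta>_int: "integrable (measure_pmf \<pi>2) \<theta>"
    using \<theta>01 by (intro measure_pmf.integrable_const_bound[where B=1]) auto
  have E\<theta>: "pmf \<sigma>2 y * (\<integral>k. \<theta> k \<partial>\<pi>2) = 1 - pmf \<pi>1 z"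
  proof -
    have "pmf \<sigma>2 y * (\<integral>k. \<theta> k \<partial>\<pi>2) = (\<integral>k. pmf \<sigma>2 y * (pmf \<pi>2 k * \<theta> k) \<partial>count_space UNIV)"
      by (simp add: measure_pmf_eq_density integral_density)
    also have "\<dots> = (\<integral>k. pmf \<pi>1 k - indicator {z} k * pmf \<pi>1 z \<partial>count_space UNIV)"
      unfolding \<theta> by (intro Bochner_Integration.integral_cong) auto
    also have "\<dots> = 1 - pmf \<pi>1 z"
      by (subst Bochner_Integration.integral_diff)
         (auto simp: integrable_pmf integral_pmf intro!: integrable_mult_left integrable_real_indicator)
    finally show ?thesis .
  qed
  have marg: "bind_pmf (pair_pmf \<pi>2 \<sigma>2) (\<lambda>(k2, l2). W k2 l2) = pair_pmf \<pi>1 \<sigma>1"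
  proof (rule pmf_eqI, clarify)
    fix k l
    have "pmf (bind_pmf (pair_pmf \<pi>2 \<sigma>2) (\<lambda>(k2, l2). W k2 l2)) (k, l) = pmf (bind_pmf \<pi>2 (\<lambda>k2. bind_pmf \<sigma>2 (W k2))) (k, l)"
      by (simp add: pair_pmf_def bind_assoc_pmf bind_return_pmf)
    also have "\<dots> = (\<integral>k2. pmf (bind_pmf \<sigma>2 (W k2)) (k, l) \<partial>\<pi>2)"
      by (rule pmf_bind)
    also have "\<dots> = pmf \<pi>1 k * pmf \<sigma>1 l"
    proof (cases "k = z")
      case False
      then have "(\<integral>k2. pmf (bind_pmf \<sigma>2 (W k2)) (k, l) \<partial>\<pi>2)
          = (\<integral>k2. indicator {k} k2 * (pmf \<sigma>2 y * (\<theta> k * pmf \<sigma>1 l)) \<partial>\<pi>2)"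
        by (intro Bochner_Integration.integral_cong) (auto simp: inner Wy)
      also have "\<dots> = (pmf \<sigma>2 y * (pmf \<pi>2 k * \<theta> k)) * pmf \<sigma>1 l"
        by (simp add: measure_pmf_single)
      finally show ?thesis using False by (simp add: \<theta>)
    next
      case True
      have "\<theta> z = 0" by (simp add: \<theta>_def)
      then have "(\<integral>k2. pmf (bind_pmf \<sigma>2 (W k2)) (k, l) \<partial>\<pi>2)
          = (\<integral>k2. (pmf \<sigma>2 y * pmf \<tau> l + (if l \<noteq> y then pmf \<sigma>2 l else 0)) - \<theta> k2 * (pmf \<sigma>2 y * pmf \<tau> l) \<partial>\<pi>2)"
        using True by (intro Bochner_Integration.integral_cong) (auto simp: inner Wy algebra_simps)
      also have "\<dots> = (pmf \<sigma>2 y * pmf \<tau> l + (if l \<noteq> y then pmf \<sigma>2 l else 0)) - (\<integral>k2. \<theta> k2 \<partial>\<pi>2) * (pmf \<sigma>2 y * pmf \<tau> l)"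
        by (subst Bochner_Integration.integral_diff) (auto intro!: integrable_mult_left \<theta>_int)
      also have "\<dots> = (pmf \<sigma>2 y - pmf \<sigma>2 y * (\<integral>k2. \<theta> k2 \<partial>\<pi>2)) * pmf \<tau> l + (if l \<noteq> y then pmf \<sigma>2 l else 0)"
        by (simp add: algebra_simps)
      \<comment> \<open>By \<open>E\<theta>\<close> the mass left for \<open>\<tau>\<close> is
        exactly its normalising constant, so the residual and the values copied from
        \<open>\<sigma>2\<close> add up to \<open>pmf \<pi>1 z * pmf \<sigma>1 l\<close>.\<close>
      also have "\<dots> = (pmf \<pi>1 z - (1 - pmf \<sigma>2 y)) * pmf \<tau> l + (if l \<noteq> y then pmf \<sigma>2 l else 0)"
        by (simp add: E\<theta>)
      finally show ?thesis using True by (auto simp: \<tau>)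
    qed
    finally show "pmf (bind_pmf (pair_pmf \<pi>2 \<sigma>2) (\<lambda>(k2, l2). W k2 l2)) (k, l) = pmf (pair_pmf \<pi>1 \<sigma>1) (k, l)"
      by (simp add: pmf_pair)
  qed
  define J where "J = bind_pmf (pair_pmf \<pi>2 \<sigma>2) (\<lambda>x. map_pmf (\<lambda>w. (w, x)) (W (fst x) (snd x)))"
  have fstJ: "map_pmf fst J = pair_pmf \<pi>1 \<sigma>1"
    unfolding marg[symmetric] J_def by (simp add: map_bind_pmf map_pmf_comp case_prod_unfold)
  have sndJ: "map_pmf snd J = pair_pmf \<pi>2 \<sigma>2"
    unfolding J_def by (simp add: map_bind_pmf map_pmf_comp map_pmf_const bind_return_pmf')
  show ?thesis
  proof (rule rel_pmf.intros[OF _ fstJ sndJ])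
    fix u v assume "(u, v) \<in> set_pmf J"
    then show "(\<lambda>(k1, l1) (k2, l2). (k1 = k2 \<or> k1 = z) \<and> (l2 = l1 \<or> l2 = y) \<and> (k1 \<noteq> z \<longrightarrow> l2 = y)) u v"
      by (cases u; cases v) (auto simp: J_def W_def split: if_splits)
  qed
qed

lemma rel_Pi_pmf_union:
  assumes "finite A" "finite B" "A \<inter> B = {}"
    and "rel_pmf R (Pi_pmf A d p) (Pi_pmf A d p')" "rel_pmf S (Pi_pmf B d p) (Pi_pmf B d p')"
    and "\<And>f f' g g'. R f f' \<Longrightarrow> S g g' \<Longrightarrow>
       T (\<lambda>x. if x \<in> A then f x else g x) (\<lambda>x. if x \<in> A then f' x else g' x)"
  shows "rel_pmf T (Pi_pmf (A \<union> B) d p) (Pi_pmf (A \<union> B) d p')"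
proof -
  have "rel_pmf (rel_prod R S) (pair_pmf (Pi_pmf A d p) (Pi_pmf B d p)) (pair_pmf (Pi_pmf A d p') (Pi_pmf B d p'))"
    using assms(4,5) by (simp add: rel_pmf_rel_prod)
  then show ?thesis
    unfolding Pi_pmf_union[OF assms(1-3)] pmf.rel_map
    by (rule pmf.rel_mono_strong) (auto simp: assms(6))
qed


text \<open>Lowering a Poisson rate from \<open>a * r\<close> to \<open>a * r'\<close> multiplies
  the weight of \<open>k\<close> by at most \<open>(r' / r) ^ k * exp (a * r)\<close>. One nonzero
  count thus yields a full factor \<open>r' / r\<close>, while all exponentials together cost only
  \<open>exp (\<kappa> * (a * r))\<close>.\<close>

lemma prod_pmf_pois_le:
  assumes "finite A" "real (card A) \<le> \<kappa>" "0 < r'" "r' < r" "0 < a" and l: "x \<in> A" "l x \<noteq> 0"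
  shows "(\<Prod>x\<in>A. pmf (pois (a * r')) (l x)) \<le> r' / r * exp (\<kappa> * (a * r)) * (\<Prod>x\<in>A. pmf (pois (a * r)) (l x))"
proof -
  have le1: "pmf (pois (a * r')) k \<le> (r' / r) ^ k * exp (a * r) * pmf (pois (a * r)) k" for k
  proof -
    have "exp (- (a * r')) \<le> 1" using assms by simp
    then have "exp (- (a * r')) * (a * r') ^ k / fact k \<le> 1 * (a * r') ^ k / fact k"
      using assms by (intro divide_right_mono mult_right_mono) auto
    also have "\<dots> = (r' / r) ^ k * exp (a * r) * (exp (- (a * r)) * (a * r) ^ k / fact k)"
      using assms by (simp add: power_mult_distrib power_divide exp_minus field_simps)
    finally show ?thesis using assms by (simp add: pmf_pois)
  qed
  have "(\<Prod>x\<in>A. pmf (pois (a * r')) (l x)) \<le> (\<Prod>x\<in>A. (r' / r) ^ (l x) * exp (a * r) * pmf (pois (a * r)) (l x))"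
    using le1 by (intro prod_mono) auto
  also have "\<dots> = (\<Prod>x\<in>A. (r' / r) ^ (l x)) * exp (a * r) ^ card A * (\<Prod>x\<in>A. pmf (pois (a * r)) (l x))"
    by (simp add: prod.distrib)
  also have "\<dots> \<le> r' / r * exp (\<kappa> * (a * r)) * (\<Prod>x\<in>A. pmf (pois (a * r)) (l x))"
  proof (intro mult_right_mono mult_mono prod_nonneg)
    have "(\<Prod>x\<in>A. (r' / r) ^ (l x)) = (r' / r) ^ (l x) * (\<Prod>x\<in>A - {x}. (r' / r) ^ (l x))"
      using assms by (intro prod.remove) auto
    also have "\<dots> \<le> (r' / r) ^ 1 * 1"
      using assms by (intro mult_mono power_decreasing prod_le_1 conjI power_le_one prod_nonneg) auto
    finally show "(\<Prod>x\<in>A. (r' / r) ^ (l x)) \<le> r' / r" by simp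
    have "exp (a * r) ^ card A = exp (real (card A) * (a * r))"
      by (simp add: exp_of_nat_mult)
    also have "\<dots> \<le> exp (\<kappa> * (a * r))"
      using assms by (simp add: mult_right_mono)
    finally show "exp (a * r) ^ card A \<le> exp (\<kappa> * (a * r))" .
  qed (use assms in auto)
  finally show ?thesis .
qed

section \<open>Coupling the counts in blocks of cells\<close>

definition stage_rel :: "'c set \<Rightarrow> (bool \<times> 'c \<Rightarrow> nat) \<Rightarrow> (bool \<times> 'c \<Rightarrow> nat) \<Rightarrow> bool" where
  "stage_rel g f f' \<longleftrightarrow> (\<forall>c\<in>g. f (True, c) \<le> f' (True, c) \<and> f' (False, c) \<le> f (False, c)) \<and>
     ((\<exists>c\<in>g. f (True, c) \<noteq> 0) \<longrightarrow> (\<forall>c\<in>g. f' (False, c) = 0))"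

definition count_pmf :: "real \<Rightarrow> real \<Rightarrow> real \<Rightarrow> 'c set \<Rightarrow> (bool \<times> 'c \<Rightarrow> nat) pmf" where
  "count_pmf a \<alpha> \<beta> g = Pi_pmf (UNIV \<times> g) 0 (\<lambda>(b, c). pois (a * (if b then \<alpha> else \<beta>)))"

text \<open>The tag \<open>True\<close> marks black, \<open>False\<close> white. This is
  \<open>star_coupling\<close> with \<open>z\<close> and \<open>y\<close> the empty configurations
  of the block. A nonempty configuration becomes less likely at the lower rate by about the ratio of
  the rates, whereas the other colour leaves the block empty with probability close to 1 for small
  \<open>a\<close>; \<open>small\<close> makes this precise.\<close>

lemma group_coupling:
  fixes g :: "'c set"
  assumes g: "finite g" "real (card g) \<le> \<kappa>"
    and rates: "0 < \<alpha>" "\<alpha> < \<alpha>'" "0 < \<beta>'" "\<beta>' < \<beta>" "0 < a"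
    and small: "\<alpha> / \<alpha>' * exp (\<kappa> * (a * (\<alpha>' + \<beta>'))) \<le> 1" "\<beta>' / \<beta> * exp (\<kappa> * (a * (\<alpha> + \<beta>))) \<le> 1"
  shows "rel_pmf (stage_rel g) (count_pmf a \<alpha> \<beta> g) (count_pmf a \<alpha>' \<beta>' g)"
proof -
  let ?A = "{True} \<times> g" and ?B = "{False} \<times> g"
  let ?P = "\<lambda>r. Pi_pmf ?A 0 (\<lambda>_. pois (a * r)) :: (bool \<times> 'c \<Rightarrow> nat) pmf"
  let ?S = "\<lambda>r. Pi_pmf ?B 0 (\<lambda>_. pois (a * r)) :: (bool \<times> 'c \<Rightarrow> nat) pmf"
  let ?h = "\<lambda>(f, f') x. if x \<in> ?A then f x else f' x"
  have fin: "finite ?A" "finite ?B" and card: "card ?A = card g" "card ?B = card g"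
    using g by (auto simp: card_cartesian_product)
  have split: "count_pmf a r q g = map_pmf ?h (pair_pmf (?P r) (?S q))" for r q
  proof -
    have "count_pmf a r q g = Pi_pmf (?A \<union> ?B) 0 (\<lambda>(b, c). pois (a * (if b then r else q)))"
      unfolding count_pmf_def by (rule arg_cong[where f="\<lambda>X. Pi_pmf X _ _"]) auto
    also have "\<dots> = map_pmf ?h (pair_pmf (Pi_pmf ?A 0 (\<lambda>(b, c). pois (a * (if b then r else q))))
        (Pi_pmf ?B 0 (\<lambda>(b, c). pois (a * (if b then r else q)))))"
      by (intro Pi_pmf_union fin) auto
    also have "Pi_pmf ?A 0 (\<lambda>(b, c). pois (a * (if b then r else q))) = ?P r"
      by (intro Pi_pmf_cong) auto
    also have "Pi_pmf ?B 0 (\<lambda>(b, c). pois (a * (if b then r else q))) = ?S q"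
      by (intro Pi_pmf_cong) auto
    finally show ?thesis .
  qed
  have zeroP: "pmf (?P r) (\<lambda>_. 0) = exp (- (real (card g) * (a * r)))"
    and zeroS: "pmf (?S r) (\<lambda>_. 0) = exp (- (real (card g) * (a * r)))" if "0 \<le> r" for r
    using that rates by (simp_all add: pmf_Pi' fin pmf_pois card exp_of_nat_mult[symmetric])
  \<comment> \<open>Here \<open>q\<close> is the rate of the other colour, and the exponential
    factor is the probability that this colour leaves the block empty.\<close>
  have key: "pmf (Pi_pmf X 0 (\<lambda>_. pois (a * r'))) f \<le> exp (- (real (card g) * (a * q))) * pmf (Pi_pmf X 0 (\<lambda>_. pois (a * r))) f"
    if X: "finite X" "card X = card g" "f \<noteq> (\<lambda>_. 0)" and r: "0 < r'" "r' < r" "0 < q"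
      "r' / r * exp (\<kappa> * (a * (r + q))) \<le> 1" for X :: "(bool \<times> 'c) set" and f r' r q
  proof (cases "\<forall>x. x \<notin> X \<longrightarrow> f x = 0")
    case True
    then obtain x where x: "x \<in> X" "f x \<noteq> 0" using X(3) by (metis ext)
    have "(\<Prod>x\<in>X. pmf (pois (a * r')) (f x)) \<le> r' / r * exp (\<kappa> * (a * r)) * (\<Prod>x\<in>X. pmf (pois (a * r)) (f x))"
      using X r g rates x by (intro prod_pmf_pois_le[where x=x]) auto
    also have "\<dots> \<le> exp (- (real (card g) * (a * q))) * (\<Prod>x\<in>X. pmf (pois (a * r)) (f x))"
    proof (intro mult_right_mono prod_nonneg)
      have "r' / r * exp (\<kappa> * (a * r)) = r' / r * exp (\<kappa> * (a * (r + q))) * exp (- (\<kappa> * (a * q)))"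
        by (simp add: mult_exp_exp algebra_simps)
      also have "\<dots> \<le> 1 * exp (- (\<kappa> * (a * q)))"
        using r by (intro mult_right_mono) auto
      also have "\<dots> \<le> exp (- (real (card g) * (a * q)))"
        using g r rates by (simp add: mult_right_mono)
      finally show "r' / r * exp (\<kappa> * (a * r)) \<le> exp (- (real (card g) * (a * q)))" .
    qed auto
    finally show ?thesis using True X by (simp add: pmf_Pi)
  qed (use X in \<open>auto simp: pmf_Pi_outside\<close>)
  have "rel_pmf (\<lambda>(k1, l1) (k2, l2). (k1 = k2 \<or> k1 = (\<lambda>_. 0)) \<and> (l2 = l1 \<or> l2 = (\<lambda>_. 0)) \<and> (k1 \<noteq> (\<lambda>_. 0) \<longrightarrow> l2 = (\<lambda>_. 0)))
      (pair_pmf (?P \<alpha>) (?S \<beta>)) (pair_pmf (?P \<alpha>') (?S \<beta>'))"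
  proof (rule star_coupling)
    show "0 < pmf (?P \<alpha>) (\<lambda>_. 0)" "0 < pmf (?S \<beta>) (\<lambda>_. 0)" using rates by (simp_all add: zeroP zeroS)
    show "pmf (?P \<alpha>) k \<le> pmf (?S \<beta>') (\<lambda>_. 0) * pmf (?P \<alpha>') k" if "k \<noteq> (\<lambda>_. 0)" for k
      using that rates small card fin by (simp add: zeroS key)
    show "pmf (?S \<beta>') k \<le> pmf (?P \<alpha>) (\<lambda>_. 0) * pmf (?S \<beta>) k" if "k \<noteq> (\<lambda>_. 0)" for k
      using that rates small card fin by (simp add: zeroP key add.commute)
  qed
  then show ?thesis
    unfolding split pmf.rel_map
    by (rule pmf.rel_mono_strong) (auto simp: stage_rel_def)
qed

text \<open>Different fibres of \<open>\<gamma>\<close> carry independent counts under both laws,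
  and \<open>stage_rel\<close> on a fibre looks at no coordinate outside it, so the block couplings
  can be glued one label at a time.\<close>

lemma partition_coupling:
  assumes I: "finite I" and \<gamma>: "\<And>g. real (card {c\<in>I. \<gamma> c = g}) \<le> \<kappa>"
    and rates: "0 < \<alpha>" "\<alpha> < \<alpha>'" "0 < \<beta>'" "\<beta>' < \<beta>" "0 < a"
    and small: "\<alpha> / \<alpha>' * exp (\<kappa> * (a * (\<alpha>' + \<beta>'))) \<le> 1" "\<beta>' / \<beta> * exp (\<kappa> * (a * (\<alpha> + \<beta>))) \<le> 1"
  shows "rel_pmf (\<lambda>f f'. \<forall>g\<in>\<gamma> ` I. stage_rel {c\<in>I. \<gamma> c = g} f f') (count_pmf a \<alpha> \<beta> I) (count_pmf a \<alpha>' \<beta>' I)"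
proof -
  have "rel_pmf (\<lambda>f f'. \<forall>g\<in>G. stage_rel {c\<in>I. \<gamma> c = g} f f')
      (count_pmf a \<alpha> \<beta> {c\<in>I. \<gamma> c \<in> G}) (count_pmf a \<alpha>' \<beta>' {c\<in>I. \<gamma> c \<in> G})" if "finite G" for G
    using that
  proof (induction G)
    case empty
    then show ?case by (simp add: count_pmf_def)
  next
    case (insert g G)
    have eq: "UNIV \<times> {c\<in>I. \<gamma> c \<in> insert g G} = UNIV \<times> {c\<in>I. \<gamma> c = g} \<union> UNIV \<times> {c\<in>I. \<gamma> c \<in> G}" by auto
    have 1: "rel_pmf (stage_rel {c\<in>I. \<gamma> c = g}) (count_pmf a \<alpha> \<beta> {c\<in>I. \<gamma> c = g}) (count_pmf a \<alpha>' \<beta>' {c\<in>I. \<gamma> c = g})"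
      using I by (intro group_coupling[OF _ \<gamma>] rates small) auto
    show ?case
      unfolding count_pmf_def eq
    proof (rule rel_Pi_pmf_union[OF _ _ _ 1[unfolded count_pmf_def] insert.IH[unfolded count_pmf_def]])
      fix f f' h h' :: "bool \<times> 'a \<Rightarrow> nat"
      assume f: "stage_rel {c \<in> I. \<gamma> c = g} f f'" and h: "\<forall>g\<in>G. stage_rel {c \<in> I. \<gamma> c = g} h h'"
      have "stage_rel {c \<in> I. \<gamma> c = g'} (\<lambda>x. if x \<in> UNIV \<times> {c \<in> I. \<gamma> c = g} then f x else h x)
          (\<lambda>x. if x \<in> UNIV \<times> {c \<in> I. \<gamma> c = g} then f' x else h' x) =
          (if g' = g then stage_rel {c \<in> I. \<gamma> c = g'} f f' else stage_rel {c \<in> I. \<gamma> c = g'} h h')" for g'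
        by (auto simp: stage_rel_def)
      then show "\<forall>g'\<in>insert g G. stage_rel {c \<in> I. \<gamma> c = g'} (\<lambda>x. if x \<in> UNIV \<times> {c \<in> I. \<gamma> c = g} then f x else h x)
          (\<lambda>x. if x \<in> UNIV \<times> {c \<in> I. \<gamma> c = g} then f' x else h' x)"
        using f h insert.hyps by auto
    qed (use I insert.hyps in auto)
  qed
  from this[of "\<gamma> ` I"] show ?thesis using I by (simp cong: conj_cong)
qed

definition separated :: "('c \<Rightarrow> 'g) set \<Rightarrow> 'c set \<Rightarrow> (bool \<times> 'c \<Rightarrow> nat) \<Rightarrow> (bool \<times> 'c \<Rightarrow> nat) \<Rightarrow> bool" where
  "separated \<Gamma> I f f' \<longleftrightarrow> (\<forall>c\<in>I. f (True, c) \<le> f' (True, c) \<and> f' (False, c) \<le> f (False, c)) \<and>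
     (\<forall>\<gamma>\<in>\<Gamma>. \<forall>c\<in>I. \<forall>c'\<in>I. \<gamma> c = \<gamma> c' \<longrightarrow> f (True, c) \<noteq> 0 \<longrightarrow> f' (False, c') = 0)"

text \<open>Monotonicity carries both kinds of separation through the other stage: a white cell
  emptied in the first stage stays empty because white counts only decrease, and a black cell
  occupied at the start is still occupied before the second stage because black counts only
  increase.\<close>

lemma separated_compose:
  assumes f: "separated \<Gamma> I f f'" and f': "separated \<Gamma>' I f' f''"
  shows "separated (\<Gamma> \<union> \<Gamma>') I f f''"
proof -
  have mono: "f (True, c) \<le> f' (True, c)" "f' (True, c) \<le> f'' (True, c)"
    "f' (False, c) \<le> f (False, c)" "f'' (False, c) \<le> f' (False, c)" if "c \<in> I" for c
    using f f' that by (auto simp: separated_def)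
  have "f'' (False, c') = 0" if "\<gamma> \<in> \<Gamma> \<union> \<Gamma>'" "c \<in> I" "c' \<in> I" "\<gamma> c = \<gamma> c'" "f (True, c) \<noteq> 0" for \<gamma> c c'
    using that(1)
  proof
    assume "\<gamma> \<in> \<Gamma>"
    then have "f' (False, c') = 0" using f that unfolding separated_def by blast
    then show ?thesis using mono[OF that(3)] by simp
  next
    assume "\<gamma> \<in> \<Gamma>'"
    moreover have "f' (True, c) \<noteq> 0" using mono[OF that(2)] that(5) by simp
    ultimately show ?thesis using f' that unfolding separated_def by blast
  qed
  then show ?thesis
    unfolding separated_def using mono order_trans by blast
qed

text \<open>As \<open>a\<close> tends to 0 the exponentials tend to 1, and the strict gaps between
  the rates leave room for them. The bound \<open>a0\<close> does not depend on \<open>I\<close>;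
  this matters because the number of cells grows with \<open>s\<close>.\<close>

lemma separated_single_coupling:
  assumes \<kappa>: "0 < \<kappa>" and rates: "0 < \<alpha>" "\<alpha> < \<alpha>'" "0 < \<beta>'" "\<beta>' < \<beta>"
  shows "\<exists>a0>0. \<forall>a (I :: 'c set) (\<gamma> :: 'c \<Rightarrow> 'g). 0 < a \<longrightarrow> a \<le> a0 \<longrightarrow> finite I \<longrightarrow>
       (\<forall>g. real (card {c\<in>I. \<gamma> c = g}) \<le> \<kappa>) \<longrightarrow>
       rel_pmf (separated {\<gamma>} I) (count_pmf a \<alpha> \<beta> I) (count_pmf a \<alpha>' \<beta>' I)"
proof -
  have small: "\<exists>a0>0. \<forall>a\<le>a0. c * exp (\<kappa> * (a * d)) \<le> 1" if "0 < c" "c < 1" "0 < d" for c d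
  proof (intro exI[of _ "ln (1 / c) / (\<kappa> * d)"] conjI allI impI)
    show "0 < ln (1 / c) / (\<kappa> * d)" using that \<kappa> by simp
    fix a assume "a \<le> ln (1 / c) / (\<kappa> * d)"
    then have "\<kappa> * (a * d) \<le> ln (1 / c)" using that \<kappa> by (simp add: field_simps)
    then have "exp (\<kappa> * (a * d)) \<le> 1 / c"
      using that by (metis exp_le_cancel_iff exp_ln zero_less_divide_1_iff)
    then show "c * exp (\<kappa> * (a * d)) \<le> 1" using that by (simp add: field_simps)
  qed
  obtain a1 where a1: "0 < a1" "\<And>a. a \<le> a1 \<Longrightarrow> \<alpha> / \<alpha>' * exp (\<kappa> * (a * (\<alpha>' + \<beta>'))) \<le> 1"
    using small[of "\<alpha> / \<alpha>'" "\<alpha>' + \<beta>'"] rates by auto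
  obtain a2 where a2: "0 < a2" "\<And>a. a \<le> a2 \<Longrightarrow> \<beta>' / \<beta> * exp (\<kappa> * (a * (\<alpha> + \<beta>))) \<le> 1"
    using small[of "\<beta>' / \<beta>" "\<alpha> + \<beta>"] rates by auto
  show ?thesis
  proof (intro exI[of _ "min a1 a2"] conjI allI impI)
    fix a and I :: "'c set" and \<gamma> :: "'c \<Rightarrow> 'g"
    assume "0 < a" "a \<le> min a1 a2" "finite I" "\<forall>g. real (card {c\<in>I. \<gamma> c = g}) \<le> \<kappa>"
    then have "rel_pmf (\<lambda>f f'. \<forall>g\<in>\<gamma> ` I. stage_rel {c\<in>I. \<gamma> c = g} f f') (count_pmf a \<alpha> \<beta> I) (count_pmf a \<alpha>' \<beta>' I)"
      using a1 a2 rates by (intro partition_coupling[where \<kappa>=\<kappa>]) auto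
    then show "rel_pmf (separated {\<gamma>} I) (count_pmf a \<alpha> \<beta> I) (count_pmf a \<alpha>' \<beta>' I)"
      by (rule pmf.rel_mono_strong) (fastforce simp: stage_rel_def separated_def)
  qed (use a1 a2 in auto)
qed

text \<open>Each tiling gets its own stage. The induction starts at one tiling, whose stage has to
  bridge the whole gap of rates.\<close>

lemma separated_coupling:
  assumes "0 < \<kappa>" "0 < \<alpha>" "\<alpha> < \<alpha>'" "0 < \<beta>'" "\<beta>' < \<beta>"
  shows "\<exists>a0>0. \<forall>a (I :: 'c set) (\<gamma>s :: ('c \<Rightarrow> 'g) list). 0 < a \<longrightarrow> a \<le> a0 \<longrightarrow> finite I \<longrightarrow> length \<gamma>s = Suc n \<longrightarrow>
       (\<forall>\<gamma>\<in>set \<gamma>s. \<forall>g. real (card {c\<in>I. \<gamma> c = g}) \<le> \<kappa>) \<longrightarrow>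
       rel_pmf (separated (set \<gamma>s) I) (count_pmf a \<alpha> \<beta> I) (count_pmf a \<alpha>' \<beta>' I)"
  using assms
proof (induction n arbitrary: \<alpha> \<beta>)
  case 0
  from separated_single_coupling[OF 0, where 'c='c and 'g='g] obtain a0 where "0 < a0"
    and a0: "\<And>a (I :: 'c set) (\<gamma> :: 'c \<Rightarrow> 'g). 0 < a \<Longrightarrow> a \<le> a0 \<Longrightarrow> finite I \<Longrightarrow>
       (\<forall>g. real (card {c\<in>I. \<gamma> c = g}) \<le> \<kappa>) \<Longrightarrow>
       rel_pmf (separated {\<gamma>} I) (count_pmf a \<alpha> \<beta> I) (count_pmf a \<alpha>' \<beta>' I)" by blast
  show ?case
    by (intro exI[of _ a0] conjI \<open>0 < a0\<close>) (auto simp: length_Suc_conv intro!: a0)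
next
  case (Suc n)
  \<comment> \<open>Any intermediate rates would do; the midpoints leave a strict gap both for this
    stage and for the remaining ones.\<close>
  define \<alpha>m where "\<alpha>m = (\<alpha> + \<alpha>') / 2"
  define \<beta>m where "\<beta>m = (\<beta> + \<beta>') / 2"
  have m: "0 < \<alpha>m" "\<alpha> < \<alpha>m" "\<alpha>m < \<alpha>'" "0 < \<beta>m" "\<beta>m < \<beta>" "\<beta>' < \<beta>m"
    using Suc.prems by (auto simp: \<alpha>m_def \<beta>m_def)
  from separated_single_coupling[of \<kappa> \<alpha> \<alpha>m \<beta>m \<beta>, where 'c='c and 'g='g] m Suc.prems obtain a1 where "0 < a1"
    and a1: "\<And>a (I :: 'c set) (\<gamma> :: 'c \<Rightarrow> 'g). 0 < a \<Longrightarrow> a \<le> a1 \<Longrightarrow> finite I \<Longrightarrow>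
       (\<forall>g. real (card {c\<in>I. \<gamma> c = g}) \<le> \<kappa>) \<Longrightarrow>
       rel_pmf (separated {\<gamma>} I) (count_pmf a \<alpha> \<beta> I) (count_pmf a \<alpha>m \<beta>m I)" by blast
  from Suc.IH[of \<alpha>m \<beta>m] m Suc.prems obtain a2 where "0 < a2"
    and a2: "\<And>a (I :: 'c set) (\<gamma>s :: ('c \<Rightarrow> 'g) list). 0 < a \<Longrightarrow> a \<le> a2 \<Longrightarrow> finite I \<Longrightarrow> length \<gamma>s = Suc n \<Longrightarrow>
       (\<forall>\<gamma>\<in>set \<gamma>s. \<forall>g. real (card {c\<in>I. \<gamma> c = g}) \<le> \<kappa>) \<Longrightarrow>
       rel_pmf (separated (set \<gamma>s) I) (count_pmf a \<alpha>m \<beta>m I) (count_pmf a \<alpha>' \<beta>' I)" by blast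
  show ?case
  proof (intro exI[of _ "min a1 a2"] conjI allI impI)
    fix a and I :: "'c set" and \<gamma>s :: "('c \<Rightarrow> 'g) list"
    assume a: "0 < a" "a \<le> min a1 a2" "finite I" "length \<gamma>s = Suc (Suc n)"
      "\<forall>\<gamma>\<in>set \<gamma>s. \<forall>g. real (card {c\<in>I. \<gamma> c = g}) \<le> \<kappa>"
    then obtain \<gamma> \<gamma>s' where \<gamma>s: "\<gamma>s = \<gamma> # \<gamma>s'" "length \<gamma>s' = Suc n" by (auto simp: length_Suc_conv)
    have "rel_pmf (separated {\<gamma>} I OO separated (set \<gamma>s') I) (count_pmf a \<alpha> \<beta> I) (count_pmf a \<alpha>' \<beta>' I)"
      unfolding pmf.rel_compp using a1[of a I \<gamma>] a2[of a I \<gamma>s'] a \<gamma>s by auto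
    then show "rel_pmf (separated (set \<gamma>s) I) (count_pmf a \<alpha> \<beta> I) (count_pmf a \<alpha>' \<beta>' I)"
      by (rule pmf.rel_mono_strong)
         (use \<gamma>s separated_compose[of "{\<gamma>}" I _ _ "set \<gamma>s'"] in \<open>auto simp: relcompp_apply\<close>)
  qed (use \<open>0 < a1\<close> \<open>0 < a2\<close> in auto)
qed

section \<open>Poisson splitting\<close>

definition cube :: "pt set" where
  "cube = {0..<1} \<times> {0..<1} \<times> {0..<1}"

definition unif :: "pt measure" where
  "unif = uniform_measure lborel cube"

lemma emeasure_lborel_Times:
  fixes A :: "'a::euclidean_space set" and B :: "'b::euclidean_space set"
  assumes "A \<in> sets borel" "B \<in> sets borel"
  shows "emeasure lborel (A \<times> B) = emeasure lborel A * emeasure lborel B"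
  using assms by (simp add: lborel_prod[symmetric] lborel.emeasure_pair_measure_Times)

lemma sets_cube [measurable]: "cube \<in> sets borel"
  unfolding cube_def by (simp add: borel_prod[symmetric])

lemma emeasure_cube: "emeasure lborel cube = 1"
  unfolding cube_def by (simp add: emeasure_lborel_Times borel_prod[symmetric])

lemma sets_unif [measurable_cong, simp]: "sets unif = sets borel"
  by (simp add: unif_def)

lemma space_unif [simp]: "space unif = UNIV"
  by (simp add: unif_def)

lemma prob_space_unif: "prob_space unif"
  unfolding unif_def by (rule prob_space_uniform_measure) (simp_all add: emeasure_cube)

interpretation unif: prob_space unif
  by (rule prob_space_unif)

interpretation unif_seq: sequence_space unif
  by standard

definition seqs0 :: "(nat \<Rightarrow> pt) measure" where
  "seqs0 = (\<Pi>\<^sub>M i\<in>UNIV. unif)"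

definition good :: "(nat \<Rightarrow> pt) set" where
  "good = {z. (\<forall>i. z i \<in> cube) \<and> inj z}"

interpretation seqs0: prob_space seqs0
  unfolding seqs0_def by (intro prob_space_PiM prob_space_unif)

lemma space_seqs0 [simp]: "space seqs0 = UNIV"
  by (simp add: seqs0_def space_PiM)

lemma measurable_seqs0_component [measurable]: "(\<lambda>z. z i) \<in> seqs0 \<rightarrow>\<^sub>M borel"
proof -
  have "(\<lambda>z. z i) \<in> seqs0 \<rightarrow>\<^sub>M unif"
    unfolding seqs0_def by measurable
  then show ?thesis by (simp cong: measurable_cong_sets)
qed

lemma measurable_case_nat_seqs0 [measurable]: "(\<lambda>(x, z). case_nat x z) \<in> unif \<Otimes>\<^sub>M seqs0 \<rightarrow>\<^sub>M seqs0"
  unfolding seqs0_def by measurable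

lemma seqs0_iter: "distr (unif \<Otimes>\<^sub>M seqs0) seqs0 (\<lambda>(x, z). case_nat x z) = seqs0"
  unfolding seqs0_def by (rule unif_seq.PiM_iter)

interpretation unif_seqs0: pair_prob_space unif seqs0
  by standard

lemma sets_seqs0_neq: "{z. z i \<noteq> z j} \<in> sets seqs0"
proof -
  have "{z \<in> space seqs0. dist (z i) (z j) \<noteq> 0} \<in> sets seqs0" by measurable
  then show ?thesis by simp
qed

text \<open>By \<open>seqs0_iter\<close> a sequence is a first point followed by an independent
  sequence of the same law. Peeling off first points reduces the claim to \<open>i = 0\<close>,
  where Fubini applies and a fixed point is a Lebesgue null set.\<close>

lemma AE_seqs0_neq: "i < j \<Longrightarrow> AE z in seqs0. z i \<noteq> z j"
proof (induction i arbitrary: j)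
  case 0
  then obtain k where j: "j = Suc k" by (cases j) auto
  have neq: "AE z in seqs0. z k \<noteq> x" for x
    unfolding seqs0_def
  proof (rule AE_PiM_component)
    from AE_lborel_singleton[of x] have "AE x' in lborel. x' \<in> cube \<longrightarrow> x' \<noteq> x"
      by eventually_elim simp
    then show "AE x' in unif. x' \<noteq> x" unfolding unif_def
      by (simp add: AE_uniform_measure emeasure_cube)
  qed (auto simp: prob_space_unif)
  have "AE p in unif \<Otimes>\<^sub>M seqs0. dist (fst p) (snd p k) \<noteq> 0"
  proof (rule unif_seqs0.AE_pair_measure)
    have "fst \<in> unif \<Otimes>\<^sub>M seqs0 \<rightarrow>\<^sub>M borel"
      unfolding measurable_cong_sets[OF refl sets_unif, symmetric] by (rule measurable_fst)
    then have "(\<lambda>p. dist (fst p) (snd p k)) \<in> borel_measurable (unif \<Otimes>\<^sub>M seqs0)"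
      by (intro borel_measurable_dist measurable_compose[OF measurable_snd measurable_seqs0_component])
    then show "{p \<in> space (unif \<Otimes>\<^sub>M seqs0). dist (fst p) (snd p k) \<noteq> 0} \<in> sets (unif \<Otimes>\<^sub>M seqs0)"
      by (rule borel_measurable_neq) simp
    show "AE x in unif. AE z in seqs0. dist (fst (x, z)) (snd (x, z) k) \<noteq> 0"
    proof (rule AE_I2)
      fix x
      show "AE z in seqs0. dist (fst (x, z)) (snd (x, z) k) \<noteq> 0"
        using neq[of x] by eventually_elim simp
    qed
  qed
  then have "AE p in unif \<Otimes>\<^sub>M seqs0. (\<lambda>(x, z). case_nat x z) p 0 \<noteq> (\<lambda>(x, z). case_nat x z) p j"
    by (simp add: j case_prod_unfold)
  then have "AE z in distr (unif \<Otimes>\<^sub>M seqs0) seqs0 (\<lambda>(x, z). case_nat x z). z 0 \<noteq> z j"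
    using sets_seqs0_neq by (subst AE_distr_iff) auto
  then show ?case by (simp only: seqs0_iter)
next
  case (Suc i)
  then obtain k where j: "j = Suc k" "i < k" by (cases j) auto
  have "AE p in unif \<Otimes>\<^sub>M seqs0. snd p i \<noteq> snd p k"
  proof (rule unif_seqs0.AE_pair_measure)
    have "snd -` {z. z i \<noteq> z k} \<inter> space (unif \<Otimes>\<^sub>M seqs0) \<in> sets (unif \<Otimes>\<^sub>M seqs0)"
      by (rule measurable_sets[OF measurable_snd sets_seqs0_neq])
    also have "snd -` {z. z i \<noteq> z k} \<inter> space (unif \<Otimes>\<^sub>M seqs0) = {p \<in> space (unif \<Otimes>\<^sub>M seqs0). snd p i \<noteq> snd p k}"
      by auto
    finally show "{p \<in> space (unif \<Otimes>\<^sub>M seqs0). snd p i \<noteq> snd p k} \<in> sets (unif \<Otimes>\<^sub>M seqs0)" .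
  qed (use Suc.IH[OF j(2)] in simp)
  then have "AE p in unif \<Otimes>\<^sub>M seqs0. (\<lambda>(x, z). case_nat x z) p (Suc i) \<noteq> (\<lambda>(x, z). case_nat x z) p j"
    by (simp add: j case_prod_unfold)
  then have "AE z in distr (unif \<Otimes>\<^sub>M seqs0) seqs0 (\<lambda>(x, z). case_nat x z). z (Suc i) \<noteq> z j"
    using sets_seqs0_neq by (subst AE_distr_iff) auto
  then show ?case by (simp only: seqs0_iter)
qed

lemma AE_seqs0_good: "AE z in seqs0. z \<in> good"
proof -
  have "AE z in seqs0. z i \<in> cube" for i
    unfolding seqs0_def
  proof (rule AE_PiM_component)
    show "AE x in unif. x \<in> cube" unfolding unif_def
      by (simp add: AE_uniform_measure emeasure_cube)
  qed (auto simp: prob_space_unif)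
  then have "AE z in seqs0. \<forall>i. z i \<in> cube" by (simp add: AE_all_countable)
  moreover have "AE z in seqs0. \<forall>i j. i < j \<longrightarrow> z i \<noteq> z j"
    using AE_seqs0_neq by (simp add: AE_all_countable AE_impI)
  ultimately show ?thesis
    by eventually_elim (auto simp: good_def inj_def, metis linorder_neqE_nat)
qed

lemma sets_good [measurable]: "good \<in> sets seqs0"
proof -
  have "good = {z \<in> space seqs0. (\<forall>i. z i \<in> cube) \<and> (\<forall>i j. i \<noteq> j \<longrightarrow> dist (z i) (z j) \<noteq> 0)}"
    by (auto simp: good_def inj_def)
  also have "\<dots> \<in> sets seqs0" by measurable
  finally show ?thesis .
qed

text \<open>Restricting to injective sequences makes the cardinality of a configuration equal to its number
  of points everywhere, not only almost surely.\<close>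
definition seqs :: "(nat \<Rightarrow> pt) measure" where
  "seqs = restrict_space seqs0 good"

lemma space_seqs: "space seqs = good"
  by (simp add: seqs_def space_restrict_space)

lemma prob_space_seqs: "prob_space seqs"
  unfolding seqs_def using AE_seqs0_good
  by (intro prob_space_restrict_space sets_good seqs0.emeasure_eq_1_AE)

interpretation seqs: prob_space seqs
  by (rule prob_space_seqs)

lemma measurable_seqs_component [measurable]: "(\<lambda>z. z i) \<in> seqs \<rightarrow>\<^sub>M borel"
  unfolding seqs_def by (rule measurable_restrict_space1) measurable

lemma measure_seqs:
  assumes [measurable]: "Measurable.pred seqs0 P"
  shows "measure seqs {z \<in> space seqs. P z} = measure seqs0 {z. P z}"
proof -
  have "measure seqs {z \<in> space seqs. P z} = measure seqs0 {z \<in> good. P z}"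
    unfolding space_seqs by (simp add: seqs_def measure_restrict_space)
  also have "\<dots> = measure seqs0 {z. P z}"
  proof (rule seqs0.finite_measure_eq_AE)
    show "AE z in seqs0. z \<in> {z \<in> good. P z} \<longleftrightarrow> z \<in> {z. P z}"
      using AE_seqs0_good by eventually_elim auto
    show "{z \<in> good. P z} \<in> sets seqs0" "{z. P z} \<in> sets seqs0"
      using assms sets.Int[OF sets_good, of "{z \<in> space seqs0. P z}"]
      by (auto simp: pred_def Int_def)
  qed
  finally show ?thesis .
qed

definition cnt :: "(pt \<Rightarrow> 'k) \<Rightarrow> nat \<Rightarrow> (nat \<Rightarrow> pt) \<Rightarrow> 'k \<Rightarrow> nat" where
  "cnt \<kappa> n z a = card {i. i < n \<and> \<kappa> (z i) = a}"

lemma cnt_eq_sum: "cnt \<kappa> n z a = (\<Sum>i<n. if \<kappa> (z i) = a then 1 else 0)"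
  by (simp add: cnt_def sum.If_cases Int_def)

lemma cnt_0 [simp]: "cnt \<kappa> 0 z a = 0"
  by (simp add: cnt_def)

lemma cnt_case_nat: "cnt \<kappa> (Suc n) (case_nat x z) a = (if \<kappa> x = a then 1 else 0) + cnt \<kappa> n z a"
  by (simp add: cnt_eq_sum sum.lessThan_Suc_shift del: sum.lessThan_Suc)

lemma measurable_cnt0 [measurable]:
  assumes [measurable]: "\<kappa> \<in> borel \<rightarrow>\<^sub>M count_space UNIV"
  shows "(\<lambda>z. cnt \<kappa> n z a) \<in> seqs0 \<rightarrow>\<^sub>M count_space UNIV"
  unfolding cnt_eq_sum by measurable

lemma measurable_cnt [measurable]:
  assumes [measurable]: "\<kappa> \<in> borel \<rightarrow>\<^sub>M count_space UNIV"
  shows "(\<lambda>z. cnt \<kappa> n z a) \<in> seqs \<rightarrow>\<^sub>M count_space UNIV"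
  unfolding seqs_def by (rule measurable_restrict_space1) measurable

text \<open>The multinomial law, by conditioning on the class of the first point.\<close>

lemma multinomial_seqs0:
  assumes K: "finite K" "\<And>x. \<kappa> x \<in> K" and [measurable]: "\<kappa> \<in> borel \<rightarrow>\<^sub>M count_space UNIV"
  shows "measure seqs0 {z. \<forall>a\<in>K. cnt \<kappa> n z a = c a} =
    (if sum c K = n then fact n * (\<Prod>a\<in>K. measure unif {x. \<kappa> x = a} ^ c a / fact (c a)) else 0)"
proof (induction n arbitrary: c)
  case 0
  show ?case
  proof (cases "\<forall>a\<in>K. c a = 0")
    case True
    then show ?thesis using seqs0.prob_space by simp
  next
    case False
    then have "{z::nat \<Rightarrow> pt. \<forall>a\<in>K. cnt \<kappa> 0 z a = c a} = {}" by auto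
    moreover have "sum c K \<noteq> 0" using False K by simp
    ultimately show ?thesis by (simp del: sum_eq_0_iff)
  qed
next
  case (Suc n)
  define q where "q a = measure unif {x. \<kappa> x = a}" for a
  have q_nonneg: "0 \<le> q a" for a by (simp add: q_def)
  define E where "E n c = {z. \<forall>a\<in>K. cnt \<kappa> n z a = c a}" for n c
  have E_sets [measurable]: "E n c \<in> sets seqs0" for n c
  proof -
    have "E n c = {z \<in> space seqs0. \<forall>a\<in>K. cnt \<kappa> n z a = c a}" by (simp add: E_def)
    also have "\<dots> \<in> sets seqs0" using K by measurable
    finally show ?thesis .
  qed
  \<comment> \<open>The probability that the other \<open>n\<close> points complete the counts
    \<open>c\<close> after a first point of class \<open>b\<close>; this is impossible if
    \<open>c b = 0\<close>.\<close>
  define g where "g b = (if c b = 0 then 0 else measure seqs0 (E n (c(b := c b - 1))))" for b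
  have g_nonneg: "0 \<le> g b" for b by (simp add: g_def)
  have "emeasure seqs0 (E (Suc n) c)
      = emeasure (unif \<Otimes>\<^sub>M seqs0) ((\<lambda>(x, z). case_nat x z) -` E (Suc n) c \<inter> space (unif \<Otimes>\<^sub>M seqs0))"
    by (subst seqs0_iter[symmetric], subst emeasure_distr) auto
  also have "\<dots> = (\<integral>\<^sup>+x. emeasure seqs0 (Pair x -` ((\<lambda>(x, z). case_nat x z) -` E (Suc n) c \<inter> space (unif \<Otimes>\<^sub>M seqs0))) \<partial>unif)"
    by (rule seqs0.emeasure_pair_measure_alt) measurable
  also have "\<dots> = (\<integral>\<^sup>+x. (\<Sum>b\<in>K. ennreal (g b) * indicator {x. \<kappa> x = b} x) \<partial>unif)"
  proof (rule nn_integral_cong)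
    fix x
    have "Pair x -` ((\<lambda>(x, z). case_nat x z) -` E (Suc n) c \<inter> space (unif \<Otimes>\<^sub>M seqs0))
        = {z. \<forall>a\<in>K. (if \<kappa> x = a then 1 else 0) + cnt \<kappa> n z a = c a}"
      by (auto simp: E_def cnt_case_nat space_pair_measure)
    also have "\<dots> = (if c (\<kappa> x) = 0 then {} else E n (c(\<kappa> x := c (\<kappa> x) - 1)))"
      using K(2)[of x] by (cases "c (\<kappa> x)") (auto simp: E_def intro!: bexI[of _ "\<kappa> x"])
    also have "emeasure seqs0 \<dots> = ennreal (g (\<kappa> x))"
      by (simp add: g_def seqs0.emeasure_eq_measure)
    also have "\<dots> = (\<Sum>b\<in>K. if b = \<kappa> x then ennreal (g b) else 0)"
      using K by simp
    also have "\<dots> = (\<Sum>b\<in>K. ennreal (g b) * indicator {x. \<kappa> x = b} x)"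
      by (intro sum.cong) auto
    finally show "emeasure seqs0 (Pair x -` ((\<lambda>(x, z). case_nat x z) -` E (Suc n) c \<inter> space (unif \<Otimes>\<^sub>M seqs0)))
      = (\<Sum>b\<in>K. ennreal (g b) * indicator {x. \<kappa> x = b} x)" .
  qed
  also have "\<dots> = (\<Sum>b\<in>K. ennreal (g b) * emeasure unif {x. \<kappa> x = b})"
  proof -
    have m: "{x. \<kappa> x = b} \<in> sets unif" for b
    proof -
      have "{x \<in> space borel. \<kappa> x = b} \<in> sets borel" by measurable
      then show ?thesis by simp
    qed
    show ?thesis
      using m by (subst nn_integral_sum)
        (auto simp: nn_integral_cmult_indicator simp del: sets_unif intro!: borel_measurable_times_ennreal borel_measurable_indicator)
  qed
  also have "\<dots> = ennreal (\<Sum>b\<in>K. g b * q b)"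
    by (simp add: unif.emeasure_eq_measure q_def g_nonneg ennreal_mult[symmetric])
  finally have rec: "measure seqs0 (E (Suc n) c) = (\<Sum>b\<in>K. g b * q b)"
    by (simp add: seqs0.emeasure_eq_measure sum_nonneg g_nonneg q_nonneg)
  let ?P = "\<Prod>a\<in>K. q a ^ c a / fact (c a)"
  \<comment> \<open>Each class contributes in proportion to \<open>c b\<close>; the sum over all
    classes turns \<open>fact n\<close> into \<open>fact (Suc n)\<close>.\<close>
  have gq: "g b * q b = (if sum c K = Suc n then fact n * ?P * real (c b) else 0)" if b: "b \<in> K" for b
  proof (cases "c b = 0")
    case False
    then obtain k where k: "c b = Suc k" by (cases "c b") auto
    have sum: "sum (c(b := k)) K = sum c K - 1" and pos: "sum c K \<ge> 1"
      using sum.remove[OF K(1) b, of c] sum.remove[OF K(1) b, of "c(b := k)"] k by auto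
    have "(\<Prod>a\<in>K. q a ^ (c(b := k)) a / fact ((c(b := k)) a)) * q b = ?P * real (c b)"
    proof -
      have "(\<Prod>a\<in>K - {b}. q a ^ (c(b := k)) a / fact ((c(b := k)) a)) = (\<Prod>a\<in>K - {b}. q a ^ c a / fact (c a))"
        by (intro prod.cong) auto
      then show ?thesis
        unfolding prod.remove[OF K(1) b] using k by (simp del: of_nat_Suc)
    qed
    then show ?thesis
      using k sum pos Suc.IH[of "c(b := k)"] by (auto simp: g_def E_def q_def)
  qed (simp add: g_def)
  have "measure seqs0 (E (Suc n) c) = (if sum c K = Suc n then fact (Suc n) * ?P else 0)"
  proof (cases "sum c K = Suc n")
    case True
    then have "measure seqs0 (E (Suc n) c) = (\<Sum>b\<in>K. fact n * ?P * real (c b))"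
      unfolding rec by (intro sum.cong refl) (simp add: gq)
    also have "\<dots> = fact n * ?P * real (sum c K)"
      unfolding of_nat_sum by (rule sum_distrib_left[symmetric])
    finally show ?thesis
      using True by (simp add: fact_Suc mult_ac del: of_nat_Suc)
  next
    case False
    then show ?thesis
      unfolding rec by (simp add: gq)
  qed
  then show ?case by (simp only: E_def q_def)
qed


section \<open>Class counts of a Poisson number of uniform points\<close>

definition marked :: "(nat \<times> (nat \<Rightarrow> pt)) measure" where
  "marked = count_space UNIV \<Otimes>\<^sub>M seqs"

lemma space_marked: "space marked = UNIV \<times> good"
  by (simp add: marked_def space_pair_measure space_seqs)

lemma sets_pmf_seqs [simp, measurable_cong]: "sets (measure_pmf p \<Otimes>\<^sub>M seqs) = sets marked"
  unfolding marked_def by (rule sets_pair_measure_cong) auto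

lemma space_pmf_seqs [simp]: "space (measure_pmf p \<Otimes>\<^sub>M seqs) = space marked"
  using sets_pmf_seqs by (rule sets_eq_imp_space_eq)

lemma measurable_marked_fst [measurable]: "fst \<in> marked \<rightarrow>\<^sub>M count_space UNIV"
  and measurable_marked_snd [measurable]: "snd \<in> marked \<rightarrow>\<^sub>M seqs"
  unfolding marked_def by measurable

lemma measurable_marked_cnt [measurable]:
  assumes [measurable]: "\<kappa> \<in> borel \<rightarrow>\<^sub>M count_space UNIV"
  shows "(\<lambda>p. cnt \<kappa> (fst p) (snd p) a) \<in> marked \<rightarrow>\<^sub>M count_space UNIV"
  by (rule measurable_compose_countable[where f="\<lambda>n p. cnt \<kappa> n (snd p) a"]) measurable

lemma emeasure_pmf_seqs:
  assumes "A \<in> sets marked"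
  shows "emeasure (measure_pmf p \<Otimes>\<^sub>M seqs) A = (\<integral>\<^sup>+n. emeasure seqs (Pair n -` A) \<partial>p)"
  using assms by (intro seqs.emeasure_pair_measure_alt) simp

text \<open>The prescribed counts force the number of points to be their sum. The factorial of the
  multinomial formula then cancels against the Poisson weight, and \<open>exp (- m)\<close> splits
  over the classes because their probabilities add up to 1.\<close>

lemma poisson_splitting:
  assumes K: "finite K" "\<And>x. \<kappa> x \<in> K" and \<kappa> [measurable]: "\<kappa> \<in> borel \<rightarrow>\<^sub>M count_space UNIV" and m: "0 \<le> m"
  shows "emeasure (measure_pmf (pois m) \<Otimes>\<^sub>M seqs) {p \<in> space marked. \<forall>a\<in>K. cnt \<kappa> (fst p) (snd p) a = c a}
     = (\<Prod>a\<in>K. ennreal (pmf (pois (m * measure unif {x. \<kappa> x = a})) (c a)))"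
proof -
  define q where "q a = measure unif {x. \<kappa> x = a}" for a
  let ?N = "sum c K"
  define e where "e = fact ?N * (\<Prod>a\<in>K. q a ^ c a / fact (c a))"
  have e_nonneg: "0 \<le> e" by (auto simp: e_def q_def intro!: mult_nonneg_nonneg prod_nonneg)
  let ?A = "{p \<in> space marked. \<forall>a\<in>K. cnt \<kappa> (fst p) (snd p) a = c a}"
  have A: "?A \<in> sets marked" using K by measurable
  have "emeasure seqs (Pair n -` ?A) = ennreal e * indicator {?N} n" for n
  proof -
    have "Pair n -` ?A = {z \<in> space seqs. \<forall>a\<in>K. cnt \<kappa> n z a = c a}"
      by (auto simp: space_marked space_seqs)
    also have "emeasure seqs \<dots> = ennreal (measure seqs0 {z. \<forall>a\<in>K. cnt \<kappa> n z a = c a})"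
      unfolding seqs.emeasure_eq_measure using K by (subst measure_seqs) auto
    also have "\<dots> = ennreal e * indicator {?N} n"
      unfolding multinomial_seqs0[OF K \<kappa>] by (auto simp: e_def q_def)
    finally show ?thesis .
  qed
  then have "emeasure (measure_pmf (pois m) \<Otimes>\<^sub>M seqs) ?A = ennreal e * emeasure (pois m) {?N}"
    unfolding emeasure_pmf_seqs[OF A] by (simp add: nn_integral_cmult)
  also have "\<dots> = ennreal (e * pmf (pois m) ?N)"
    by (simp add: emeasure_pmf_single ennreal_mult e_nonneg)
  also have "e * pmf (pois m) ?N = (\<Prod>a\<in>K. exp (- (m * q a)) * (m * q a) ^ c a / fact (c a))"
  proof -
    have "(\<Sum>a\<in>K. q a) = measure unif (\<Union>a\<in>K. {x. \<kappa> x = a})"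
    proof -
      have "{x \<in> space borel. \<kappa> x = a} \<in> sets borel" for a by measurable
      then have "{x. \<kappa> x = a} \<in> sets borel" for a by simp
      then show ?thesis
        unfolding q_def using K
        by (intro unif.finite_measure_finite_Union[symmetric]) (auto simp: disjoint_family_on_def)
    qed
    also have "(\<Union>a\<in>K. {x. \<kappa> x = a}) = UNIV" using K by auto
    finally have "(\<Sum>a\<in>K. m * q a) = m" using unif.prob_space by (simp add: sum_distrib_left[symmetric])
    then have "exp (- m) = (\<Prod>a\<in>K. exp (- (m * q a)))"
      using K by (simp add: exp_sum[symmetric] sum_negf)
    then show ?thesis
      using K by (simp add: e_def pmf_pois m prod.distrib power_mult_distrib prod_dividef power_sum)
  qed
  also have "\<dots> = (\<Prod>a\<in>K. pmf (pois (m * q a)) (c a))"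
    using m by (simp add: pmf_pois q_def)
  finally show ?thesis by (simp add: prod_ennreal q_def)
qed

text \<open>Agreement on the atoms of \<open>p\<close> shows that the law of \<open>X\<close> is at
  least \<open>p\<close> on every set. Both have total mass 1, so passing to complements gives
  equality.\<close>

lemma distr_eq_measure_pmfI:
  assumes "prob_space M" and X [measurable]: "X \<in> M \<rightarrow>\<^sub>M count_space UNIV"
    and eq: "\<And>c. c \<in> set_pmf p \<Longrightarrow> emeasure M {\<omega> \<in> space M. X \<omega> = c} = ennreal (pmf p c)"
  shows "distr M (count_space UNIV) X = measure_pmf p"
proof -
  interpret M: prob_space M by fact
  interpret D: prob_space "distr M (count_space UNIV) X" by (rule M.prob_space_distr) fact
  let ?D = "distr M (count_space UNIV) X"
  have le: "measure p A \<le> measure ?D A" for A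
  proof -
    have "emeasure p (A \<inter> set_pmf p) = (\<integral>\<^sup>+x. emeasure p {x} \<partial>count_space (A \<inter> set_pmf p))"
      by (rule emeasure_countable_singleton) auto
    also have "\<dots> = (\<integral>\<^sup>+x. emeasure ?D {x} \<partial>count_space (A \<inter> set_pmf p))"
    proof (rule nn_integral_cong)
      fix x assume "x \<in> space (count_space (A \<inter> set_pmf p))"
      moreover have "X -` {x} \<inter> space M = {\<omega> \<in> space M. X \<omega> = x}" by auto
      ultimately show "emeasure p {x} = emeasure ?D {x}"
        using eq[of x] by (simp add: emeasure_distr emeasure_pmf_single)
    qed
    also have "\<dots> = emeasure ?D (A \<inter> set_pmf p)"
      by (rule emeasure_countable_singleton[symmetric]) auto
    also have "\<dots> \<le> emeasure ?D A"
      by (rule emeasure_mono) auto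
    finally show ?thesis
      by (simp add: measure_Int_set_pmf measure_pmf.emeasure_eq_measure D.emeasure_eq_measure)
  qed
  show ?thesis
  proof (rule measure_eqI)
    fix A
    have "measure p A = measure ?D A"
      using le[of A] le[of "UNIV - A"] measure_pmf.prob_compl[of A p] D.prob_compl[of A] by simp
    then show "emeasure ?D A = emeasure p A"
      by (simp add: measure_pmf.emeasure_eq_measure D.emeasure_eq_measure)
  qed simp
qed

text \<open>Independence depends only on the joint law, and this is the same on both sides. The
  empty family is separate because the characterisation by product measures is stated for nonempty
  index sets.\<close>

lemma indep_vars_distr_iff:
  assumes "prob_space M" and T [measurable]: "T \<in> M \<rightarrow>\<^sub>M N" and X [measurable]: "\<And>i. i \<in> I \<Longrightarrow> X i \<in> N \<rightarrow>\<^sub>M M' i"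
  shows "prob_space.indep_vars (distr M N T) M' X I \<longleftrightarrow> prob_space.indep_vars M M' (\<lambda>i \<omega>. X i (T \<omega>)) I"
proof -
  interpret M: prob_space M by fact
  interpret D: prob_space "distr M N T" by (rule M.prob_space_distr) fact
  show ?thesis
  proof (cases "I = {}")
    case True
    then show ?thesis
      by (simp add: M.indep_vars_def M.indep_sets_def D.indep_vars_def D.indep_sets_def)
  next
    case False
    have "distr (distr M N T) (PiM I M') (\<lambda>x. \<lambda>i\<in>I. X i x) = distr M (PiM I M') (\<lambda>\<omega>. \<lambda>i\<in>I. X i (T \<omega>))"
      by (subst distr_distr) (auto simp: comp_def intro!: measurable_restrict)
    moreover have "PiM I (\<lambda>i. distr (distr M N T) (M' i) (X i)) = PiM I (\<lambda>i. distr M (M' i) (\<lambda>\<omega>. X i (T \<omega>)))"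
      by (intro PiM_cong refl) (subst distr_distr, auto simp: comp_def)
    moreover have "(\<lambda>\<omega>. X i (T \<omega>)) \<in> M \<rightarrow>\<^sub>M M' i" if "i \<in> I" for i
      using that by (intro measurable_compose[OF T X])
    ultimately show ?thesis
      using False by (subst M.indep_vars_iff_distr_eq_PiM', simp, simp) (subst D.indep_vars_iff_distr_eq_PiM', auto)
  qed
qed

lemma pois_add: "0 \<le> a \<Longrightarrow> 0 \<le> b \<Longrightarrow> map_pmf (\<lambda>(x, y). x + y) (pair_pmf (pois a) (pois b)) = pois (a + b)"
proof (rule pmf_eqI)
  fix n :: nat assume ab: "0 \<le> a" "0 \<le> b"
  have "pmf (map_pmf (\<lambda>(x, y). x + y) (pair_pmf (pois a) (pois b))) n
      = measure (pair_pmf (pois a) (pois b)) ((\<lambda>(x, y). x + y) -` {n})"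
    by (simp add: pmf_map)
  also have "(\<lambda>(x, y). x + y) -` {n} = (\<lambda>i. (i, n - i)) ` {..n}"
    by (auto simp: image_iff)
  also have "measure (pair_pmf (pois a) (pois b)) \<dots> = (\<Sum>i\<le>n. pmf (pois a) i * pmf (pois b) (n - i))"
    by (subst measure_measure_pmf_finite) (auto simp: sum.reindex inj_on_def pmf_pair)
  also have "\<dots> = (\<Sum>i\<le>n. exp (- (a + b)) / fact n * (real (n choose i) * a ^ i * b ^ (n - i)))"
  proof (intro sum.cong refl)
    fix i assume "i \<in> {..n}"
    moreover have "exp (- (a + b)) = exp (- a) * exp (- b)" by (simp add: mult_exp_exp)
    ultimately show "pmf (pois a) i * pmf (pois b) (n - i) = exp (- (a + b)) / fact n * (real (n choose i) * a ^ i * b ^ (n - i))"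
      using ab by (simp only: pmf_pois binomial_fact) (simp add: binomial_fact)
  qed
  also have "\<dots> = pmf (pois (a + b)) n"
    using ab by (simp add: pmf_pois binomial_ring sum_distrib_left[symmetric] sum_divide_distrib[symmetric])
  finally show "pmf (map_pmf (\<lambda>(x, y). x + y) (pair_pmf (pois a) (pois b))) n = pmf (pois (a + b)) n" .
qed

lemma Pi_pmf_pois_add:
  assumes K: "finite K" "\<And>a. a \<in> K \<Longrightarrow> 0 \<le> r a \<and> 0 \<le> r' a"
  shows "map_pmf (\<lambda>(f, g) a. f a + g a) (pair_pmf (Pi_pmf K 0 (\<lambda>a. pois (r a))) (Pi_pmf K 0 (\<lambda>a. pois (r' a))))
    = Pi_pmf K 0 (\<lambda>a. pois (r a + r' a))"
proof -
  have pois_eq: "pois (r a + r' a) = bind_pmf (pois (r a)) (\<lambda>x. bind_pmf (pois (r' a)) (\<lambda>y. return_pmf (x + y)))" if "a \<in> K" for a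
    using K(2)[OF that]
    by (subst pois_add[symmetric]) (simp_all add: pair_pmf_def map_pmf_def bind_assoc_pmf bind_return_pmf)
  have "Pi_pmf K 0 (\<lambda>a. pois (r a + r' a))
      = Pi_pmf K 0 (\<lambda>a. bind_pmf (pois (r a)) (\<lambda>x. bind_pmf (pois (r' a)) (\<lambda>y. return_pmf (x + y))))"
    by (intro Pi_pmf_cong refl pois_eq)
  also have "\<dots> = bind_pmf (Pi_pmf K 0 (\<lambda>a. pois (r a)))
      (\<lambda>f. Pi_pmf K 0 (\<lambda>a. bind_pmf (pois (r' a)) (\<lambda>y. return_pmf (f a + y))))"
    by (rule Pi_pmf_bind[OF K(1)])
  also have "\<dots> = bind_pmf (Pi_pmf K 0 (\<lambda>a. pois (r a))) (\<lambda>f. bind_pmf (Pi_pmf K 0 (\<lambda>a. pois (r' a)))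
      (\<lambda>g. Pi_pmf K 0 (\<lambda>a. return_pmf (f a + g a))))"
    by (rule arg_cong[where f="bind_pmf _"], rule ext, rule Pi_pmf_bind[OF K(1)])
  also have "\<dots> = bind_pmf (Pi_pmf K 0 (\<lambda>a. pois (r a))) (\<lambda>f. bind_pmf (Pi_pmf K 0 (\<lambda>a. pois (r' a)))
      (\<lambda>g. return_pmf (\<lambda>a. if a \<in> K then f a + g a else 0)))"
    by (simp only: Pi_pmf_return_pmf[OF K(1)])
  also have "\<dots> = bind_pmf (Pi_pmf K 0 (\<lambda>a. pois (r a))) (\<lambda>f. bind_pmf (Pi_pmf K 0 (\<lambda>a. pois (r' a)))
      (\<lambda>g. return_pmf (\<lambda>a. f a + g a)))"
  proof (rule bind_pmf_cong[OF refl], rule bind_pmf_cong[OF refl], rule arg_cong[where f=return_pmf], rule ext)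
    fix f g a assume "f \<in> set_pmf (Pi_pmf K 0 (\<lambda>a. pois (r a)))" "g \<in> set_pmf (Pi_pmf K 0 (\<lambda>a. pois (r' a)))"
    then have "a \<notin> K \<Longrightarrow> f a = 0" "a \<notin> K \<Longrightarrow> g a = 0"
      using set_Pi_pmf_subset[OF K(1), of 0 "\<lambda>a. pois (r a)"] set_Pi_pmf_subset[OF K(1), of 0 "\<lambda>a. pois (r' a)"] by auto
    then show "(if a \<in> K then f a + g a else 0) = f a + g a" by auto
  qed
  finally show ?thesis
    by (simp add: pair_pmf_def map_pmf_def bind_assoc_pmf bind_return_pmf)
qed

section \<open>Poisson processes from independent pieces\<close>

lemma Pi_pmf_pois_sum:
  assumes "finite J" "finite K" "\<And>j a. j \<in> J \<Longrightarrow> a \<in> K \<Longrightarrow> 0 \<le> r j a"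
  shows "map_pmf (\<lambda>f a. \<Sum>j\<in>J. f j a) (Pi_pmf J (\<lambda>_. 0) (\<lambda>j. Pi_pmf K 0 (\<lambda>a. pois (r j a))))
    = Pi_pmf K 0 (\<lambda>a. pois (\<Sum>j\<in>J. r j a))"
  using assms(1,3)
proof (induction J)
  case empty
  then show ?case using assms(2) by (simp add: pois_def)
next
  case (insert j J)
  let ?p = "\<lambda>j. Pi_pmf K 0 (\<lambda>a. pois (r j a))"
  have "map_pmf (\<lambda>f a. \<Sum>j\<in>insert j J. f j a) (Pi_pmf (insert j J) (\<lambda>_. 0) ?p)
      = map_pmf (\<lambda>(y, f) a. y a + (\<Sum>j\<in>J. f j a)) (pair_pmf (?p j) (Pi_pmf J (\<lambda>_. 0) ?p))"
    unfolding Pi_pmf_insert[OF insert.hyps] map_pmf_comp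
  proof (intro map_pmf_cong refl ext, clarify)
    fix y f a
    have "(\<Sum>i\<in>J. (f(j := y)) i a) = (\<Sum>i\<in>J. f i a)"
      using insert.hyps by (intro sum.cong) auto
    then show "(\<Sum>i\<in>insert j J. (f(j := y)) i a) = y a + (\<Sum>i\<in>J. f i a)"
      using insert.hyps by simp
  qed
  also have "\<dots> = map_pmf (\<lambda>(f, g) a. f a + g a)
      (map_pmf (apsnd (\<lambda>f a. \<Sum>j\<in>J. f j a)) (pair_pmf (?p j) (Pi_pmf J (\<lambda>_. 0) ?p)))"
    by (simp add: map_pmf_comp case_prod_unfold)
  also have "\<dots> = map_pmf (\<lambda>(f, g) a. f a + g a) (pair_pmf (?p j) (Pi_pmf K 0 (\<lambda>a. pois (\<Sum>j\<in>J. r j a))))"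
    unfolding pair_map_pmf2[symmetric] using insert.IH insert.prems by simp
  also have "\<dots> = Pi_pmf K 0 (\<lambda>a. pois (r j a + (\<Sum>j\<in>J. r j a)))"
    using insert.prems by (intro Pi_pmf_pois_add assms(2)) (auto intro!: sum_nonneg)
  finally show ?case using insert.hyps by simp
qed

lemma measurable_count_space_countableI:
  assumes "countable A" "\<And>x. x \<in> space M \<Longrightarrow> f x \<in> A" "\<And>a. a \<in> A \<Longrightarrow> {x \<in> space M. f x = a} \<in> sets M"
  shows "f \<in> M \<rightarrow>\<^sub>M count_space UNIV"
proof (rule measurableI)
  fix S
  have "f -` S \<inter> space M = (\<Union>a\<in>A \<inter> S. {x \<in> space M. f x = a})" using assms(2) by auto
  also have "\<dots> \<in> sets M" using assms by (intro sets.countable_UN'') auto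
  finally show "f -` S \<inter> space M \<in> sets M" .
qed auto

text \<open>\<open>Q\<close> is meant to carry the counts of both configurations at once, with
  whatever dependence the coupling gives them. The positions are one sequence per piece, independent
  of \<open>Q\<close> and of each other.\<close>

definition prod_space :: "'c pmf \<Rightarrow> 'j set \<Rightarrow> ('c \<times> ('j \<Rightarrow> nat \<Rightarrow> pt)) measure" where
  "prod_space Q J = measure_pmf Q \<Otimes>\<^sub>M (\<Pi>\<^sub>M j\<in>J. seqs)"

definition coord :: "('c \<Rightarrow> 'j \<Rightarrow> nat) \<Rightarrow> 'j \<Rightarrow> 'c \<times> ('j \<Rightarrow> nat \<Rightarrow> pt) \<Rightarrow> nat \<times> (nat \<Rightarrow> pt)" where
  "coord N j \<omega> = (N (fst \<omega>) j, snd \<omega> j)"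

interpretation seqs_product: product_prob_space "\<lambda>_. seqs" J for J :: "'j set"
  by standard

text \<open>A piece uses an initial part of its sequence, so a larger count only adds points.
  Monotone counts thereby give inclusions of the points used.\<close>

definition pts :: "('j \<Rightarrow> pt \<Rightarrow> pt) \<Rightarrow> 'j set \<Rightarrow> ('j \<Rightarrow> nat \<times> (nat \<Rightarrow> pt)) \<Rightarrow> pt set" where
  "pts \<phi> J y = (\<Union>j\<in>J. (\<lambda>i. \<phi> j (snd (y j) i)) ` {..<fst (y j)})"

lemma finite_pts: "finite J \<Longrightarrow> finite (pts \<phi> J y)"
  by (simp add: pts_def)

lemma pts_cong: "(\<And>j. j \<in> J \<Longrightarrow> y j = y' j) \<Longrightarrow> pts \<phi> J y = pts \<phi> J y'"
  by (simp add: pts_def)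

definition piece_maps :: "('j \<Rightarrow> pt \<Rightarrow> pt) \<Rightarrow> 'j set \<Rightarrow> bool" where
  "piece_maps \<phi> J \<longleftrightarrow> finite J \<and> (\<forall>j\<in>J. \<phi> j \<in> borel \<rightarrow>\<^sub>M borel \<and> inj_on (\<phi> j) cube) \<and>
     disjoint_family_on (\<lambda>j. \<phi> j ` cube) J"

text \<open>No two points coincide: good sequences are injective with values in the cube, the maps
  are injective there, and different pieces have disjoint images.\<close>

lemma card_pts:
  assumes \<phi>: "piece_maps \<phi> J" and y: "\<And>j. j \<in> J \<Longrightarrow> snd (y j) \<in> good"
  shows "card (pts \<phi> J y \<inter> B) = (\<Sum>j\<in>J. cnt (\<lambda>x. \<phi> j x \<in> B) (fst (y j)) (snd (y j)) True)"
proof -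
  let ?D = "\<lambda>j. {i. i < fst (y j) \<and> \<phi> j (snd (y j) i) \<in> B}"
  let ?f = "\<lambda>j i. \<phi> j (snd (y j) i)"
  have fin: "finite J" using \<phi> by (simp add: piece_maps_def)
  have cube: "snd (y j) i \<in> cube" if "j \<in> J" for j i
    using y[OF that] by (auto simp: good_def)
  have "pts \<phi> J y \<inter> B = (\<Union>j\<in>J. ?f j ` ?D j)"
    by (auto simp: pts_def)
  also have "card \<dots> = (\<Sum>j\<in>J. card (?f j ` ?D j))"
  proof (rule card_UN_disjoint[OF fin])
    show "\<forall>i\<in>J. \<forall>j\<in>J. i \<noteq> j \<longrightarrow> ?f i ` ?D i \<inter> ?f j ` ?D j = {}"
    proof (intro ballI impI)
      fix i j assume ij: "i \<in> J" "j \<in> J" "i \<noteq> j"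
      then have "\<phi> i ` cube \<inter> \<phi> j ` cube = {}"
        using \<phi> by (auto simp: piece_maps_def disjoint_family_on_def)
      moreover have "?f i ` ?D i \<subseteq> \<phi> i ` cube" "?f j ` ?D j \<subseteq> \<phi> j ` cube"
        using cube ij by auto
      ultimately show "?f i ` ?D i \<inter> ?f j ` ?D j = {}" by blast
    qed
  qed auto
  also have "\<dots> = (\<Sum>j\<in>J. card (?D j))"
  proof (intro sum.cong refl card_image)
    fix j assume j: "j \<in> J"
    then have "inj_on (\<phi> j) cube" "inj (snd (y j))" using \<phi> y[OF j] by (auto simp: piece_maps_def good_def)
    then show "inj_on (?f j) (?D j)"
      using cube[OF j] by (auto simp: inj_on_def inj_def)
  qed
  finally show ?thesis by (simp add: cnt_def)
qed

lemma measurable_pts: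
  assumes \<phi>: "piece_maps \<phi> J"
  shows "pts \<phi> J \<in> (\<Pi>\<^sub>M j\<in>J. marked) \<rightarrow>\<^sub>M cfg_space"
  unfolding cfg_space_def
proof (rule measurable_measure_of)
  fix Y assume "Y \<in> {{X. card (X \<inter> B) = n} | B n. B \<in> sets (borel :: pt measure)}"
  then obtain B n where Y: "Y = {X. card (X \<inter> B) = n}" and [measurable]: "B \<in> sets borel" by auto
  have fin: "finite J" using \<phi> by (simp add: piece_maps_def)
  have k: "(\<lambda>x. \<phi> j x \<in> B) \<in> borel \<rightarrow>\<^sub>M count_space UNIV" if "j \<in> J" for j
  proof -
    have [measurable]: "\<phi> j \<in> borel \<rightarrow>\<^sub>M borel" using \<phi> that by (simp add: piece_maps_def)
    show ?thesis by measurable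
  qed
  have c: "(\<lambda>y. cnt (\<lambda>x. \<phi> j x \<in> B) (fst (y j)) (snd (y j)) True) \<in> (\<Pi>\<^sub>M j\<in>J. marked) \<rightarrow>\<^sub>M count_space UNIV" if "j \<in> J" for j
    by (rule measurable_compose[OF measurable_component_singleton[OF that, of "\<lambda>_. marked"] measurable_marked_cnt[OF k[OF that]]])
  have "pts \<phi> J -` Y \<inter> space (\<Pi>\<^sub>M j\<in>J. marked)
      = {y \<in> space (\<Pi>\<^sub>M j\<in>J. marked). (\<Sum>j\<in>J. cnt (\<lambda>x. \<phi> j x \<in> B) (fst (y j)) (snd (y j)) True) = n}"
  proof -
    have "card (pts \<phi> J y \<inter> B) = (\<Sum>j\<in>J. cnt (\<lambda>x. \<phi> j x \<in> B) (fst (y j)) (snd (y j)) True)"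
      if "y \<in> space (\<Pi>\<^sub>M j\<in>J. marked)" for y
      using that by (intro card_pts[OF \<phi>]) (auto simp: space_PiM space_marked PiE_iff mem_Times_iff)
    then show ?thesis by (auto simp: Y)
  qed
  also have "\<dots> \<in> sets (\<Pi>\<^sub>M j\<in>J. marked)"
  proof -
    have "(\<lambda>y. \<Sum>j\<in>J. cnt (\<lambda>x. \<phi> j x \<in> B) (fst (y j)) (snd (y j)) True) \<in> (\<Pi>\<^sub>M j\<in>J. marked) \<rightarrow>\<^sub>M count_space UNIV"
      using c by measurable
    then show ?thesis by measurable
  qed
  finally show "pts \<phi> J -` Y \<inter> space (\<Pi>\<^sub>M j\<in>J. marked) \<in> sets (\<Pi>\<^sub>M j\<in>J. marked)" .
qed auto

text \<open>Only the law of \<open>N\<close> is prescribed. Two interpretations with the same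
  \<open>Q\<close> and different \<open>N\<close> therefore live on one probability space, share all
  positions and may have dependent counts.\<close>

locale piece_space =
  fixes Q :: "'c pmf" and J :: "'j set" and N :: "'c \<Rightarrow> 'j \<Rightarrow> nat" and m :: "'j \<Rightarrow> real"
  assumes finite_J: "finite J" and m_nonneg: "\<And>j. j \<in> J \<Longrightarrow> 0 \<le> m j"
    and law: "map_pmf N Q = Pi_pmf J 0 (\<lambda>j. pois (m j))"
begin

abbreviation "\<Omega> \<equiv> prod_space Q J"

sublocale prob_space \<Omega>
proof -
  interpret P: prob_space "\<Pi>\<^sub>M j\<in>J. seqs" by (intro prob_space_PiM prob_space_seqs)
  interpret PQ: pair_prob_space "measure_pmf Q" "\<Pi>\<^sub>M j\<in>J. seqs" by standard
  show "prob_space \<Omega>" unfolding prod_space_def by (rule PQ.P.prob_space_axioms)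
qed

lemma measurable_coord [measurable]: "j \<in> J \<Longrightarrow> coord N j \<in> \<Omega> \<rightarrow>\<^sub>M marked"
  unfolding coord_def marked_def prod_space_def
  by (intro measurable_Pair measurable_compose[OF measurable_fst] measurable_compose[OF measurable_snd]) auto

lemma coord_space: "j \<in> J \<Longrightarrow> \<omega> \<in> space \<Omega> \<Longrightarrow> coord N j \<omega> \<in> space marked"
  using measurable_space[OF measurable_coord] .

text \<open>Given the counts, the sequences are independent, so the conditional probability is a
  product of functions of the single counts; since the counts are independent too, its expectation
  factorises.\<close>

lemma emeasure_coords:
  assumes S: "\<And>j. j \<in> J \<Longrightarrow> S j \<in> sets marked"
  shows "emeasure \<Omega> {\<omega> \<in> space \<Omega>. \<forall>j\<in>J. coord N j \<omega> \<in> S j}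
    = (\<Prod>j\<in>J. emeasure (measure_pmf (pois (m j)) \<Otimes>\<^sub>M seqs) (S j))"
proof -
  let ?A = "{\<omega> \<in> space \<Omega>. \<forall>j\<in>J. coord N j \<omega> \<in> S j}"
  have sec: "Pair n -` S j \<in> sets seqs" if "j \<in> J" for n j
    using S[OF that] sets_Pair1[of "S j" "count_space UNIV" seqs n] by (simp add: marked_def)
  have A: "?A \<in> sets \<Omega>"
    using S finite_J by measurable
  have "emeasure \<Omega> ?A = (\<integral>\<^sup>+q. emeasure (\<Pi>\<^sub>M j\<in>J. seqs) (Pair q -` ?A) \<partial>Q)"
    using A unfolding prod_space_def
    by (intro sigma_finite_measure.emeasure_pair_measure_alt prob_space_imp_sigma_finite prob_space_PiM prob_space_seqs)
  also have "\<dots> = (\<integral>\<^sup>+q. (\<Prod>j\<in>J. emeasure seqs (Pair (N q j) -` S j)) \<partial>Q)"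
  proof (rule nn_integral_cong)
    fix q
    have "Pair q -` ?A = (\<Pi>\<^sub>E j\<in>J. Pair (N q j) -` S j)"
    proof -
      have "z \<in> space seqs" if "j \<in> J" "(n, z) \<in> S j" for j n z
        using sets.sets_into_space[OF sec[OF that(1)], of n] that(2) by auto
      then show ?thesis
        unfolding prod_space_def space_pair_measure space_PiM coord_def PiE_iff set_eq_iff vimage_eq by (auto simp: extensional_def PiE_iff)
    qed
    then show "emeasure (\<Pi>\<^sub>M j\<in>J. seqs) (Pair q -` ?A) = (\<Prod>j\<in>J. emeasure seqs (Pair (N q j) -` S j))"
      using sec finite_J by (simp add: seqs_product.emeasure_PiM)
  qed
  also have "\<dots> = (\<integral>\<^sup>+f. (\<Prod>j\<in>J. emeasure seqs (Pair (f j) -` S j)) \<partial>map_pmf N Q)"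
    by simp
  also have "\<dots> = (\<Prod>j\<in>J. \<integral>\<^sup>+n. emeasure seqs (Pair n -` S j) \<partial>pois (m j))"
    unfolding law by (rule nn_integral_prod_Pi_pmf[OF finite_J])
  also have "\<dots> = (\<Prod>j\<in>J. emeasure (measure_pmf (pois (m j)) \<Otimes>\<^sub>M seqs) (S j))"
    using S by (intro prod.cong refl) (simp add: emeasure_pmf_seqs)
  finally show ?thesis .
qed

lemma emeasure_pmf_seqs_space: "emeasure (measure_pmf p \<Otimes>\<^sub>M seqs) (space marked) = 1"
proof -
  interpret PS: pair_prob_space "measure_pmf p" seqs by standard
  show ?thesis using PS.P.emeasure_space_1 by simp
qed

lemma emeasure_pmf_seqs_eq_measure:
  "emeasure (measure_pmf p \<Otimes>\<^sub>M seqs) A = ennreal (measure (measure_pmf p \<Otimes>\<^sub>M seqs) A)"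
proof -
  interpret PS: pair_prob_space "measure_pmf p" seqs by standard
  show ?thesis by (rule PS.P.emeasure_eq_measure)
qed

lemma emeasure_coords_subset:
  assumes J': "J' \<subseteq> J" and S: "\<And>j. j \<in> J' \<Longrightarrow> S j \<in> sets marked"
  shows "emeasure \<Omega> {\<omega> \<in> space \<Omega>. \<forall>j\<in>J'. coord N j \<omega> \<in> S j}
    = (\<Prod>j\<in>J'. emeasure (measure_pmf (pois (m j)) \<Otimes>\<^sub>M seqs) (S j))"
proof -
  let ?S = "\<lambda>j. if j \<in> J' then S j else space marked"
  have "{\<omega> \<in> space \<Omega>. \<forall>j\<in>J'. coord N j \<omega> \<in> S j} = {\<omega> \<in> space \<Omega>. \<forall>j\<in>J. coord N j \<omega> \<in> ?S j}"
    using J' coord_space by auto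
  also have "emeasure \<Omega> \<dots> = (\<Prod>j\<in>J. emeasure (measure_pmf (pois (m j)) \<Otimes>\<^sub>M seqs) (?S j))"
    using S by (intro emeasure_coords) auto
  also have "\<dots> = (\<Prod>j\<in>J'. emeasure (measure_pmf (pois (m j)) \<Otimes>\<^sub>M seqs) (S j))"
    using J' finite_J by (intro prod.mono_neutral_cong_right) (auto simp: emeasure_pmf_seqs_space)
  finally show ?thesis .
qed

lemma indep_coords: "indep_vars (\<lambda>_. marked) (coord N) J"
proof (cases "J = {}")
  case True
  then show ?thesis unfolding indep_vars_def indep_sets_def by blast
next
  case False
  have pr: "prob (\<Inter>j\<in>J'. coord N j -` A j \<inter> space \<Omega>) = (\<Prod>j\<in>J'. measure (measure_pmf (pois (m j)) \<Otimes>\<^sub>M seqs) (A j))"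
    if "J' \<subseteq> J" "J' \<noteq> {}" "\<And>j. j \<in> J' \<Longrightarrow> A j \<in> sets marked" for J' A
  proof -
    have "(\<Inter>j\<in>J'. coord N j -` A j \<inter> space \<Omega>) = {\<omega> \<in> space \<Omega>. \<forall>j\<in>J'. coord N j \<omega> \<in> A j}"
      using that by auto
    then show ?thesis
      using emeasure_coords_subset[OF that(1,3)]
      by (simp add: emeasure_pmf_seqs_eq_measure emeasure_eq_measure prod_ennreal prod_nonneg)
  qed
  show ?thesis
  proof (subst indep_vars_finite[where E="\<lambda>_. sets marked"])
    show "\<forall>A\<in>J \<rightarrow> sets marked. prob (\<Inter>j\<in>J. coord N j -` A j \<inter> space \<Omega>) = (\<Prod>j\<in>J. prob (coord N j -` A j \<inter> space \<Omega>))"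
    proof
      fix A assume A: "A \<in> J \<rightarrow> sets marked"
      have "prob (\<Inter>j\<in>J. coord N j -` A j \<inter> space \<Omega>) = (\<Prod>j\<in>J. measure (measure_pmf (pois (m j)) \<Otimes>\<^sub>M seqs) (A j))"
        using A False by (intro pr) auto
      also have "\<dots> = (\<Prod>j\<in>J. prob (coord N j -` A j \<inter> space \<Omega>))"
        using A pr[of "{j}" A for j] by (intro prod.cong refl) (auto simp: Pi_iff)
      finally show "prob (\<Inter>j\<in>J. coord N j -` A j \<inter> space \<Omega>) = (\<Prod>j\<in>J. prob (coord N j -` A j \<inter> space \<Omega>))" .
    qed
  qed (auto simp: False finite_J sets.Int_stable sets.sigma_sets_eq sets.space_closed)
qed


text \<open>Splitting makes the class counts of a single piece independent Poisson variables. Pieces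
  are independent of each other, and sums of independent Poisson variables are again Poisson, with
  the means added.\<close>

lemma counts_law:
  fixes K :: "'k set"
  assumes J': "J' \<subseteq> J" and K: "finite K" "\<And>j x. \<kappa> j x \<in> K"
    and \<kappa>: "\<And>j. j \<in> J' \<Longrightarrow> \<kappa> j \<in> borel \<rightarrow>\<^sub>M count_space UNIV"
  defines "H \<equiv> \<lambda>\<omega> a. if a \<in> K then \<Sum>j\<in>J'. cnt (\<kappa> j) (fst (coord N j \<omega>)) (snd (coord N j \<omega>)) a else 0"
  shows "H \<in> \<Omega> \<rightarrow>\<^sub>M count_space UNIV"
    "distr \<Omega> (count_space UNIV) H = measure_pmf (Pi_pmf K 0 (\<lambda>a. pois (\<Sum>j\<in>J'. m j * measure unif {x. \<kappa> j x = a})))"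
proof -
  define C where "C \<omega> j a = (if j \<in> J' \<and> a \<in> K then cnt (\<kappa> j) (fst (coord N j \<omega>)) (snd (coord N j \<omega>)) a else 0)"
    for \<omega> j a
  define P where "P = Pi_pmf J' (\<lambda>_. 0) (\<lambda>j. Pi_pmf K 0 (\<lambda>a. pois (m j * measure unif {x. \<kappa> j x = a})))"
  define A where "A = {f :: 'j \<Rightarrow> 'k \<Rightarrow> nat. \<forall>j a. j \<notin> J' \<or> a \<notin> K \<longrightarrow> f j a = 0}"
  have fin: "finite J'" using J' finite_J finite_subset by blast
  \<comment> \<open>With all rates equal to 1 every array in \<open>A\<close> has positive
    probability, and the support of a \<open>pmf\<close> is countable.\<close>
  have cA: "countable A"
  proof (rule countable_subset)
    show "A \<subseteq> set_pmf (Pi_pmf J' (\<lambda>_. 0) (\<lambda>j. Pi_pmf K 0 (\<lambda>a. pois 1)))"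
      using fin K by (auto simp: A_def set_Pi_pmf PiE_dflt_def pois_def fun_eq_iff)
  qed simp
  define S where "S f j = {p \<in> space marked. \<forall>a\<in>K. cnt (\<kappa> j) (fst p) (snd p) a = f j a}"
    for f :: "'j \<Rightarrow> 'k \<Rightarrow> nat" and j
  have S: "S f j \<in> sets marked" if "j \<in> J'" for f j
  proof -
    note [measurable] = \<kappa>[OF that]
    show ?thesis unfolding S_def using K(1) by measurable
  qed
  have eqS: "{\<omega> \<in> space \<Omega>. C \<omega> = f} = {\<omega> \<in> space \<Omega>. \<forall>j\<in>J'. coord N j \<omega> \<in> S f j}" if "f \<in> A" for f
  proof -
    have "C \<omega> = f \<longleftrightarrow> (\<forall>j\<in>J'. \<forall>a\<in>K. cnt (\<kappa> j) (fst (coord N j \<omega>)) (snd (coord N j \<omega>)) a = f j a)" for \<omega>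
      using that unfolding A_def C_def fun_eq_iff by auto
    then show ?thesis
      using J' coord_space by (auto simp: S_def)
  qed
  have CA: "C \<omega> \<in> A" for \<omega> by (auto simp: C_def A_def)
  have C_meas: "C \<in> \<Omega> \<rightarrow>\<^sub>M count_space UNIV"
  proof (rule measurable_count_space_countableI[OF cA CA])
    fix f assume "f \<in> A"
    show "{\<omega> \<in> space \<Omega>. C \<omega> = f} \<in> sets \<Omega>"
    proof -
      have [measurable]: "coord N j \<in> \<Omega> \<rightarrow>\<^sub>M marked" if "j \<in> J'" for j
        using that J' by (intro measurable_coord) auto
      show ?thesis unfolding eqS[OF \<open>f \<in> A\<close>] using S fin by measurable
    qed
  qed
  have H_C: "H = (\<lambda>\<omega> a. \<Sum>j\<in>J'. C \<omega> j a)"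
    by (auto simp: H_def C_def fun_eq_iff)
  show "H \<in> \<Omega> \<rightarrow>\<^sub>M count_space UNIV"
    unfolding H_C using measurable_compose[OF C_meas, of "\<lambda>f a. \<Sum>j\<in>J'. f j a"] by simp
  have "distr \<Omega> (count_space UNIV) C = measure_pmf P"
  proof (rule distr_eq_measure_pmfI[OF prob_space_axioms C_meas])
    fix f assume "f \<in> set_pmf P"
    then have f': "f j \<in> set_pmf (Pi_pmf K 0 (\<lambda>a. pois (m j * measure unif {x. \<kappa> j x = a})))" if "j \<in> J'" for j
      using fin that by (auto simp: P_def set_Pi_pmf PiE_dflt_def)
    have "f j a = 0" if "j \<notin> J'" for j a
      using \<open>f \<in> set_pmf P\<close> fin that by (auto simp: P_def set_Pi_pmf PiE_dflt_def)
    moreover have "f j a = 0" if "j \<in> J'" "a \<notin> K" for j a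
      using f'[OF that(1)] that(2) K(1) by (auto simp: set_Pi_pmf PiE_dflt_def)
    ultimately have f: "f \<in> A" by (auto simp: A_def)
    have "emeasure \<Omega> {\<omega> \<in> space \<Omega>. C \<omega> = f} = (\<Prod>j\<in>J'. emeasure (measure_pmf (pois (m j)) \<Otimes>\<^sub>M seqs) (S f j))"
      unfolding eqS[OF f] by (rule emeasure_coords_subset[OF J' S])
    also have "\<dots> = (\<Prod>j\<in>J'. \<Prod>a\<in>K. ennreal (pmf (pois (m j * measure unif {x. \<kappa> j x = a})) (f j a)))"
      unfolding S_def using K J' m_nonneg \<kappa> by (intro prod.cong refl poisson_splitting) auto
    also have "\<dots> = ennreal (pmf P f)"
      using f fin K(1) unfolding P_def
      by (subst pmf_Pi'[OF fin]) (auto simp: A_def pmf_Pi' prod_ennreal prod_nonneg fun_eq_iff)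
    finally show "emeasure \<Omega> {\<omega> \<in> space \<Omega>. C \<omega> = f} = ennreal (pmf P f)" .
  qed
  then have "distr (distr \<Omega> (count_space UNIV) C) (count_space UNIV) (\<lambda>f a. \<Sum>j\<in>J'. f j a)
      = distr (measure_pmf P) (count_space UNIV) (\<lambda>f a. \<Sum>j\<in>J'. f j a)" by simp
  also have "\<dots> = measure_pmf (map_pmf (\<lambda>f a. \<Sum>j\<in>J'. f j a) P)"
    by (simp add: map_pmf_rep_eq)
  also have "map_pmf (\<lambda>f a. \<Sum>j\<in>J'. f j a) P = Pi_pmf K 0 (\<lambda>a. pois (\<Sum>j\<in>J'. m j * measure unif {x. \<kappa> j x = a}))"
    unfolding P_def using J' m_nonneg by (intro Pi_pmf_pois_sum fin K(1)) auto
  also have "distr (distr \<Omega> (count_space UNIV) C) (count_space UNIV) (\<lambda>f a. \<Sum>j\<in>J'. f j a) = distr \<Omega> (count_space UNIV) H"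
    using C_meas H_C by (subst distr_distr) (auto simp: comp_def)
  finally show "distr \<Omega> (count_space UNIV) H = measure_pmf (Pi_pmf K 0 (\<lambda>a. pois (\<Sum>j\<in>J'. m j * measure unif {x. \<kappa> j x = a})))" .
qed

lemma measurable_pts_coord:
  assumes "piece_maps \<phi> J'" "J' \<subseteq> J"
  shows "(\<lambda>\<omega>. pts \<phi> J' (\<lambda>j. coord N j \<omega>)) \<in> \<Omega> \<rightarrow>\<^sub>M cfg_space"
proof -
  have "(\<lambda>\<omega>. \<lambda>j\<in>J'. coord N j \<omega>) \<in> \<Omega> \<rightarrow>\<^sub>M (\<Pi>\<^sub>M j\<in>J'. marked)"
    using assms(2) by (intro measurable_restrict measurable_coord) auto
  from measurable_compose[OF this measurable_pts[OF assms(1)]]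
  have "(\<lambda>\<omega>. pts \<phi> J' (\<lambda>j\<in>J'. coord N j \<omega>)) \<in> \<Omega> \<rightarrow>\<^sub>M cfg_space" .
  also have "(\<lambda>\<omega>. pts \<phi> J' (\<lambda>j\<in>J'. coord N j \<omega>)) = (\<lambda>\<omega>. pts \<phi> J' (\<lambda>j. coord N j \<omega>))"
    by (intro ext pts_cong) auto
  finally show ?thesis .
qed

lemma indep_pts:
  assumes "piece_maps \<phi> J1" "J1 \<subseteq> J" "piece_maps \<psi> J2" "J2 \<subseteq> J" "J1 \<inter> J2 = {}"
  shows "indep_var cfg_space (\<lambda>\<omega>. pts \<phi> J1 (\<lambda>j. coord N j \<omega>)) cfg_space (\<lambda>\<omega>. pts \<psi> J2 (\<lambda>j. coord N j \<omega>))"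
proof -
  have "indep_var cfg_space (pts \<phi> J1 \<circ> (\<lambda>\<omega>. \<lambda>j\<in>J1. coord N j \<omega>)) cfg_space (pts \<psi> J2 \<circ> (\<lambda>\<omega>. \<lambda>j\<in>J2. coord N j \<omega>))"
    using assms by (intro indep_var_compose[OF indep_var_restrict[OF indep_coords]] measurable_pts)
  also have "pts \<phi> J1 \<circ> (\<lambda>\<omega>. \<lambda>j\<in>J1. coord N j \<omega>) = (\<lambda>\<omega>. pts \<phi> J1 (\<lambda>j. coord N j \<omega>))"
    unfolding comp_def by (intro ext pts_cong) auto
  also have "pts \<psi> J2 \<circ> (\<lambda>\<omega>. \<lambda>j\<in>J2. coord N j \<omega>) = (\<lambda>\<omega>. pts \<psi> J2 (\<lambda>j. coord N j \<omega>))"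
    unfolding comp_def by (intro ext pts_cong) auto
  finally show ?thesis .
qed

lemma pts_subset:
  assumes "\<omega> \<in> space \<Omega>" "J' \<subseteq> J" "\<And>j. j \<in> J' \<Longrightarrow> \<phi> j ` cube \<subseteq> R"
  shows "pts \<phi> J' (\<lambda>j. coord N j \<omega>) \<subseteq> R"
proof -
  have "snd (coord N j \<omega>) i \<in> cube" if "j \<in> J'" for j i
    using coord_space[of j \<omega>] that assms by (auto simp: space_marked good_def mem_Times_iff)
  then show ?thesis using assms(3) by (fastforce simp: pts_def)
qed

text \<open>The sets \<open>Bs a\<close> together with the complement of their union classify all
  points; the label \<open>k\<close> stands for this complement. All counts are bundled into one
  variable \<open>H\<close>, so that Poisson laws and independence can both be read off from one
  \<open>Pi_pmf\<close>.\<close>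

lemma family_law:
  fixes k :: nat
  assumes \<phi>: "piece_maps \<phi> J'" and J': "J' \<subseteq> J"
    and Bs: "\<And>a. a < k \<Longrightarrow> Bs a \<in> sets borel" "disjoint_family_on Bs {..<k}"
  shows "\<exists>H p. H \<in> \<Omega> \<rightarrow>\<^sub>M count_space UNIV \<and>
    distr \<Omega> (count_space UNIV) H = measure_pmf (Pi_pmf {..k} 0 p) \<and>
    (\<forall>a<k. \<forall>\<omega>. H \<omega> a = card (pts \<phi> J' (\<lambda>j. coord N j \<omega>) \<inter> Bs a)) \<and>
    (\<forall>a<k. p a = pois (\<Sum>j\<in>J'. m j * measure unif (\<phi> j -` Bs a)))"
proof -
  define \<kappa> where "\<kappa> j x = (LEAST a. a = k \<or> \<phi> j x \<in> Bs a)" for j x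
  have \<kappa>_le: "\<kappa> j x \<le> k" for j x
    unfolding \<kappa>_def by (rule Least_le) simp
  have \<kappa>_iff: "\<kappa> j x = a \<longleftrightarrow> \<phi> j x \<in> Bs a" if "a < k" for j x a
  proof
    assume "\<kappa> j x = a"
    moreover have "\<kappa> j x = k \<or> \<phi> j x \<in> Bs (\<kappa> j x)"
      unfolding \<kappa>_def by (rule LeastI[of _ k]) simp
    ultimately show "\<phi> j x \<in> Bs a" using that by auto
  next
    assume *: "\<phi> j x \<in> Bs a"
    show "\<kappa> j x = a"
      unfolding \<kappa>_def
    proof (rule Least_equality)
      fix b assume b: "b = k \<or> \<phi> j x \<in> Bs b"
      show "a \<le> b"
      proof (rule ccontr)
        assume "\<not> a \<le> b"
        then have "b < k" "a \<noteq> b" "\<phi> j x \<in> Bs b" using b that by auto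
        then show False using Bs(2) * that by (auto simp: disjoint_family_on_def)
      qed
    qed (use * in auto)
  qed
  have \<kappa>_meas: "\<kappa> j \<in> borel \<rightarrow>\<^sub>M count_space UNIV" if "j \<in> J'" for j
  proof -
    have [measurable]: "\<phi> j \<in> borel \<rightarrow>\<^sub>M borel" using \<phi> that by (simp add: piece_maps_def)
    have lt: "{x \<in> space borel. \<kappa> j x = a} \<in> sets borel" if "a < k" for a
    proof -
      have [measurable]: "Bs a \<in> sets borel" using Bs that by auto
      show ?thesis unfolding \<kappa>_iff[OF that] by measurable
    qed
    show ?thesis
    proof (rule measurable_count_space_countableI[where A="{..k}"])
      fix a assume "a \<in> {..k}"
      show "{x \<in> space borel. \<kappa> j x = a} \<in> sets borel"
      proof (cases "a < k")
        case False
        then have "{x \<in> space borel. \<kappa> j x = a} = space borel - (\<Union>b<k. {x \<in> space borel. \<kappa> j x = b})"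
          using \<kappa>_le[of j] \<open>a \<in> {..k}\<close> by (auto simp: order_le_less)
        also have "\<dots> \<in> sets borel" using lt by auto
        finally show ?thesis .
      qed (rule lt)
    qed (auto simp: \<kappa>_le)
  qed
  define H0 where "H0 \<omega> a = (if a \<in> {..k} then \<Sum>j\<in>J'. cnt (\<kappa> j) (fst (coord N j \<omega>)) (snd (coord N j \<omega>)) a else 0)" for \<omega> a
  \<comment> \<open>\<open>H\<close> agrees with \<open>H0\<close> on the space, but below
    \<open>k\<close> it equals the cardinality for every \<open>\<omega>\<close> whatsoever, which
    spares later steps a restriction to the space.\<close>
  define H where "H \<omega> a = (if a < k then card (pts \<phi> J' (\<lambda>j. coord N j \<omega>) \<inter> Bs a) else H0 \<omega> a)" for \<omega> a
  define p where "p a = pois (\<Sum>j\<in>J'. m j * measure unif {x. \<kappa> j x = a})" for a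
  have eq: "H \<omega> = H0 \<omega>" if "\<omega> \<in> space \<Omega>" for \<omega>
  proof
    fix a
    show "H \<omega> a = H0 \<omega> a"
    proof (cases "a < k")
      case True
      have "card (pts \<phi> J' (\<lambda>j. coord N j \<omega>) \<inter> Bs a) = (\<Sum>j\<in>J'. cnt (\<lambda>x. \<phi> j x \<in> Bs a) (fst (coord N j \<omega>)) (snd (coord N j \<omega>)) True)"
        using coord_space[OF _ that] J' by (intro card_pts[OF \<phi>]) (auto simp: space_marked mem_Times_iff)
      also have "\<dots> = (\<Sum>j\<in>J'. cnt (\<kappa> j) (fst (coord N j \<omega>)) (snd (coord N j \<omega>)) a)"
        by (simp add: cnt_def \<kappa>_iff[OF True])
      finally show ?thesis using True by (simp add: H_def H0_def)
    qed (simp add: H_def)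
  qed
  have law0: "distr \<Omega> (count_space UNIV) H0 = measure_pmf (Pi_pmf {..k} 0 p)" and H0: "H0 \<in> \<Omega> \<rightarrow>\<^sub>M count_space UNIV"
    unfolding H0_def p_def using counts_law[OF J' _ _ \<kappa>_meas, of "{..k}"] \<kappa>_le by auto
  have "distr \<Omega> (count_space UNIV) H = distr \<Omega> (count_space UNIV) H0"
    by (intro distr_cong eq refl)
  moreover have "H \<in> \<Omega> \<rightarrow>\<^sub>M count_space UNIV"
    using H0 eq by (subst measurable_cong[where g=H0]) auto
  ultimately show ?thesis
    using law0 by (intro exI[of _ H] exI[of _ p]) (auto simp: H_def p_def \<kappa>_iff vimage_def)
qed


text \<open>\<open>vol\<close> says that the uniform laws on the images of the pieces, weighted with
  the means, add up to \<open>lam\<close> times Lebesgue measure. The counts follow from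
  \<open>family_law\<close> for one set, the independence from \<open>family_law\<close> for a
  disjoint family.\<close>

theorem poisson_process_pts:
  assumes \<phi>: "piece_maps \<phi> J'" and J': "J' \<subseteq> J" and R: "\<And>j. j \<in> J' \<Longrightarrow> \<phi> j ` cube \<subseteq> R"
    and vol: "\<And>B. B \<in> sets borel \<Longrightarrow> B \<subseteq> R \<Longrightarrow> (\<Sum>j\<in>J'. m j * measure unif (\<phi> j -` B)) = lam * measure lborel B"
    and lam: "0 \<le> lam"
  shows "poisson_process \<Omega> (\<lambda>\<omega>. pts \<phi> J' (\<lambda>j. coord N j \<omega>)) R lam"
  unfolding poisson_process_def
proof (intro conjI allI ballI impI)
  let ?X = "\<lambda>\<omega>. pts \<phi> J' (\<lambda>j. coord N j \<omega>)"
  show "prob_space \<Omega>" by (rule prob_space_axioms)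
  show "?X \<in> \<Omega> \<rightarrow>\<^sub>M cfg_space" by (rule measurable_pts_coord[OF \<phi> J'])
  have "finite J'" using \<phi> by (simp add: piece_maps_def)
  then show "AE \<omega> in \<Omega>. ?X \<omega> \<subseteq> R \<and> finite (?X \<omega>)"
    by (intro AE_I2 conjI pts_subset[OF _ J' R] finite_pts)
  show "measure \<Omega> {\<omega> \<in> space \<Omega>. card (?X \<omega> \<inter> B) = n} = exp (- (lam * measure lborel B)) * (lam * measure lborel B) ^ n / fact n"
    if B: "B \<in> sets borel" "B \<subseteq> R" for B n
  proof -
    have "\<exists>H p. H \<in> \<Omega> \<rightarrow>\<^sub>M count_space UNIV \<and>
      distr \<Omega> (count_space UNIV) H = measure_pmf (Pi_pmf {..1::nat} 0 p) \<and>
      (\<forall>a<1. \<forall>\<omega>. H \<omega> a = card (?X \<omega> \<inter> B)) \<and>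
      (\<forall>a<1. p a = pois (\<Sum>j\<in>J'. m j * measure unif (\<phi> j -` B)))"
      using B by (intro family_law[OF \<phi> J']) (auto simp: disjoint_family_on_def)
    then obtain H p where H: "H \<in> \<Omega> \<rightarrow>\<^sub>M count_space UNIV"
      "distr \<Omega> (count_space UNIV) H = measure_pmf (Pi_pmf {..1::nat} 0 p)"
      "\<forall>a<1. \<forall>\<omega>. H \<omega> a = card (?X \<omega> \<inter> B)"
      "\<forall>a<1. p a = pois (\<Sum>j\<in>J'. m j * measure unif (\<phi> j -` B))"
      by blast
    have "measure \<Omega> {\<omega> \<in> space \<Omega>. card (?X \<omega> \<inter> B) = n} = measure \<Omega> (H -` {f. f 0 = n} \<inter> space \<Omega>)"
      by (intro arg_cong[where f="measure \<Omega>"]) (auto simp: H(3))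
    also have "\<dots> = measure (distr \<Omega> (count_space UNIV) H) {f. f 0 = n}"
      using H(1) by (simp add: measure_distr)
    also have "\<dots> = measure (Pi_pmf {..1::nat} 0 p) ((\<lambda>f. f 0) -` {n})"
      by (simp add: H(2) vimage_def)
    also have "\<dots> = pmf (map_pmf (\<lambda>f. f 0) (Pi_pmf {..1::nat} 0 p)) n"
      by (simp add: pmf_map)
    also have "map_pmf (\<lambda>f. f 0) (Pi_pmf {..1::nat} 0 p) = pois (lam * measure lborel B)"
      by (simp add: Pi_pmf_component H(4) vol[OF B])
    finally show ?thesis using lam by (simp add: pmf_pois)
  qed
  show "indep_vars (\<lambda>_. count_space UNIV) (\<lambda>i \<omega>. card (?X \<omega> \<inter> Bs i)) {..<k}"
    if Bs: "(\<forall>i<k. Bs i \<in> sets borel \<and> Bs i \<subseteq> R) \<and> disjoint_family_on Bs {..<k}" for k :: nat and Bs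
  proof -
    have b1: "Bs a \<in> sets borel" if "a < k" for a using Bs that by auto
    have b2: "disjoint_family_on Bs {..<k}" using Bs by auto
    obtain H p where H: "H \<in> \<Omega> \<rightarrow>\<^sub>M count_space UNIV"
      "distr \<Omega> (count_space UNIV) H = measure_pmf (Pi_pmf {..k} 0 p)"
      "\<forall>a<k. \<forall>\<omega>. H \<omega> a = card (?X \<omega> \<inter> Bs a)"
      using family_law[OF \<phi> J' b1 b2] by blast
    have "prob_space.indep_vars (measure_pmf (Pi_pmf {..k} 0 p)) (\<lambda>_. count_space UNIV) (\<lambda>x f. f x) {..<k}"
      by (rule prob_space.indep_vars_subset[OF measure_pmf.prob_space_axioms indep_vars_Pi_pmf]) auto
    then have "indep_vars (\<lambda>_. count_space UNIV) (\<lambda>i \<omega>. H \<omega> i) {..<k}"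
      unfolding H(2)[symmetric] by (subst (asm) indep_vars_distr_iff[OF prob_space_axioms H(1)]) auto
    then show ?thesis
      by (rule indep_vars_cong[THEN iffD1, rotated -1]) (auto simp: H(3) fun_eq_iff)
  qed
qed

end

section \<open>Distances on the torus\<close>

text \<open>What the argument uses of either norm. The height occurs as \<open>- t\<close> because
  the difference of a torus point and a point at height \<open>t\<close> is formed. The quadratic
  gain is dictated by the Euclidean norm, for which lowering a point that is horizontally far away
  helps only to second order.\<close>

definition flat_norm :: "(pt \<Rightarrow> real) \<Rightarrow> bool" where
  "flat_norm N \<longleftrightarrow> (\<forall>u v t. 0 \<le> N (u, v, t) \<and> N (u, v, t) \<le> \<bar>u\<bar> + \<bar>v\<bar> + \<bar>t\<bar> \<and> \<bar>u\<bar> \<le> N (u, v, t) \<and> \<bar>v\<bar> \<le> N (u, v, t)) \<and>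
     (\<forall>u v t t' g D. 0 \<le> t' \<longrightarrow> 0 \<le> g \<longrightarrow> t' + g \<le> t \<longrightarrow> N (u, v, - t) \<le> D \<longrightarrow> 0 < D \<longrightarrow>
        N (u, v, - t') + g\<^sup>2 / (2 * D) \<le> N (u, v, - t))"

lemma
  assumes "flat_norm N"
  shows flat_norm_nonneg: "0 \<le> N (u, v, t)"
    and flat_norm_le: "N (u, v, t) \<le> \<bar>u\<bar> + \<bar>v\<bar> + \<bar>t\<bar>"
    and flat_norm_ge: "\<bar>u\<bar> \<le> N (u, v, t)" "\<bar>v\<bar> \<le> N (u, v, t)"
    and flat_norm_gain: "0 \<le> t' \<Longrightarrow> 0 \<le> g \<Longrightarrow> t' + g \<le> t \<Longrightarrow> N (u, v, - t) \<le> D \<Longrightarrow> 0 < D \<Longrightarrow>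
        N (u, v, - t') + g\<^sup>2 / (2 * D) \<le> N (u, v, - t)"
  using assms unfolding flat_norm_def by blast+

lemma flat_norm_JM: "flat_norm JM_norm"
  unfolding flat_norm_def
proof (intro conjI allI impI)
  fix u v t :: real
  show "0 \<le> JM_norm (u, v, t)" by (simp add: JM_norm_def)
  show "JM_norm (u, v, t) \<le> \<bar>u\<bar> + \<bar>v\<bar> + \<bar>t\<bar>"
    using sqrt_sum_squares_le_sum_abs[of u v] by (simp add: JM_norm_def)
  have "\<bar>u\<bar> \<le> sqrt (u\<^sup>2 + v\<^sup>2)" "\<bar>v\<bar> \<le> sqrt (u\<^sup>2 + v\<^sup>2)"
    by (auto intro!: real_le_rsqrt)
  then show "\<bar>u\<bar> \<le> JM_norm (u, v, t)" "\<bar>v\<bar> \<le> JM_norm (u, v, t)"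
    unfolding JM_norm_def prod.case by linarith+
next
  fix u v t t' g D :: real
  assume *: "0 \<le> t'" "0 \<le> g" "t' + g \<le> t" "JM_norm (u, v, - t) \<le> D" "0 < D"
  have "0 \<le> sqrt (u\<^sup>2 + v\<^sup>2)" by simp
  moreover have "sqrt (u\<^sup>2 + v\<^sup>2) + \<bar>- t\<bar> \<le> D" using *(4) unfolding JM_norm_def prod.case .
  \<comment> \<open>Here the true gain is \<open>g\<close> itself, and \<open>g \<le> 2 * D\<close>
    makes it at least the quadratic gain.\<close>
  ultimately have "g \<le> 2 * D" using * by linarith
  then have "g * g \<le> g * (2 * D)" using * by (intro mult_left_mono) auto
  then have "g\<^sup>2 / (2 * D) \<le> g" using * by (subst pos_divide_le_eq) (auto simp: power2_eq_square)
  then show "JM_norm (u, v, - t') + g\<^sup>2 / (2 * D) \<le> JM_norm (u, v, - t)"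
    using * unfolding JM_norm_def prod.case by linarith
qed

lemma flat_norm_eucl: "flat_norm eucl_norm"
  unfolding flat_norm_def
proof (intro conjI allI impI)
  fix u v t :: real
  show "0 \<le> eucl_norm (u, v, t)" by (simp add: eucl_norm_def)
  have "u\<^sup>2 + v\<^sup>2 + t\<^sup>2 \<le> (\<bar>u\<bar> + \<bar>v\<bar> + \<bar>t\<bar>)\<^sup>2"
    by (simp add: power2_sum)
  then show "eucl_norm (u, v, t) \<le> \<bar>u\<bar> + \<bar>v\<bar> + \<bar>t\<bar>"
    by (simp add: eucl_norm_def real_le_lsqrt)
  show "\<bar>u\<bar> \<le> eucl_norm (u, v, t)" "\<bar>v\<bar> \<le> eucl_norm (u, v, t)"
    by (auto simp: eucl_norm_def intro!: real_le_rsqrt)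
next
  fix u v t t' g D :: real
  assume *: "0 \<le> t'" "0 \<le> g" "t' + g \<le> t" "eucl_norm (u, v, - t) \<le> D" "0 < D"
  define a where "a = eucl_norm (u, v, - t)"
  define b where "b = eucl_norm (u, v, - t')"
  have ab: "a\<^sup>2 = u\<^sup>2 + v\<^sup>2 + t\<^sup>2" "b\<^sup>2 = u\<^sup>2 + v\<^sup>2 + t'\<^sup>2" "0 \<le> a" "0 \<le> b"
    by (simp_all add: a_def b_def eucl_norm_def)
  have t2: "t'\<^sup>2 + g\<^sup>2 \<le> t\<^sup>2"
  proof -
    have "t'\<^sup>2 + g\<^sup>2 \<le> (t' + g)\<^sup>2" using * by (simp add: power2_sum)
    also have "\<dots> \<le> t\<^sup>2" using * by (intro power_mono) auto
    finally show ?thesis .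
  qed
  then have "b\<^sup>2 \<le> a\<^sup>2" using ab zero_le_power2[of g] by linarith
  then have "b \<le> a" using ab(3) by (rule power2_le_imp_le)
  have "a \<le> D" unfolding a_def by (rule *(4))
  \<comment> \<open>The squares differ by at least the square of \<open>g\<close>; division by
    \<open>a + b \<le> 2 * D\<close> turns this into a gain in distance.\<close>
  have "g\<^sup>2 \<le> a\<^sup>2 - b\<^sup>2" using ab t2 by simp
  also have "\<dots> = (a - b) * (a + b)" by (simp add: power2_eq_square algebra_simps)
  also have "\<dots> \<le> (a - b) * (2 * D)" using \<open>b \<le> a\<close> \<open>a \<le> D\<close> by (intro mult_left_mono) auto
  finally have "g\<^sup>2 / (2 * D) \<le> a - b" using * by (subst pos_divide_le_eq) auto
  then show "eucl_norm (u, v, - t') + g\<^sup>2 / (2 * D) \<le> eucl_norm (u, v, - t)"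
    unfolding a_def b_def by linarith
qed

lemma C_d_le:
  assumes "flat_norm N"
  shows "0 \<le> C_d N" "C_d N \<le> 3"
proof -
  let ?S = "{N (x - y) | x y. x \<in> {0..1} \<times> {0..1} \<times> {0..1} \<and> y \<in> {0..1} \<times> {0..1} \<times> {0..1}}"
  have le: "z \<le> 3" if "z \<in> ?S" for z
  proof -
    from that obtain x1 x2 x3 y1 y2 y3 where z: "z = N (x1 - y1, x2 - y2, x3 - y3)"
      and b: "0 \<le> x1" "x1 \<le> 1" "0 \<le> x2" "x2 \<le> 1" "0 \<le> x3" "x3 \<le> 1" "0 \<le> y1" "y1 \<le> 1" "0 \<le> y2" "y2 \<le> 1" "0 \<le> y3" "y3 \<le> 1"
      by auto
    have "z \<le> \<bar>x1 - y1\<bar> + \<bar>x2 - y2\<bar> + \<bar>x3 - y3\<bar>"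
      unfolding z by (rule flat_norm_le[OF assms])
    then show ?thesis using b by linarith
  qed
  have mem: "N ((0, 0, 0) - (0, 0, 0)) \<in> ?S"
    by (rule CollectI, rule exI[of _ "(0, 0, 0)"], rule exI[of _ "(0, 0, 0)"]) simp
  show "C_d N \<le> 3" unfolding C_d_def by (rule cSup_least) (use mem in blast, rule le)
  have "0 \<le> N ((0, 0, 0) - (0, 0, 0))" by (metis flat_norm_nonneg[OF assms] prod_cases3)
  also have "\<dots> \<le> C_d N" unfolding C_d_def by (intro cSup_upper[OF mem] bdd_aboveI[of _ 3] le)
  finally show "0 \<le> C_d N" .
qed

lemma tdist_le:
  assumes "flat_norm N"
  shows "tdist N s (x1, x2, x3) (y1, y2, y3) \<le> N (x1 - y1 + s * of_int k1, x2 - y2 + s * of_int k2, x3 - y3)"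
  unfolding tdist_def
  by (rule cInf_lower) (auto intro!: bdd_belowI[of _ 0] flat_norm_nonneg[OF assms])

lemma tdist_less:
  assumes "tdist N s (x1, x2, x3) (y1, y2, y3) < D"
  obtains k1 k2 :: int where "N (x1 - y1 + s * of_int k1, x2 - y2 + s * of_int k2, x3 - y3) < D"
proof -
  let ?S = "{N (x1 - y1 + s * of_int k1, x2 - y2 + s * of_int k2, x3 - y3) |k1 k2. True}"
  have "Inf ?S < D" using assms by (simp add: tdist_def)
  then obtain z where "z \<in> ?S" "z < D" using cInf_lessD[of ?S D] by auto
  then show ?thesis using that by auto
qed

text \<open>The gain holds for each translate of length at most \<open>D\<close>. If it failed for
  the infimum, some translate would be shorter than both \<open>D\<close> and the claimed bound, and
  lowering the point along this translate gives a contradiction.\<close>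

lemma tdist_gain:
  assumes N: "flat_norm N" and t: "0 \<le> t'" "0 \<le> g" "t' + g \<le> t"
    and D: "tdist N s (x1, x2, 0) (a1, a2, t) < D" "0 < D"
  shows "tdist N s (x1, x2, 0) (a1, a2, t') + g\<^sup>2 / (2 * D) \<le> tdist N s (x1, x2, 0) (a1, a2, t)"
proof (rule ccontr)
  assume "\<not> ?thesis"
  then have "tdist N s (x1, x2, 0) (a1, a2, t) < min D (tdist N s (x1, x2, 0) (a1, a2, t') + g\<^sup>2 / (2 * D))"
    using D by simp
  then obtain k1 k2 :: int where k: "N (x1 - a1 + s * of_int k1, x2 - a2 + s * of_int k2, 0 - t)
      < min D (tdist N s (x1, x2, 0) (a1, a2, t') + g\<^sup>2 / (2 * D))"
    by (rule tdist_less)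
  have "N (x1 - a1 + s * of_int k1, x2 - a2 + s * of_int k2, - t') + g\<^sup>2 / (2 * D)
      \<le> N (x1 - a1 + s * of_int k1, x2 - a2 + s * of_int k2, - t)"
    using t k D(2) by (intro flat_norm_gain[OF N]) auto
  moreover have "tdist N s (x1, x2, 0) (a1, a2, t') \<le> N (x1 - a1 + s * of_int k1, x2 - a2 + s * of_int k2, 0 - t')"
    by (rule tdist_le[OF N])
  ultimately show False using k by simp
qed

lemma tdist_mono:
  assumes N: "flat_norm N" and t: "0 \<le> t'" "t' \<le> t"
  shows "tdist N s (x1, x2, 0) (a1, a2, t') \<le> tdist N s (x1, x2, 0) (a1, a2, t)"
  using tdist_gain[OF N, of t' 0 t s x1 x2 a1 a2 "\<bar>tdist N s (x1, x2, 0) (a1, a2, t)\<bar> + 1"] t by simp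

section \<open>From displaced points to robust blackness\<close>

definition far :: "real \<Rightarrow> real \<Rightarrow> pt \<Rightarrow> pt \<Rightarrow> bool" where
  "far s r b w \<longleftrightarrow> (\<forall>k1 k2 :: int. r \<le> \<bar>fst b - fst w + s * of_int k1\<bar> \<or> r \<le> \<bar>fst (snd b) - fst (snd w) + s * of_int k2\<bar>)"

definition above :: "real \<Rightarrow> pt \<Rightarrow> pt \<Rightarrow> bool" where
  "above g a b \<longleftrightarrow> fst a = fst b \<and> fst (snd a) = fst (snd b) \<and> 0 \<le> snd (snd b) \<and> snd (snd b) + g \<le> snd (snd a)"

text \<open>The deterministic content of the coupling. Partners are sought in opposite directions: a
  black point must survive into the second configuration, while a white point of the second must
  already have been present, lower down, in the first. These are the points that realise the
  distances to be compared.\<close>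

definition improved :: "real \<Rightarrow> real \<Rightarrow> real \<Rightarrow> pt set \<times> pt set \<times> pt set \<times> pt set \<Rightarrow> bool" where
  "improved s r g \<omega> \<longleftrightarrow> (case \<omega> of (P1p, P1m, P2p, P2m) \<Rightarrow> finite P1p \<and>
     (\<forall>b\<in>P1p. \<forall>w'\<in>P2m. \<exists>b'\<in>P2p. \<exists>w\<in>P1m. above 0 b b' \<and> above 0 w' w \<and> (above g b b' \<or> above g w' w \<or> far s r b w')))"

text \<open>For the black point \<open>b\<close> nearest to \<open>x\<close>, the distances from
  \<open>x\<close> increase along \<open>b'\<close>, \<open>b\<close>, \<open>w\<close>,
  \<open>w'\<close>. A displacement by \<open>g\<close> opens a gap in the first or in the last of
  these inequalities; if \<open>far\<close> holds instead, \<open>b\<close> and \<open>w'\<close>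
  cannot both be near \<open>x\<close>.\<close>

lemma improved_robustly_black:
  assumes N: "flat_norm N" and imp: "improved s r g (P1p, P1m, P2p, P2m)"
    and black: "black N s P1p P1m (x1, x2, 0)"
    and cover: "\<exists>b\<in>P1p. tdist N s (x1, x2, 0) b \<le> R"
    and R: "0 \<le> R" "0 < \<eta>" "\<eta> \<le> 1" "0 \<le> g" "\<eta> \<le> g\<^sup>2 / (2 * (R + 1))" "2 * R + 2 * \<eta> \<le> r"
  shows "robustly_black N s \<eta> P2p P2m (x1, x2, 0)"
proof -
  let ?x = "(x1, x2, 0) :: pt"
  have fin: "finite P1p" using imp by (simp add: improved_def)
  obtain b where b: "b \<in> P1p" and min: "\<And>b2. b2 \<in> P1p \<Longrightarrow> tdist N s ?x b \<le> tdist N s ?x b2"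
    using cover arg_min_if_finite[OF fin, of "tdist N s ?x"] by (metis empty_iff linorder_not_less)
  have bR: "tdist N s ?x b \<le> R" using cover min by force
  have bw: "tdist N s ?x b \<le> tdist N s ?x w" if "w \<in> P1m" for w
  proof -
    have "ereal (tdist N s ?x b) \<le> setdist N s ?x P1p"
      unfolding setdist_def using min by (intro INF_greatest) auto
    also have "\<dots> \<le> setdist N s ?x P1m" using black by (simp add: black_def)
    also have "\<dots> \<le> ereal (tdist N s ?x w)"
      unfolding setdist_def using that by (rule INF_lower)
    finally show ?thesis by simp
  qed
  have main: "setdist N s ?x P2p + ereal \<eta> \<le> ereal (tdist N s ?x w')" if w': "w' \<in> P2m" for w'
  proof -
    obtain b' w where b': "b' \<in> P2p" and w: "w \<in> P1m" and ab: "above 0 b b'" "above 0 w' w"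
      and alt: "above g b b' \<or> above g w' w \<or> far s r b w'"
      using imp b w' unfolding improved_def by fastforce
    obtain b1 b2 t t' where bb: "b = (b1, b2, t)" "b' = (b1, b2, t')" and t: "0 \<le> t'" "t' \<le> t"
      using ab(1) by (cases b; cases b') (auto simp: above_def)
    obtain w1 w2 v v' where ww: "w' = (w1, w2, v')" "w = (w1, w2, v)" and v: "0 \<le> v" "v \<le> v'"
      using ab(2) by (cases w; cases w') (auto simp: above_def)
    have b'b: "tdist N s ?x b' \<le> tdist N s ?x b" unfolding bb using t by (intro tdist_mono N)
    have w'w: "tdist N s ?x w \<le> tdist N s ?x w'" unfolding ww using v by (intro tdist_mono N)
    have w'b: "tdist N s ?x b' + \<eta> \<le> tdist N s ?x w'"
      using alt
    proof (elim disjE)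
      assume "above g b b'"
      then have "tdist N s ?x b' + g\<^sup>2 / (2 * (R + 1)) \<le> tdist N s ?x b"
        unfolding bb using bR R t by (intro tdist_gain N) (auto simp: above_def bb)
      then show ?thesis using bw[OF w] w'w R by linarith
    next
      assume up: "above g w' w"
      show ?thesis
      \<comment> \<open>\<open>tdist_gain\<close> needs a bound on the distance. Beyond
        \<open>R + 1\<close> the white point loses anyway, by at least 1, because \<open>b'\<close>
        is within \<open>R\<close>.\<close>
      proof (cases "tdist N s ?x w' < R + 1")
        case True
        then have "tdist N s ?x w + g\<^sup>2 / (2 * (R + 1)) \<le> tdist N s ?x w'"
          using up unfolding ww using R v by (intro tdist_gain N) (auto simp: above_def)
        then show ?thesis using bw[OF w] b'b R by linarith
      next
        case False
        then show ?thesis using bR b'b R by linarith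
      qed
    next
      assume far: "far s r b w'"
      show ?thesis
      proof (rule ccontr)
        assume "\<not> ?thesis"
        \<comment> \<open>Both \<open>b\<close> and \<open>w'\<close> then have translates within
          \<open>R + \<eta>\<close> of \<open>x\<close>, so horizontally they are closer than
          \<open>2 * R + 2 * \<eta> \<le> r\<close>, against \<open>far\<close>.\<close>
        then have "tdist N s ?x w' < R + \<eta>" using b'b bR by linarith
        then obtain k1 k2 :: int where k: "N (x1 - w1 + s * of_int k1, x2 - w2 + s * of_int k2, 0 - v') < R + \<eta>"
          unfolding ww by (rule tdist_less)
        have "tdist N s ?x b < R + \<eta>" using bR R by linarith
        then obtain l1 l2 :: int where l: "N (x1 - b1 + s * of_int l1, x2 - b2 + s * of_int l2, 0 - t) < R + \<eta>"
          unfolding bb by (rule tdist_less)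
        have nb: "\<bar>u\<bar> \<le> N (u, v, t)" "\<bar>v\<bar> \<le> N (u, v, t)" for u v t
          by (rule flat_norm_ge[OF N])+
        have 1: "\<bar>x1 - w1 + s * of_int k1\<bar> < R + \<eta>" "\<bar>x2 - w2 + s * of_int k2\<bar> < R + \<eta>"
          using order_le_less_trans[OF nb(1) k] order_le_less_trans[OF nb(2) k] by auto
        have 2: "\<bar>x1 - b1 + s * of_int l1\<bar> < R + \<eta>" "\<bar>x2 - b2 + s * of_int l2\<bar> < R + \<eta>"
          using order_le_less_trans[OF nb(1) l] order_le_less_trans[OF nb(2) l] by auto
        have "\<bar>b1 - w1 + s * of_int (k1 - l1)\<bar> < r" "\<bar>b2 - w2 + s * of_int (k2 - l2)\<bar> < r"
          using 1 2 R by (auto simp: algebra_simps abs_less_iff)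
        moreover have "r \<le> \<bar>b1 - w1 + s * of_int (k1 - l1)\<bar> \<or> r \<le> \<bar>b2 - w2 + s * of_int (k2 - l2)\<bar>"
          using far unfolding far_def bb ww fst_conv snd_conv by blast
        ultimately show False by linarith
      qed
    qed
    have "setdist N s ?x P2p \<le> ereal (tdist N s ?x b')"
      unfolding setdist_def using b' by (rule INF_lower)
    then have "setdist N s ?x P2p + ereal \<eta> \<le> ereal (tdist N s ?x b') + ereal \<eta>"
      by (rule add_right_mono)
    also have "\<dots> = ereal (tdist N s ?x b' + \<eta>)" by simp
    also have "\<dots> \<le> ereal (tdist N s ?x w')" using w'b by (simp only: ereal_less_eq)
    finally show ?thesis .
  qed
  have "setdist N s ?x P2p + ereal \<eta> \<le> setdist N s ?x P2m"
    unfolding setdist_def[of _ _ _ P2m] by (intro INF_greatest main)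
  then show ?thesis
    unfolding robustly_black_def by (subst ereal_le_minus) auto
qed

lemma tmod_bounds: "0 < s \<Longrightarrow> 0 \<le> tmod s x \<and> tmod s x < s"
proof -
  assume s: "0 < s"
  have "of_int \<lfloor>x / s\<rfloor> \<le> x / s" "x / s < of_int \<lfloor>x / s\<rfloor> + 1" by linarith+
  then have "of_int \<lfloor>x / s\<rfloor> * s \<le> x" "x < (of_int \<lfloor>x / s\<rfloor> + 1) * s"
    unfolding pos_le_divide_eq[OF s] pos_divide_less_eq[OF s] by auto
  then show ?thesis by (simp add: tmod_def algebra_simps)
qed

lemma improved_E_gl:
  assumes N: "flat_norm N" and imp: "improved s r g (P1p, P1m, P2p, P2m)"
    and cover: "\<And>x1 x2. 0 \<le> x1 \<Longrightarrow> x1 < s \<Longrightarrow> 0 \<le> x2 \<Longrightarrow> x2 < s \<Longrightarrow> \<exists>b\<in>P1p. tdist N s (x1, x2, 0) b \<le> R"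
    and R: "0 \<le> R" "0 < \<eta>" "\<eta> \<le> 1" "0 \<le> g" "\<eta> \<le> g\<^sup>2 / (2 * (R + 1))" "2 * R + 2 * \<eta> \<le> r"
    and s: "1 \<le> s" and \<delta>: "2 * C_d N * \<delta> \<le> \<eta>"
  shows "E_gl N s \<delta> (P1p, P1m, P2p, P2m)"
  unfolding E_gl_def prod.case
proof (intro allI impI, elim conjE)
  fix vs assume vs: "vs \<noteq> []" and bl: "\<forall>x\<in>tpath s vs. black N s P1p P1m x"
  have "robustly_black N s (2 * C_d N * \<delta>) P2p P2m y" if y: "y \<in> tpath s vs" for y
  proof -
    obtain z where z: "y = (tmod s (fst z), tmod s (snd z), 0)"
      using y by (auto simp: tpath_def torus_pt_def)
    have "robustly_black N s \<eta> P2p P2m (tmod s (fst z), tmod s (snd z), 0)"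
      using bl y z s tmod_bounds[of s] by (intro improved_robustly_black[OF N imp _ cover R]) auto
    then have "setdist N s y P2p \<le> setdist N s y P2m - ereal \<eta>"
      by (simp add: robustly_black_def z)
    also have "\<dots> \<le> setdist N s y P2m - ereal (2 * C_d N * \<delta>)"
      using \<delta> by (intro ereal_minus_mono) auto
    finally show ?thesis by (simp add: robustly_black_def)
  qed
  moreover have "tdist N s y y \<le> ln s" for y
  proof -
    obtain y1 y2 y3 where y: "y = (y1, y2, y3)" by (cases y)
    have "tdist N s y y \<le> N (0, 0, 0)"
      using tdist_le[OF N, of s y1 y2 y3 y1 y2 y3 0 0] by (simp add: y)
    also have "\<dots> \<le> \<bar>0\<bar> + \<bar>0\<bar> + \<bar>0\<bar>"
      by (rule flat_norm_le[OF N])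
    also have "\<dots> \<le> ln s" using s by simp
    finally show ?thesis .
  qed
  ultimately show "\<exists>ws. ws \<noteq> [] \<and> (\<forall>y\<in>tpath s ws. robustly_black N s (2 * C_d N * \<delta>) P2p P2m y) \<and>
       (\<forall>y\<in>tpath s ws. \<exists>x\<in>tpath s vs. tdist N s y x \<le> ln s) \<and> (\<forall>x\<in>tpath s vs. \<exists>y\<in>tpath s ws. tdist N s x y \<le> ln s)"
    using vs by blast
qed

section \<open>Decomposition of the region into boxes\<close>

definition box_map :: "pt \<Rightarrow> pt \<Rightarrow> pt \<Rightarrow> pt" where
  "box_map c l x = (fst c + fst l * fst x, fst (snd c) + fst (snd l) * fst (snd x), snd (snd c) + snd (snd l) * snd (snd x))"

definition box3 :: "pt \<Rightarrow> pt \<Rightarrow> pt set" where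
  "box3 c l = {fst c..<fst c + fst l} \<times> {fst (snd c)..<fst (snd c) + fst (snd l)} \<times> {snd (snd c)..<snd (snd c) + snd (snd l)}"

definition pos3 :: "pt \<Rightarrow> bool" where
  "pos3 l \<longleftrightarrow> 0 < fst l \<and> 0 < fst (snd l) \<and> 0 < snd (snd l)"

definition vol3 :: "pt \<Rightarrow> real" where
  "vol3 l = fst l * fst (snd l) * snd (snd l)"

lemma box_map_measurable [measurable]: "box_map c l \<in> borel \<rightarrow>\<^sub>M borel"
  unfolding box_map_def borel_prod[symmetric] by measurable

lemma inj_box_map: "pos3 l \<Longrightarrow> inj (box_map c l)"
  by (auto simp: inj_def box_map_def pos3_def)

lemma box_map_mem_iff:
  assumes "pos3 l"
  shows "box_map c l x \<in> box3 c l \<longleftrightarrow> x \<in> cube"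
  using assms by (cases x) (auto simp: box_map_def box3_def cube_def pos3_def zero_le_mult_iff)

lemma box_map_cube:
  assumes "pos3 l"
  shows "box_map c l ` cube = box3 c l"
proof
  show "box_map c l ` cube \<subseteq> box3 c l" by (intro image_subsetI) (simp only: box_map_mem_iff[OF assms])
  show "box3 c l \<subseteq> box_map c l ` cube"
  proof
    fix y assume y: "y \<in> box3 c l"
    define x where "x = ((fst y - fst c) / fst l, (fst (snd y) - fst (snd c)) / fst (snd l), (snd (snd y) - snd (snd c)) / snd (snd l))"
    have "box_map c l x = y" using assms by (simp add: x_def box_map_def pos3_def prod_eq_iff)
    then show "y \<in> box_map c l ` cube" using y box_map_mem_iff[OF assms, of c x] by (metis image_eqI)
  qed
qed

lemma sets_box3 [measurable]: "box3 c l \<in> sets borel"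
  unfolding box3_def by (simp add: borel_prod[symmetric])

lemma emeasure_box3:
  assumes "pos3 l"
  shows "emeasure lborel (box3 c l) = ennreal (vol3 l)"
  using assms unfolding box3_def pos3_def vol3_def
  by (simp add: emeasure_lborel_Times borel_prod[symmetric] ennreal_mult[symmetric] mult.assoc)

lemma Basis_pt: "(Basis :: pt set) = {(1, 0, 0), (0, 1, 0), (0, 0, 1)}"
  by (auto simp: Basis_prod_def zero_prod_def)

text \<open>Change of variables: \<open>box_map c l\<close> is the affine map with diagonal linear
  part \<open>l\<close>, whose Jacobian is \<open>vol3 l\<close>.\<close>

lemma measure_box_map:
  assumes l: "pos3 l" and B: "B \<in> sets borel"
  shows "vol3 l * measure unif (box_map c l -` B) = measure lborel (B \<inter> box3 c l)"
proof -
  define T where "T x = c + (\<Sum>j\<in>Basis. ((l \<bullet> j) * (x \<bullet> j)) *\<^sub>R j)" for x :: pt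
  have T: "T = box_map c l"
    by (cases c; cases l) (auto simp: T_def box_map_def Basis_pt fun_eq_iff)
  have nz: "l \<bullet> j \<noteq> 0" if "j \<in> Basis" for j
    using that l by (cases l) (auto simp: Basis_pt pos3_def)
  have P: "(\<Prod>j\<in>Basis. \<bar>l \<bullet> j\<bar>) = vol3 l"
    using l by (cases l) (simp add: Basis_pt pos3_def vol3_def)
  have "lborel = density (distr lborel borel T) (\<lambda>_. ennreal (\<Prod>j\<in>Basis. \<bar>l \<bullet> j\<bar>))"
    unfolding T_def using nz by (rule lborel_affine_euclidean)
  then have lb: "lborel = density (distr lborel borel (box_map c l)) (\<lambda>_. ennreal (vol3 l))"
    by (simp only: T P)
  have "emeasure lborel (B \<inter> box3 c l) = emeasure (density (distr lborel borel (box_map c l)) (\<lambda>_. ennreal (vol3 l))) (B \<inter> box3 c l)"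
    by (simp only: lb[symmetric])
  also have "\<dots> = ennreal (vol3 l) * emeasure lborel (box_map c l -` (B \<inter> box3 c l))"
    using B by (simp add: emeasure_density_const emeasure_distr)
  also have "box_map c l -` (B \<inter> box3 c l) = cube \<inter> box_map c l -` B"
    by (intro set_eqI) (simp only: vimage_eq Int_iff box_map_mem_iff[OF l] conj_commute)
  finally have "measure lborel (B \<inter> box3 c l) = vol3 l * measure lborel (cube \<inter> box_map c l -` B)"
    using l by (simp add: measure_def enn2real_mult pos3_def vol3_def)
  moreover have "measure unif (box_map c l -` B) = measure lborel (cube \<inter> box_map c l -` B)"
    using B measurable_sets[OF box_map_measurable B, of c l]
    by (simp add: unif_def measure_uniform_measure emeasure_cube measure_def[of lborel cube])
  ultimately show ?thesis by simp
qed

text \<open>The cells tile the layer below \<open>h\<close>, \<open>High\<close> is the slab from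
  \<open>h\<close> to \<open>t\<close>, and \<open>Extra\<close> the slab from \<open>t\<close> to
  \<open>s\<close>. Only the low layer is cut horizontally, because only there does the coupling
  depend on which points are neighbours.\<close>

datatype piece = Cell int int | High | Extra

fun piece_corner :: "real \<Rightarrow> real \<Rightarrow> real \<Rightarrow> piece \<Rightarrow> pt" where
  "piece_corner r h t (Cell i j) = (r * i, r * j, 0)"
| "piece_corner r h t High = (0, 0, h)"
| "piece_corner r h t Extra = (0, 0, t)"

fun piece_size :: "real \<Rightarrow> real \<Rightarrow> real \<Rightarrow> real \<Rightarrow> piece \<Rightarrow> pt" where
  "piece_size s r h t (Cell i j) = (r, r, h)"
| "piece_size s r h t High = (s, s, t - h)"
| "piece_size s r h t Extra = (s, s, s - t)"

definition piece_map :: "real \<Rightarrow> real \<Rightarrow> real \<Rightarrow> real \<Rightarrow> piece \<Rightarrow> pt \<Rightarrow> pt" where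
  "piece_map s r h t p = box_map (piece_corner r h t p) (piece_size s r h t p)"

definition piece_box :: "real \<Rightarrow> real \<Rightarrow> real \<Rightarrow> real \<Rightarrow> piece \<Rightarrow> pt set" where
  "piece_box s r h t p = box3 (piece_corner r h t p) (piece_size s r h t p)"

definition piece_vol :: "real \<Rightarrow> real \<Rightarrow> real \<Rightarrow> real \<Rightarrow> piece \<Rightarrow> real" where
  "piece_vol s r h t p = vol3 (piece_size s r h t p)"

text \<open>The number of cells per side is even, so that blocks of length 2 close up around the
  torus.\<close>

definition cells :: "nat \<Rightarrow> piece set" where
  "cells n = (\<lambda>(i, j). Cell i j) ` ({0..<2 * int n} \<times> {0..<2 * int n})"

definition pieces :: "nat \<Rightarrow> real \<Rightarrow> real \<Rightarrow> piece set" where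
  "pieces n s t = cells n \<union> {High} \<union> (if t < s then {Extra} else {})"

lemma finite_cells [simp]: "finite (cells n)"
  by (simp add: cells_def)

lemma finite_pieces [simp]: "finite (pieces n s t)"
  by (simp add: pieces_def)

lemma grid_cell:
  assumes r: "0 < r" and x: "0 \<le> x" "x < r * real m"
  shows "\<lfloor>x / r\<rfloor> \<in> {0..<int m}" "r * \<lfloor>x / r\<rfloor> \<le> x" "x < r * \<lfloor>x / r\<rfloor> + r"
proof -
  have "x / r < real m" using r x by (simp add: pos_divide_less_eq mult.commute)
  then show "\<lfloor>x / r\<rfloor> \<in> {0..<int m}" using r x by (simp add: floor_less_iff)
  have "of_int \<lfloor>x / r\<rfloor> \<le> x / r" "x / r < of_int \<lfloor>x / r\<rfloor> + 1" by linarith+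
  then have "of_int \<lfloor>x / r\<rfloor> * r \<le> x" "x < (of_int \<lfloor>x / r\<rfloor> + 1) * r"
    unfolding pos_le_divide_eq[OF r] pos_divide_less_eq[OF r] by auto
  then show "r * \<lfloor>x / r\<rfloor> \<le> x" "x < r * \<lfloor>x / r\<rfloor> + r" by (simp_all add: algebra_simps)
qed

locale stack =
  fixes s r h t :: real and n :: nat
  assumes s: "0 < s" and n: "1 \<le> n" and r: "r = s / (2 * real n)" and h: "0 < h" "h < t" "t \<le> s"
begin

lemma r_pos: "0 < r" and s_eq: "s = r * real (2 * n)"
  using s n by (simp_all add: r)

lemma pos3_piece: "p \<in> pieces n s t \<Longrightarrow> pos3 (piece_size s r h t p)"
  using s r_pos h by (auto simp: pieces_def cells_def pos3_def split: if_splits)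

lemma disjoint_piece_box: "disjoint_family_on (piece_box s r h t) (pieces n s t)"
proof -
  have lt: "i = i'" if "r * real_of_int i \<le> x" "x < r * i + r" "r * real_of_int i' \<le> x" "x < r * i' + r" for x i i'
  proof -
    have "r * real_of_int i < r * (i' + 1)" "r * real_of_int i' < r * (i + 1)"
      using that by (simp_all add: algebra_simps)
    then have "real_of_int i < of_int (i' + 1)" "real_of_int i' < of_int (i + 1)"
      using r_pos mult_less_cancel_left_pos[OF r_pos] by simp_all
    then show ?thesis by linarith
  qed
  show ?thesis
    unfolding disjoint_family_on_def
  proof (intro ballI impI)
    fix p p' assume pp: "p \<in> pieces n s t" "p' \<in> pieces n s t" "p \<noteq> p'"
    show "piece_box s r h t p \<inter> piece_box s r h t p' = {}"
    proof (rule ccontr)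
      assume "piece_box s r h t p \<inter> piece_box s r h t p' \<noteq> {}"
      then obtain x1 x2 x3 where "(x1, x2, x3) \<in> piece_box s r h t p" "(x1, x2, x3) \<in> piece_box s r h t p'" by auto
      then show False
        using pp h lt[of _ x1] lt[of _ x2] unfolding piece_box_def box3_def
        by (cases p; cases p') auto
    qed
  qed
qed

lemma Union_piece_box: "(\<Union>p\<in>pieces n s t. piece_box s r h t p) = {0..<s} \<times> {0..<s} \<times> {0..<s}"
proof
  show "(\<Union>p\<in>pieces n s t. piece_box s r h t p) \<subseteq> {0..<s} \<times> {0..<s} \<times> {0..<s}"
  proof
    fix x assume "x \<in> (\<Union>p\<in>pieces n s t. piece_box s r h t p)"
    then obtain p where p: "p \<in> pieces n s t" "x \<in> piece_box s r h t p" by auto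
    show "x \<in> {0..<s} \<times> {0..<s} \<times> {0..<s}"
    proof (cases p)
      case (Cell i j)
      then have ij: "0 \<le> i" "i + 1 \<le> 2 * int n" "0 \<le> j" "j + 1 \<le> 2 * int n"
        using p by (auto simp: pieces_def cells_def split: if_splits)
      have b: "0 \<le> r * real_of_int k" "r * k + r \<le> s" if "0 \<le> k" "k + 1 \<le> 2 * int n" for k
      proof -
        show "0 \<le> r * real_of_int k" using that r_pos by simp
        have "real_of_int (k + 1) \<le> real_of_int (2 * int n)" using that(2) by (simp only: of_int_le_iff)
        then have "r * real_of_int (k + 1) \<le> r * real (2 * n)"
          using r_pos by (intro mult_left_mono) auto
        then show "r * k + r \<le> s" unfolding s_eq[symmetric] by (simp add: algebra_simps)
      qed
      show ?thesis
        using p b[OF ij(1,2)] b[OF ij(3,4)] h Cell by (cases x) (auto simp: piece_box_def box3_def)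
    qed (use p h s in \<open>auto simp: piece_box_def box3_def pieces_def cells_def split: if_splits\<close>)
  qed
  show "{0..<s} \<times> {0..<s} \<times> {0..<s} \<subseteq> (\<Union>p\<in>pieces n s t. piece_box s r h t p)"
  proof
    fix x assume "x \<in> {0..<s} \<times> {0..<s} \<times> {0..<s}"
    then obtain x1 x2 x3 where x: "x = (x1, x2, x3)" "0 \<le> x1" "x1 < s" "0 \<le> x2" "x2 < s" "0 \<le> x3" "x3 < s" by auto
    consider "x3 < h" | "h \<le> x3" "x3 < t" | "t \<le> x3" by linarith
    then show "x \<in> (\<Union>p\<in>pieces n s t. piece_box s r h t p)"
    proof cases
      case 1
      have "Cell \<lfloor>x1 / r\<rfloor> \<lfloor>x2 / r\<rfloor> \<in> pieces n s t"
        using grid_cell(1)[OF r_pos, of x1 "2 * n"] grid_cell(1)[OF r_pos, of x2 "2 * n"] x s_eq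
        by (auto simp: pieces_def cells_def)
      moreover have "x \<in> piece_box s r h t (Cell \<lfloor>x1 / r\<rfloor> \<lfloor>x2 / r\<rfloor>)"
        using grid_cell(2,3)[OF r_pos, of x1 "2 * n"] grid_cell(2,3)[OF r_pos, of x2 "2 * n"] x s_eq 1
        by (auto simp: piece_box_def box3_def)
      ultimately show ?thesis by blast
    next
      case 2
      then have "x \<in> piece_box s r h t High" using x by (auto simp: piece_box_def box3_def)
      then show ?thesis by (auto simp: pieces_def)
    next
      case 3
      then have "x \<in> piece_box s r h t Extra" "t < s" using x by (auto simp: piece_box_def box3_def)
      then show ?thesis by (auto simp: pieces_def)
    qed
  qed
qed

lemma piece_maps_stack:
  "piece_maps (\<lambda>(b, p). piece_map s r h t p) ({b} \<times> pieces n s t)"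
  unfolding piece_maps_def
proof (intro conjI ballI)
  fix j assume "j \<in> {b} \<times> pieces n s t"
  then show "(case j of (b, p) \<Rightarrow> piece_map s r h t p) \<in> borel \<rightarrow>\<^sub>M borel"
    "inj_on (case j of (b, p) \<Rightarrow> piece_map s r h t p) cube"
    by (auto simp: piece_map_def intro: inj_on_subset[OF inj_box_map[OF pos3_piece]])
next
  have img: "piece_map s r h t p ` cube = piece_box s r h t p" if "p \<in> pieces n s t" for p
    using that by (simp add: piece_map_def piece_box_def box_map_cube pos3_piece)
  show "disjoint_family_on (\<lambda>j. (case j of (b, p) \<Rightarrow> piece_map s r h t p) ` cube) ({b} \<times> pieces n s t)"
    using disjoint_piece_box unfolding disjoint_family_on_def by (auto simp: img)
qed simp

lemma piece_map_cube: "p \<in> pieces n s t \<Longrightarrow> piece_map s r h t p ` cube \<subseteq> region s"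
proof -
  assume p: "p \<in> pieces n s t"
  then have "piece_map s r h t p ` cube = piece_box s r h t p"
    by (simp add: piece_map_def piece_box_def box_map_cube pos3_piece)
  also have "\<dots> \<subseteq> {0..<s} \<times> {0..<s} \<times> {0..<s}" using Union_piece_box p by blast
  also have "\<dots> \<subseteq> region s" by (auto simp: region_def)
  finally show ?thesis .
qed

lemma sum_piece_vol:
  assumes B: "B \<in> sets borel" "B \<subseteq> region s"
  shows "(\<Sum>p\<in>pieces n s t. piece_vol s r h t p * measure unif (piece_map s r h t p -` B)) = measure lborel B"
proof -
  have "(\<Sum>p\<in>pieces n s t. piece_vol s r h t p * measure unif (piece_map s r h t p -` B))
      = (\<Sum>p\<in>pieces n s t. measure lborel (B \<inter> piece_box s r h t p))"
    using B by (intro sum.cong refl) (simp add: piece_vol_def piece_map_def piece_box_def measure_box_map pos3_piece)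
  also have "\<dots> = measure lborel (\<Union>p\<in>pieces n s t. B \<inter> piece_box s r h t p)"
  proof (rule measure_finite_Union[symmetric])
    show "emeasure lborel (B \<inter> piece_box s r h t p) \<noteq> \<infinity>" if "p \<in> pieces n s t" for p
    proof -
      have "emeasure lborel (B \<inter> piece_box s r h t p) \<le> emeasure lborel (piece_box s r h t p)"
        by (rule emeasure_mono) (auto simp: piece_box_def)
      also have "\<dots> < \<infinity>" using emeasure_box3[OF pos3_piece[OF that]] by (simp add: piece_box_def)
      finally show ?thesis by simp
    qed
  qed (use B disjoint_piece_box in \<open>auto simp: piece_box_def disjoint_family_on_def\<close>)
  also have "(\<Union>p\<in>pieces n s t. B \<inter> piece_box s r h t p) = B \<inter> ({0..<s} \<times> {0..<s} \<times> {0..<s})"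
    using Union_piece_box by blast
  also have "measure lborel \<dots> = measure lborel B"
  proof -
    \<comment> \<open>The boxes are half-open, whereas \<open>region s\<close> includes its top
      face; this face is a null set.\<close>
    have "AE x in lborel. (x :: pt) \<notin> UNIV \<times> UNIV \<times> {s}"
    proof (rule AE_not_in)
      have "emeasure lborel (UNIV \<times> UNIV \<times> {s} :: pt set) = 0"
        by (simp add: emeasure_lborel_Times borel_prod[symmetric])
      then show "(UNIV \<times> UNIV \<times> {s} :: pt set) \<in> null_sets lborel"
        by (auto simp: null_sets_def borel_prod[symmetric])
    qed
    then have "AE x in lborel. x \<in> B \<inter> ({0..<s} \<times> {0..<s} \<times> {0..<s}) \<longleftrightarrow> x \<in> B"
      by eventually_elim (use B in \<open>auto simp: region_def\<close>)
    then have "emeasure lborel (B \<inter> ({0..<s} \<times> {0..<s} \<times> {0..<s})) = emeasure lborel B"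
      using B by (intro emeasure_eq_AE) (auto simp: borel_prod[symmetric])
    then show ?thesis by (simp add: measure_def)
  qed
  finally show ?thesis .
qed

end

section \<open>The coupled configurations\<close>

text \<open>The tiling of the cyclic grid with \<open>2n\<close> positions by blocks of length 2, shifted by \<open>c\<close>. Adjacent
  positions share a block for \<open>c = 0\<close> or for \<open>c = 1\<close>.\<close>
definition block :: "nat \<Rightarrow> int \<Rightarrow> int \<Rightarrow> int" where
  "block n c i = ((i + c) div 2) mod int n"

fun block2 :: "nat \<Rightarrow> int \<Rightarrow> int \<Rightarrow> piece \<Rightarrow> int \<times> int" where
  "block2 n c d (Cell i j) = (block n c i, block n d j)"
| "block2 n c d _ = (0, 0)"

definition blocks :: "nat \<Rightarrow> (piece \<Rightarrow> int \<times> int) list" where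
  "blocks n = [block2 n 0 0, block2 n 0 1, block2 n 1 0, block2 n 1 1]"

text \<open>The half \<open>(i + c) div 2\<close> lies between 0 and \<open>n\<close>, and its
  extreme value \<open>n\<close> wraps around to 0, so it is \<open>v\<close> or
  \<open>v + n\<close>; each half comes from two positions. Four candidates per direction is a
  generous bound, and it is the origin of the constant 16 for cells.\<close>

lemma block_fibre:
  assumes n: "1 \<le> n" and c: "c \<in> {0, 1}" and i: "0 \<le> i" "i < 2 * int n" and v: "block n c i = v"
  shows "i \<in> {2 * v - c, 2 * v + 1 - c, 2 * v + 2 * int n - c, 2 * v + 2 * int n + 1 - c}"
proof -
  define d where "d = (i + c) div 2"
  have d: "0 \<le> d" "d \<le> int n" using c i by (auto simp: d_def)
  have ic: "i + c = 2 * d \<or> i + c = 2 * d + 1" by (auto simp: d_def)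
  have "d = v \<or> d = v + int n"
  proof (cases "d = int n")
    case True
    then have "v = 0" using v by (simp add: block_def d_def[symmetric])
    then show ?thesis using True by simp
  next
    case False
    then have "d mod int n = d" using d by simp
    then show ?thesis using v by (simp add: block_def d_def[symmetric])
  qed
  then show ?thesis using ic by auto
qed

lemma card_blocks_fibre:
  assumes n: "1 \<le> n" and \<gamma>: "\<gamma> \<in> set (blocks n)"
  shows "real (card {p \<in> cells n. \<gamma> p = g}) \<le> 16"
proof -
  obtain c d where cd: "c \<in> {0, 1}" "d \<in> {0, 1}" and \<gamma>_eq: "\<gamma> = block2 n c d"
    using \<gamma> by (auto simp: blocks_def)
  define F where "F e v = {2 * v - e, 2 * v + 1 - e, 2 * v + 2 * int n - e, 2 * v + 2 * int n + 1 - e}" for e v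
  have F: "finite (F e v)" "card (F e v) \<le> 4" for e v
    using card_length[of "[2 * v - e, 2 * v + 1 - e, 2 * v + 2 * int n - e, 2 * v + 2 * int n + 1 - e]"]
    by (simp_all add: F_def)
  have "{p \<in> cells n. \<gamma> p = g} \<subseteq> (\<lambda>(i, j). Cell i j) ` (F c (fst g) \<times> F d (snd g))"
  proof
    fix p assume "p \<in> {p \<in> cells n. \<gamma> p = g}"
    then have "p \<in> cells n" and g: "block2 n c d p = g" by (simp_all add: \<gamma>_eq)
    then obtain i j where p: "p = Cell i j" "0 \<le> i" "i < 2 * int n" "0 \<le> j" "j < 2 * int n"
      unfolding cells_def by (elim imageE) (metis atLeastLessThan_iff case_prod_conv mem_Sigma_iff prod.collapse)
    have bl: "block n c i = fst g" "block n d j = snd g" unfolding g[symmetric] p(1) by simp_all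
    have "i \<in> F c (fst g)" "j \<in> F d (snd g)"
      unfolding F_def by (rule block_fibre[OF n cd(1) p(2,3) bl(1)], rule block_fibre[OF n cd(2) p(4,5) bl(2)])
    then show "p \<in> (\<lambda>(i, j). Cell i j) ` (F c (fst g) \<times> F d (snd g))" using p by auto
  qed
  then have "card {p \<in> cells n. \<gamma> p = g} \<le> card ((\<lambda>(i, j). Cell i j) ` (F c (fst g) \<times> F d (snd g)))"
    using F by (intro card_mono) auto
  also have "\<dots> \<le> card (F c (fst g) \<times> F d (snd g))"
    using F by (intro card_image_le) auto
  also have "\<dots> \<le> 4 * 4"
    unfolding card_cartesian_product using F by (intro mult_mono) auto
  finally show ?thesis by linarith
qed

text \<open>Unwrapping the torus replaces \<open>j\<close> by \<open>v\<close>, which differs from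
  \<open>i\<close> by at most 1. Consecutive integers have the same half either as they are or after
  both are increased by 1, and reduction modulo \<open>n\<close> removes the unwrapping.\<close>

lemma adjacent_block:
  assumes r: "0 < r" and s: "s = r * real (2 * n)"
    and x: "r * real_of_int i \<le> x" "x < r * real_of_int i + r"
    and y: "r * real_of_int j \<le> y" "y < r * real_of_int j + r"
    and near: "\<bar>x - y + s * of_int k\<bar> < r"
  obtains c where "c \<in> {0, 1}" "block n c i = block n c j"
proof -
  define v where "v = j - 2 * int n * k"
  have "r * real_of_int (i - v) = r * real_of_int i - r * real_of_int j + s * of_int k"
    by (simp add: v_def s algebra_simps)
  then have "\<bar>r * real_of_int (i - v)\<bar> < r * 2" using x y near by (simp add: abs_less_iff)
  then have "r * \<bar>real_of_int (i - v)\<bar> < r * 2" using r by (simp add: abs_mult)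
  then have "\<bar>real_of_int (i - v)\<bar> < 2" using r by (simp only: mult_less_cancel_left_pos)
  then have "\<bar>i - v\<bar> < 2" by linarith
  then have "(i + 0) div 2 = (v + 0) div 2 \<or> (i + 1) div 2 = (v + 1) div 2" by presburger
  then obtain c where c: "c \<in> {0, 1}" "(i + c) div 2 = (v + c) div 2" by blast
  have "v + c = (j + c) + 2 * (- (int n * k))" by (simp add: v_def)
  then have "(v + c) div 2 = (j + c) div 2 + - (int n * k)" by (simp only: div_mult_self2[of 2])
  then have "((v + c) div 2) mod int n = ((j + c) div 2) mod int n"
    by (simp add: mod_diff_eq[symmetric] mod_mult_self1_is_0)
  then show ?thesis using that[of c] c by (simp add: block_def)
qed

lemma rel_pmf_True: "rel_pmf (\<lambda>_ _. True) p q"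
  by (rule rel_pmf.intros[of "pair_pmf p q"]) (auto simp: map_fst_pair_pmf map_snd_pair_pmf)

section \<open>Transport to the space of values\<close>

text \<open>Using the finest possible \<open>\<sigma>\<close>-algebra, and only the range of \<open>F\<close> as the space, turns properties
  of the values of \<open>F\<close> into properties that hold on the whole space, without measurability issues.\<close>
definition push_algebra :: "'a measure \<Rightarrow> ('a \<Rightarrow> 'b) \<Rightarrow> 'b measure" where
  "push_algebra M F = sigma (F ` space M) {A. A \<subseteq> F ` space M \<and> F -` A \<inter> space M \<in> sets M}"

lemma space_push_algebra: "space (push_algebra M F) = F ` space M"
  unfolding push_algebra_def by (rule space_measure_of) blast

lemma sets_push_algebra:
  "sets (push_algebra M F) = {A. A \<subseteq> F ` space M \<and> F -` A \<inter> space M \<in> sets M}" (is "_ = ?S")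
proof -
  have "sigma_algebra (F ` space M) ?S"
    unfolding sigma_algebra_iff2
  proof (intro conjI ballI allI impI)
    show "?S \<subseteq> Pow (F ` space M)" by auto
    show "{} \<in> ?S" by simp
    fix A assume A: "A \<in> ?S"
    have "F -` (F ` space M - A) \<inter> space M = space M - (F -` A \<inter> space M)" by auto
    then show "F ` space M - A \<in> ?S" using A by auto
  next
    fix A :: "nat \<Rightarrow> _" assume A: "range A \<subseteq> ?S"
    then have Ai: "A i \<subseteq> F ` space M" "F -` A i \<inter> space M \<in> sets M" for i by blast+
    have "F -` (\<Union>i. A i) \<inter> space M = (\<Union>i. F -` A i \<inter> space M)" by blast
    also have "\<dots> \<in> sets M" using Ai(2) by (intro sets.countable_UN) blast
    finally show "(\<Union>i. A i) \<in> ?S" using Ai(1) by blast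
  qed
  then have "sigma_sets (F ` space M) ?S = ?S"
    by (rule sigma_algebra.sigma_sets_eq)
  then show ?thesis
    unfolding push_algebra_def by (subst sets_measure_of) blast+
qed

lemma measurable_push_algebra: "F \<in> M \<rightarrow>\<^sub>M push_algebra M F"
  by (rule measurableI) (auto simp: space_push_algebra sets_push_algebra)

lemma measurable_from_push_algebra:
  assumes X: "(\<lambda>x. X (F x)) \<in> M \<rightarrow>\<^sub>M L"
  shows "X \<in> push_algebra M F \<rightarrow>\<^sub>M L"
proof (rule measurableI)
  fix y assume "y \<in> space (push_algebra M F)"
  then show "X y \<in> space L" using measurable_space[OF X] by (auto simp: space_push_algebra)
next
  fix A assume A: "A \<in> sets L"
  have "F -` (X -` A \<inter> F ` space M) \<inter> space M = (\<lambda>x. X (F x)) -` A \<inter> space M" by auto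
  then show "X -` A \<inter> space (push_algebra M F) \<in> sets (push_algebra M F)"
    using measurable_sets[OF X A] by (auto simp: space_push_algebra sets_push_algebra)
qed

lemma poisson_process_push:
  assumes pp: "poisson_process M (\<lambda>x. X (F x)) R lam"
    and R: "\<And>x. x \<in> space M \<Longrightarrow> X (F x) \<subseteq> R \<and> finite (X (F x))"
  shows "poisson_process (distr M (push_algebra M F) F) X R lam"
proof -
  let ?N = "push_algebra M F"
  have M: "prob_space M" and XF: "(\<lambda>x. X (F x)) \<in> M \<rightarrow>\<^sub>M cfg_space" using pp unfolding poisson_process_def by blast+
  have X: "X \<in> ?N \<rightarrow>\<^sub>M cfg_space" by (rule measurable_from_push_algebra) (rule XF)
  have cnt: "{X. card (X \<inter> B) = n} \<in> sets cfg_space" if "B \<in> sets borel" for B n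
    unfolding cfg_space_def using that by (auto simp: sets_measure_of)
  have cntX: "(\<lambda>\<omega>. card (X \<omega> \<inter> B)) \<in> ?N \<rightarrow>\<^sub>M count_space UNIV" if B: "B \<in> sets borel" for B
  proof (rule measurable_count_space_countableI[where A=UNIV])
    fix n
    have "X -` {X. card (X \<inter> B) = n} \<inter> space ?N \<in> sets ?N" by (rule measurable_sets[OF X cnt[OF B]])
    also have "X -` {X. card (X \<inter> B) = n} \<inter> space ?N = {\<omega> \<in> space ?N. card (X \<omega> \<inter> B) = n}" by auto
    finally show "{\<omega> \<in> space ?N. card (X \<omega> \<inter> B) = n} \<in> sets ?N" .
  qed auto
  show ?thesis
    unfolding poisson_process_def
  proof (intro conjI allI ballI impI)
    show "prob_space (distr M ?N F)"
      by (rule prob_space.prob_space_distr[OF M measurable_push_algebra])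
    show "X \<in> distr M ?N F \<rightarrow>\<^sub>M cfg_space" using X by simp
    show "AE \<omega> in distr M ?N F. X \<omega> \<subseteq> R \<and> finite (X \<omega>)"
      using R by (intro AE_I2) (auto simp: space_push_algebra)
  next
    fix B n assume B: "B \<in> sets (borel :: pt measure)" "B \<subseteq> R"
    have "{\<omega> \<in> space ?N. card (X \<omega> \<inter> B) = n} \<in> sets ?N"
      using measurable_sets[OF cntX[OF B(1)], of "{n}"] by (simp add: vimage_def Int_def conj_commute)
    then have "measure (distr M ?N F) {\<omega> \<in> space (distr M ?N F). card (X \<omega> \<inter> B) = n}
        = measure M (F -` {\<omega> \<in> space ?N. card (X \<omega> \<inter> B) = n} \<inter> space M)"
      by (simp add: measure_distr[OF measurable_push_algebra])
    also have "F -` {\<omega> \<in> space ?N. card (X \<omega> \<inter> B) = n} \<inter> space M = {\<omega> \<in> space M. card (X (F \<omega>) \<inter> B) = n}"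
      by (auto simp: space_push_algebra)
    finally show "measure (distr M ?N F) {\<omega> \<in> space (distr M ?N F). card (X \<omega> \<inter> B) = n}
        = exp (- (lam * measure lborel B)) * (lam * measure lborel B) ^ n / fact n"
      using pp B unfolding poisson_process_def by simp
  next
    fix k :: nat and Bs
    assume Bs: "(\<forall>i<k. Bs i \<in> sets borel \<and> Bs i \<subseteq> R) \<and> disjoint_family_on Bs {..<k}"
    then have "prob_space.indep_vars M (\<lambda>_. count_space UNIV) (\<lambda>i \<omega>. card (X (F \<omega>) \<inter> Bs i)) {..<k}"
      using pp unfolding poisson_process_def by blast
    then show "prob_space.indep_vars (distr M ?N F) (\<lambda>_. count_space UNIV) (\<lambda>i \<omega>. card (X \<omega> \<inter> Bs i)) {..<k}"
      using Bs cntX by (subst indep_vars_distr_iff[OF M measurable_push_algebra]) auto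
  qed
qed

lemma indep_var_push:
  assumes "prob_space M" and ind: "prob_space.indep_var M L (\<lambda>x. X (F x)) L' (\<lambda>x. Y (F x))"
  shows "prob_space.indep_var (distr M (push_algebra M F) F) L X L' Y"
proof -
  interpret M: prob_space M by fact
  interpret D: prob_space "distr M (push_algebra M F) F" by (rule M.prob_space_distr[OF measurable_push_algebra])
  have XY: "(\<lambda>x. X (F x)) \<in> M \<rightarrow>\<^sub>M L" "(\<lambda>x. Y (F x)) \<in> M \<rightarrow>\<^sub>M L'"
    using M.indep_var_rv1[OF ind] M.indep_var_rv2[OF ind] by auto
  have c: "case_bool (\<lambda>x. X (F x)) (\<lambda>x. Y (F x)) = (\<lambda>b x. case_bool X Y b (F x))"
    by (auto simp: fun_eq_iff split: bool.split)
  show ?thesis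
    using ind XY unfolding M.indep_var_def D.indep_var_def c
    by (subst indep_vars_distr_iff[OF assms(1) measurable_push_algebra])
       (auto split: bool.split intro: measurable_from_push_algebra)
qed

section \<open>Contracted and uncontracted stacks\<close>

lemma piece_maps_cong:
  assumes "\<And>j. j \<in> J \<Longrightarrow> \<phi> j = \<psi> j" and "piece_maps \<phi> J"
  shows "piece_maps \<psi> J"
  using assms unfolding piece_maps_def disjoint_family_on_def by simp

text \<open>A point of the slab at height \<open>h + d\<close> goes to
  \<open>\<kappa> * h + \<mu> * d\<close>: the low layer below it alone has become thinner by
  \<open>(1 - \<kappa>) * h\<close>, so this gain is uniform over the slab. Inside a cell the gain
  is proportional to the height, and only its sign is recorded.\<close>

lemma stack_above:
  assumes h: "0 < h" "h < s" and \<kappa>: "0 \<le> \<kappa>" "\<kappa> \<le> 1" and \<mu>: "0 \<le> \<mu>" "\<mu> \<le> 1" and t: "t = \<kappa> * h + \<mu> * (s - h)" and u: "u \<in> cube"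
  shows "above 0 (piece_map s r h s (Cell i j) u) (piece_map s r (\<kappa> * h) t (Cell i j) u)"
    "above ((1 - \<kappa>) * h) (piece_map s r h s High u) (piece_map s r (\<kappa> * h) t High u)"
proof -
  obtain u1 u2 u3 where uu: "u = (u1, u2, u3)" "0 \<le> u3" using u by (auto simp: cube_def)
  have "\<kappa> * (h * u3) \<le> 1 * (h * u3)" using \<kappa> h uu by (intro mult_right_mono) auto
  then show "above 0 (piece_map s r h s (Cell i j) u) (piece_map s r (\<kappa> * h) t (Cell i j) u)"
    using \<kappa> h uu unfolding above_def piece_map_def box_map_def by (simp add: mult.assoc)
  define d where "d = (s - h) * u3"
  have d: "0 \<le> d" using h uu by (simp add: d_def)
  then have "0 \<le> \<mu> * d" "\<mu> * d \<le> d" using \<mu> by (auto intro!: mult_left_le_one_le)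
  moreover have "(t - \<kappa> * h) * u3 = \<mu> * d" by (simp add: t d_def)
  moreover have "(1 - \<kappa>) * h = h - \<kappa> * h" by (simp add: left_diff_distrib)
  moreover have "0 \<le> \<kappa> * h" using \<kappa> h by simp
  ultimately show "above ((1 - \<kappa>) * h) (piece_map s r h s High u) (piece_map s r (\<kappa> * h) t High u)"
    using uu by (simp add: above_def piece_map_def box_map_def d_def[symmetric])
qed

lemma stack_poisson:
  fixes J :: "(bool \<times> piece) set"
  assumes ps: "piece_space Q J N m" and st: "stack s r h t n" and sub: "{b} \<times> pieces n s t \<subseteq> J" and lam: "0 \<le> lam"
    and m: "\<And>p. p \<in> pieces n s t \<Longrightarrow> m (b, p) = lam * piece_vol s r h t p"
    and \<phi>: "\<And>p. p \<in> pieces n s t \<Longrightarrow> \<phi> (b, p) = piece_map s r h t p"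
  shows "piece_maps \<phi> ({b} \<times> pieces n s t)"
    "poisson_process (prod_space Q J) (\<lambda>\<omega>. pts \<phi> ({b} \<times> pieces n s t) (\<lambda>j. coord N j \<omega>)) (region s) lam"
    "\<omega> \<in> space (prod_space Q J) \<Longrightarrow> pts \<phi> ({b} \<times> pieces n s t) (\<lambda>j. coord N j \<omega>) \<subseteq> region s"
proof -
  interpret piece_space Q J N m by fact
  interpret stack s r h t n by fact
  let ?J = "{b} \<times> pieces n s t"
  show pm: "piece_maps \<phi> ?J"
    by (rule piece_maps_cong[OF _ piece_maps_stack]) (auto simp: \<phi>)
  have cube: "\<phi> j ` cube \<subseteq> region s" if j: "j \<in> ?J" for j
  proof -
    obtain q where "j = (b, q)" "q \<in> pieces n s t" using j by auto
    then show ?thesis using piece_map_cube[of q] by (simp only: \<phi>)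
  qed
  then show "\<omega> \<in> space \<Omega> \<Longrightarrow> pts \<phi> ?J (\<lambda>j. coord N j \<omega>) \<subseteq> region s"
    using sub by (intro pts_subset)
  show "poisson_process \<Omega> (\<lambda>\<omega>. pts \<phi> ?J (\<lambda>j. coord N j \<omega>)) (region s) lam"
  proof (rule poisson_process_pts[OF pm sub cube _ lam])
    fix B :: "pt set" assume B: "B \<in> sets borel" "B \<subseteq> region s"
    have "?J = Pair b ` pieces n s t" by auto
    then have "(\<Sum>j\<in>?J. m j * measure unif (\<phi> j -` B)) = (\<Sum>p\<in>pieces n s t. m (b, p) * measure unif (\<phi> (b, p) -` B))"
      by (simp add: sum.reindex inj_on_def)
    also have "\<dots> = (\<Sum>p\<in>pieces n s t. lam * (piece_vol s r h t p * measure unif (piece_map s r h t p -` B)))"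
      by (intro sum.cong refl) (simp add: m \<phi>)
    also have "\<dots> = lam * measure lborel B"
      unfolding sum_distrib_left[symmetric] sum_piece_vol[OF B] ..
    finally show "(\<Sum>j\<in>?J. m j * measure unif (\<phi> j -` B)) = lam * measure lborel B" .
  qed
qed

text \<open>The relation is wanted at every sample, not just on the support; samples outside the
  support are redirected to a fixed one inside, which changes no law.\<close>

lemma rel_pmf_coupling:
  fixes p :: "'a pmf" and q :: "'b pmf"
  assumes "rel_pmf R p q"
  shows "\<exists>(Q :: ('a \<times> 'b) pmf) N1 N2. map_pmf N1 Q = p \<and> map_pmf N2 Q = q \<and> (\<forall>\<omega>. R (N1 \<omega>) (N2 \<omega>))"
proof -
  from assms obtain Q where Q: "\<And>x y. (x, y) \<in> set_pmf Q \<Longrightarrow> R x y" "map_pmf fst Q = p" "map_pmf snd Q = q"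
    by (cases rule: rel_pmf.cases) auto
  obtain q0 where q0: "q0 \<in> set_pmf Q" using set_pmf_not_empty[of Q] by auto
  define sel where "sel \<omega> = (if \<omega> \<in> set_pmf Q then \<omega> else q0)" for \<omega>
  have sel: "sel \<omega> \<in> set_pmf Q" for \<omega> using q0 by (simp add: sel_def)
  have "map_pmf (\<lambda>\<omega>. fst (sel \<omega>)) Q = p" "map_pmf (\<lambda>\<omega>. snd (sel \<omega>)) Q = q"
    unfolding Q(2,3)[symmetric] by (auto intro!: map_pmf_cong simp: sel_def)
  moreover have "R (fst (sel \<omega>)) (snd (sel \<omega>))" for \<omega>
    using sel[of \<omega>] Q(1)[of "fst (sel \<omega>)" "snd (sel \<omega>)"] by simp
  ultimately show ?thesis
    by (intro exI[of _ Q] exI[of _ "\<lambda>\<omega>. fst (sel \<omega>)"] exI[of _ "\<lambda>\<omega>. snd (sel \<omega>)"]) simp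
qed

locale two_configs =
  fixes s h p1 p2 \<kappa>b \<kappa>w :: real and n :: nat
  assumes s: "0 < s" and n: "1 \<le> n" and h: "0 < h" "h < s" and p: "0 < p1" "p1 < p2" "p2 < 1"
    and \<kappa>b: "0 < \<kappa>b" "\<kappa>b < 1" and \<kappa>w: "0 < \<kappa>w" "\<kappa>w < 1"
begin

definition "r = s / (2 * real n)"
text \<open>The slab of the contracted black stack has thickness \<open>p1 / p2 * (s - h)\<close>,
  so at intensity \<open>p2\<close> it has the same mean as the full slab at intensity
  \<open>p1\<close>. In \<open>tw\<close> the same is done for white, with the roles of the two
  configurations exchanged.\<close>

definition "tb = \<kappa>b * h + p1 / p2 * (s - h)"
definition "tw = \<kappa>w * h + (1 - p2) / (1 - p1) * (s - h)"
definition "index = (UNIV :: bool set) \<times> (cells n \<union> {High, Extra})"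
text \<open>Black pieces are contracted from the first to the second configuration, white pieces from the
  second to the first. The piece \<open>Extra\<close> fills the gap that the contraction leaves at the top; it
  is degenerate, and not used, in the stack that is not contracted.\<close>
definition "place1 = (\<lambda>(b, q). if b then piece_map s r h s q else piece_map s r (\<kappa>w * h) tw q)"
definition "place2 = (\<lambda>(b, q). if b then piece_map s r (\<kappa>b * h) tb q else piece_map s r h s q)"
definition "mean1 = (\<lambda>(b, q). if b then p1 * piece_vol s r h s q else (1 - p1) * piece_vol s r (\<kappa>w * h) tw q)"
definition "mean2 = (\<lambda>(b, q). if b then p2 * piece_vol s r (\<kappa>b * h) tb q else (1 - p2) * piece_vol s r h s q)"

lemma shrunk_stack:
  assumes "0 < \<kappa>" "\<kappa> < 1" "0 < \<mu>" "\<mu> < 1"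
  shows "stack s r (\<kappa> * h) (\<kappa> * h + \<mu> * (s - h)) n"
proof -
  have "\<kappa> * h < 1 * h" "\<mu> * (s - h) < 1 * (s - h)" "0 < \<kappa> * h" "0 < \<mu> * (s - h)"
    using assms h by (auto intro!: mult_strict_right_mono simp del: mult_1)
  then show ?thesis using s n by unfold_locales (auto simp: r_def)
qed

lemma stack_S: "stack s r h s n"
  using s n h by unfold_locales (auto simp: r_def)

lemma stack_B: "stack s r (\<kappa>b * h) tb n"
  unfolding tb_def using p \<kappa>b by (intro shrunk_stack) auto

lemma stack_W: "stack s r (\<kappa>w * h) tw n"
  unfolding tw_def using p \<kappa>w by (intro shrunk_stack) auto

lemma r_pos: "0 < r" and s_eq: "s = r * real (2 * n)"
  using stack.r_pos[OF stack_S] stack.s_eq[OF stack_S] by auto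

lemma piece_sub: "{b} \<times> pieces n s t \<subseteq> index"
  by (auto simp: index_def pieces_def split: if_splits)

lemma finite_index: "finite index"
  by (simp add: index_def)

lemma piece_vol_nonneg:
  assumes "stack s r h' t n"
  shows "0 \<le> piece_vol s r h' t q"
proof -
  interpret stack s r h' t n by fact
  show ?thesis
    using r_pos s h by (cases q) (auto simp: piece_vol_def vol3_def)
qed

lemma mean_nonneg: "0 \<le> mean1 j" "0 \<le> mean2 j"
  using p piece_vol_nonneg[OF stack_S] piece_vol_nonneg[OF stack_B] piece_vol_nonneg[OF stack_W]
  by (auto simp: mean1_def mean2_def split: prod.split)

lemma mean_High: "mean1 (b, High) = mean2 (b, High)"
  using p by (auto simp: mean1_def mean2_def piece_vol_def vol3_def tb_def tw_def)

definition "linked f f' \<longleftrightarrow> separated (set (blocks n)) (cells n) f f' \<and> (\<forall>b. f (b, High) = f' (b, High))"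

text \<open>Three independent parts are glued: the cells with the given coupling,
  \<open>High\<close> with identical counts since the means agree, and \<open>Extra\<close> without
  any condition. A contracted cell is lower by \<kappa>, which is why \<kappa> appears as a factor
  of the rates.\<close>

lemma linked_coupling:
  assumes "rel_pmf (separated (set (blocks n)) (cells n)) (count_pmf (r\<^sup>2 * h) p1 ((1 - p1) * \<kappa>w) (cells n))
    (count_pmf (r\<^sup>2 * h) (p2 * \<kappa>b) (1 - p2) (cells n))"
  shows "rel_pmf linked (Pi_pmf index 0 (\<lambda>j. pois (mean1 j))) (Pi_pmf index 0 (\<lambda>j. pois (mean2 j)))"
proof -
  let ?A = "(UNIV :: bool set) \<times> cells n" and ?B = "(UNIV :: bool set) \<times> {High}" and ?C = "(UNIV :: bool set) \<times> {Extra}"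
  have idx: "index = ?A \<union> (?B \<union> ?C)" by (auto simp: index_def)
  have c1: "count_pmf (r\<^sup>2 * h) p1 ((1 - p1) * \<kappa>w) (cells n) = Pi_pmf ?A 0 (\<lambda>j. pois (mean1 j))"
    unfolding count_pmf_def
    by (intro Pi_pmf_cong refl) (auto simp: cells_def mean1_def piece_vol_def vol3_def power2_eq_square mult_ac)
  have c2: "count_pmf (r\<^sup>2 * h) (p2 * \<kappa>b) (1 - p2) (cells n) = Pi_pmf ?A 0 (\<lambda>j. pois (mean2 j))"
    unfolding count_pmf_def
    by (intro Pi_pmf_cong refl) (auto simp: cells_def mean2_def piece_vol_def vol3_def power2_eq_square mult_ac)
  have hi: "Pi_pmf ?B 0 (\<lambda>j. pois (mean1 j)) = Pi_pmf ?B 0 (\<lambda>j. pois (mean2 j))"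
    by (intro Pi_pmf_cong refl) (auto simp: mean_High)
  have BC: "rel_pmf (\<lambda>f f'. \<forall>b. f (b, High) = f' (b, High)) (Pi_pmf (?B \<union> ?C) 0 (\<lambda>j. pois (mean1 j))) (Pi_pmf (?B \<union> ?C) 0 (\<lambda>j. pois (mean2 j)))"
  proof (rule rel_Pi_pmf_union[where R="(=)" and S="\<lambda>_ _. True"])
    show "rel_pmf (=) (Pi_pmf ?B 0 (\<lambda>j. pois (mean1 j))) (Pi_pmf ?B 0 (\<lambda>j. pois (mean2 j)))"
      unfolding hi by (simp add: pmf.rel_eq)
  qed (auto simp: rel_pmf_True)
  show ?thesis
    unfolding idx
  proof (rule rel_Pi_pmf_union[OF _ _ _ assms[unfolded c1 c2] BC])
    show "?A \<inter> (?B \<union> ?C) = {}" by (auto simp: cells_def)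
    fix f f' g g' :: "bool \<times> piece \<Rightarrow> nat"
    assume f: "separated (set (blocks n)) (cells n) f f'" and g: "\<forall>b. g (b, High) = g' (b, High)"
    have "High \<notin> cells n" by (auto simp: cells_def)
    then show "linked (\<lambda>x. if x \<in> ?A then f x else g x) (\<lambda>x. if x \<in> ?A then f' x else g' x)"
      using f g by (simp add: linked_def separated_def)
  qed auto
qed

end

lemma mem_pts: "j \<in> J \<Longrightarrow> i < fst (y j) \<Longrightarrow> \<phi> j (snd (y j) i) \<in> pts \<phi> J y"
  by (auto simp: pts_def)

context two_configs
begin

text \<open>Both configurations are read off from the same sequences, with the counts
  \<open>N1\<close> and \<open>N2\<close>. \<open>Rel\<close> is left open so that the same
  construction also serves, with the trivial relation, where no improvement is claimed.\<close>

lemma construction: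
  assumes rel: "rel_pmf Rel (Pi_pmf index 0 (\<lambda>j. pois (mean1 j))) (Pi_pmf index 0 (\<lambda>j. pois (mean2 j)))"
  obtains M :: "(pt set \<times> pt set \<times> pt set \<times> pt set) measure" where
    "poisson_process M (\<lambda>\<omega>. fst \<omega>) (region s) p1"
    "poisson_process M (\<lambda>\<omega>. fst (snd \<omega>)) (region s) (1 - p1)"
    "poisson_process M (\<lambda>\<omega>. fst (snd (snd \<omega>))) (region s) p2"
    "poisson_process M (\<lambda>\<omega>. snd (snd (snd \<omega>))) (region s) (1 - p2)"
    "prob_space.indep_var M cfg_space (\<lambda>\<omega>. fst \<omega>) cfg_space (\<lambda>\<omega>. fst (snd \<omega>))"
    "prob_space.indep_var M cfg_space (\<lambda>\<omega>. fst (snd (snd \<omega>))) cfg_space (\<lambda>\<omega>. snd (snd (snd \<omega>)))"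
    "Rel = linked \<Longrightarrow> \<forall>\<omega>\<in>space M. improved s r (min ((1 - \<kappa>b) * h) ((1 - \<kappa>w) * h)) \<omega>"
proof -
  obtain Q :: "((bool \<times> piece \<Rightarrow> nat) \<times> (bool \<times> piece \<Rightarrow> nat)) pmf" and N1 N2
    where N1: "map_pmf N1 Q = Pi_pmf index 0 (\<lambda>j. pois (mean1 j))" and N2: "map_pmf N2 Q = Pi_pmf index 0 (\<lambda>j. pois (mean2 j))"
      and Rel: "\<forall>\<omega>. Rel (N1 \<omega>) (N2 \<omega>)"
    using rel_pmf_coupling[OF rel] by blast
  have ps1: "piece_space Q index N1 mean1" and ps2: "piece_space Q index N2 mean2"
    using N1 N2 by (auto intro!: piece_space.intro simp: finite_index mean_nonneg)
  interpret P1: piece_space Q index N1 mean1 by (rule ps1)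
  interpret P2: piece_space Q index N2 mean2 by (rule ps2)
  let ?\<Omega> = "prod_space Q index"
  define S where "S = pieces n s s"
  define B where "B = pieces n s tb"
  define W where "W = pieces n s tw"
  define X1 where "X1 \<omega> = pts place1 ({True} \<times> S) (\<lambda>j. coord N1 j \<omega>)" for \<omega>
  define Y1 where "Y1 \<omega> = pts place1 ({False} \<times> W) (\<lambda>j. coord N1 j \<omega>)" for \<omega>
  define X2 where "X2 \<omega> = pts place2 ({True} \<times> B) (\<lambda>j. coord N2 j \<omega>)" for \<omega>
  define Y2 where "Y2 \<omega> = pts place2 ({False} \<times> S) (\<lambda>j. coord N2 j \<omega>)" for \<omega>
  have lam: "0 \<le> p1" "0 \<le> 1 - p1" "0 \<le> p2" "0 \<le> 1 - p2" using p by auto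
  note sX1 = stack_poisson[OF ps1 stack_S piece_sub[of True] lam(1), where \<phi>=place1, folded S_def]
  note sY1 = stack_poisson[OF ps1 stack_W piece_sub[of False] lam(2), where \<phi>=place1, folded W_def]
  note sX2 = stack_poisson[OF ps2 stack_B piece_sub[of True] lam(3), where \<phi>=place2, folded B_def]
  note sY2 = stack_poisson[OF ps2 stack_S piece_sub[of False] lam(4), where \<phi>=place2, folded S_def]
  have pX1: "piece_maps place1 ({True} \<times> S)" "poisson_process ?\<Omega> X1 (region s) p1"
      "\<And>\<omega>. \<omega> \<in> space ?\<Omega> \<Longrightarrow> X1 \<omega> \<subseteq> region s"
    unfolding X1_def using sX1 by (simp_all add: place1_def mean1_def)
  have pY1: "piece_maps place1 ({False} \<times> W)" "poisson_process ?\<Omega> Y1 (region s) (1 - p1)"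
      "\<And>\<omega>. \<omega> \<in> space ?\<Omega> \<Longrightarrow> Y1 \<omega> \<subseteq> region s"
    unfolding Y1_def using sY1 by (simp_all add: place1_def mean1_def)
  have pX2: "piece_maps place2 ({True} \<times> B)" "poisson_process ?\<Omega> X2 (region s) p2"
      "\<And>\<omega>. \<omega> \<in> space ?\<Omega> \<Longrightarrow> X2 \<omega> \<subseteq> region s"
    unfolding X2_def using sX2 by (simp_all add: place2_def mean2_def)
  have pY2: "piece_maps place2 ({False} \<times> S)" "poisson_process ?\<Omega> Y2 (region s) (1 - p2)"
      "\<And>\<omega>. \<omega> \<in> space ?\<Omega> \<Longrightarrow> Y2 \<omega> \<subseteq> region s"
    unfolding Y2_def using sY2 by (simp_all add: place2_def mean2_def)
  have fin: "finite (X1 \<omega>)" "finite (Y1 \<omega>)" "finite (X2 \<omega>)" "finite (Y2 \<omega>)" for \<omega>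
    by (simp_all add: X1_def Y1_def X2_def Y2_def S_def B_def W_def finite_pts)
  define F where "F \<omega> = (X1 \<omega>, Y1 \<omega>, X2 \<omega>, Y2 \<omega>)" for \<omega>
  define M where "M = distr ?\<Omega> (push_algebra ?\<Omega> F) F"
  show ?thesis
  proof (rule that[of M])
    show "poisson_process M (\<lambda>\<omega>. fst \<omega>) (region s) p1"
      unfolding M_def by (rule poisson_process_push) (use pX1 fin in \<open>auto simp: F_def\<close>)
    show "poisson_process M (\<lambda>\<omega>. fst (snd \<omega>)) (region s) (1 - p1)"
      unfolding M_def by (rule poisson_process_push) (use pY1 fin in \<open>auto simp: F_def\<close>)
    show "poisson_process M (\<lambda>\<omega>. fst (snd (snd \<omega>))) (region s) p2"
      unfolding M_def by (rule poisson_process_push) (use pX2 fin in \<open>auto simp: F_def\<close>)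
    show "poisson_process M (\<lambda>\<omega>. snd (snd (snd \<omega>))) (region s) (1 - p2)"
      unfolding M_def by (rule poisson_process_push) (use pY2 fin in \<open>auto simp: F_def\<close>)
    have "prob_space.indep_var ?\<Omega> cfg_space X1 cfg_space Y1"
      unfolding X1_def Y1_def
      by (rule P1.indep_pts) (use pX1(1) pY1(1) piece_sub in \<open>auto simp: S_def W_def\<close>)
    then show "prob_space.indep_var M cfg_space (\<lambda>\<omega>. fst \<omega>) cfg_space (\<lambda>\<omega>. fst (snd \<omega>))"
      unfolding M_def by (intro indep_var_push P1.prob_space_axioms) (simp add: F_def)
    have "prob_space.indep_var ?\<Omega> cfg_space X2 cfg_space Y2"
      unfolding X2_def Y2_def
      by (rule P2.indep_pts) (use pX2(1) pY2(1) piece_sub in \<open>auto simp: S_def B_def\<close>)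
    then show "prob_space.indep_var M cfg_space (\<lambda>\<omega>. fst (snd (snd \<omega>))) cfg_space (\<lambda>\<omega>. snd (snd (snd \<omega>)))"
      unfolding M_def by (intro indep_var_push P1.prob_space_axioms) (simp add: F_def)
  next
    assume linked: "Rel = linked"
    let ?g = "min ((1 - \<kappa>b) * h) ((1 - \<kappa>w) * h)"
    have S_eq: "S = cells n \<union> {High}" by (simp add: S_def pieces_def)
    have SB: "S \<subseteq> B" "S \<subseteq> W" by (auto simp: S_eq B_def W_def pieces_def)
    have "improved s r ?g (F \<omega>)" if \<omega>: "\<omega> \<in> space ?\<Omega>" for \<omega>
      unfolding improved_def F_def prod.case
    proof (intro conjI ballI)
      show "finite (X1 \<omega>)" by (rule fin)
    next
      fix b w' assume "b \<in> X1 \<omega>" "w' \<in> Y2 \<omega>"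
      then obtain q i q' i' where q: "q \<in> S" "i < N1 (fst \<omega>) (True, q)" "b = place1 (True, q) (snd \<omega> (True, q) i)"
        and q': "q' \<in> S" "i' < N2 (fst \<omega>) (False, q')" "w' = place2 (False, q') (snd \<omega> (False, q') i')"
        by (auto simp: X1_def Y2_def pts_def coord_def)
      define u where "u = snd \<omega> (True, q) i"
      define u' where "u' = snd \<omega> (False, q') i'"
      have idx: "(True, q) \<in> index" "(False, q') \<in> index" using q(1) q'(1) by (auto simp: S_eq index_def)
      have u: "u \<in> cube" "u' \<in> cube"
        using P1.coord_space[OF idx(1) \<omega>] P1.coord_space[OF idx(2) \<omega>]
        by (auto simp: space_marked coord_def good_def u_def u'_def)
      have link: "linked (N1 (fst \<omega>)) (N2 (fst \<omega>))" using Rel linked by blast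
      \<comment> \<open>The partner of a point is the image of the same uniform point under the
        other placement. It is present because black counts do not decrease and white counts do not
        increase from the first configuration to the second.\<close>
      have le: "N1 (fst \<omega>) (True, q) \<le> N2 (fst \<omega>) (True, q)" "N2 (fst \<omega>) (False, q') \<le> N1 (fst \<omega>) (False, q')"
        using link q(1) q'(1) unfolding S_eq linked_def separated_def by auto
      define b' where "b' = place2 (True, q) u"
      define w where "w = place1 (False, q') u'"
      have "b' \<in> X2 \<omega>"
        using mem_pts[of "(True, q)" "{True} \<times> B" i "\<lambda>j. coord N2 j \<omega>" place2] SB q(1,2) le(1)
        by (auto simp: X2_def b'_def u_def coord_def)
      moreover have "w \<in> Y1 \<omega>"
        using mem_pts[of "(False, q')" "{False} \<times> W" i' "\<lambda>j. coord N1 j \<omega>" place1] SB q'(1,2) le(2)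
        by (auto simp: Y1_def w_def u'_def coord_def)
      moreover have bb: "above 0 b b'" "q = High \<Longrightarrow> above ?g b b'"
      proof -
        have h0: "0 \<le> p1 / p2" "p1 / p2 \<le> 1" using p by auto
        note sa = stack_above[OF h _ _ h0 tb_def u(1), of r]
        have "above 0 b b'" if "q = Cell x y" for x y
          using sa(1)[of x y] \<kappa>b that unfolding q(3) b'_def place1_def place2_def u_def[symmetric] by auto
        moreover have "above ((1 - \<kappa>b) * h) b b'" if "q = High"
          using sa(2) \<kappa>b that unfolding q(3) b'_def place1_def place2_def u_def[symmetric] by auto
        moreover have "0 \<le> (1 - \<kappa>b) * h" using \<kappa>b h by simp
        ultimately show "above 0 b b'" "q = High \<Longrightarrow> above ?g b b'"
          using q(1) by (auto simp: S_eq cells_def above_def)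
      qed
      moreover have ww: "above 0 w' w" "q' = High \<Longrightarrow> above ?g w' w"
      proof -
        have h0: "0 \<le> (1 - p2) / (1 - p1)" "(1 - p2) / (1 - p1) \<le> 1" using p by auto
        note sa = stack_above[OF h _ _ h0 tw_def u(2), of r]
        have "above 0 w' w" if "q' = Cell x y" for x y
          using sa(1)[of x y] \<kappa>w that unfolding q'(3) w_def place1_def place2_def u'_def[symmetric] by auto
        moreover have "above ((1 - \<kappa>w) * h) w' w" if "q' = High"
          using sa(2) \<kappa>w that unfolding q'(3) w_def place1_def place2_def u'_def[symmetric] by auto
        moreover have "0 \<le> (1 - \<kappa>w) * h" using \<kappa>w h by simp
        ultimately show "above 0 w' w" "q' = High \<Longrightarrow> above ?g w' w"
          using q'(1) by (auto simp: S_eq cells_def above_def)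
      qed
      \<comment> \<open>Only two low points are critical. If they were horizontally closer than
        \<open>r\<close>, their cells would share a block in one of the four tilings, and the black
        point would have forced the white count there to be 0.\<close>
      moreover have "above ?g b b' \<or> above ?g w' w \<or> far s r b w'"
      proof (cases "q = High \<or> q' = High")
        case True
        then show ?thesis using bb(2) ww(2) by auto
      next
        case False
        then have qc: "q \<in> cells n" "q' \<in> cells n" using q(1) q'(1) by (auto simp: S_eq)
        then obtain x y x' y' where c: "q = Cell x y" "q' = Cell x' y'" by (auto simp: cells_def)
        have inb: "b \<in> piece_box s r h s q"
          using box_map_mem_iff[OF stack.pos3_piece[OF stack_S q(1)[unfolded S_def]]] u(1)
          unfolding q(3) place1_def u_def[symmetric] piece_box_def by (simp add: piece_map_def)
        have inw: "w' \<in> piece_box s r h s q'"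
          using box_map_mem_iff[OF stack.pos3_piece[OF stack_S q'(1)[unfolded S_def]]] u(2)
          unfolding q'(3) place2_def u'_def[symmetric] piece_box_def by (simp add: piece_map_def)
        have B1: "r * x \<le> fst b" "fst b < r * x + r" "r * y \<le> fst (snd b)" "fst (snd b) < r * y + r"
          using inb by (auto simp: c piece_box_def box3_def mem_Times_iff)
        have W1: "r * x' \<le> fst w'" "fst w' < r * x' + r" "r * y' \<le> fst (snd w')" "fst (snd w') < r * y' + r"
          using inw by (auto simp: c piece_box_def box3_def mem_Times_iff)
        have "far s r b w'"
          unfolding far_def
        proof (intro allI, rule ccontr)
          fix k1 k2 :: int
          assume "\<not> (r \<le> \<bar>fst b - fst w' + s * of_int k1\<bar> \<or> r \<le> \<bar>fst (snd b) - fst (snd w') + s * of_int k2\<bar>)"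
          then have near: "\<bar>fst b - fst w' + s * of_int k1\<bar> < r" "\<bar>fst (snd b) - fst (snd w') + s * of_int k2\<bar> < r" by auto
          obtain c1 where c1: "c1 \<in> {0, 1}" "block n c1 x = block n c1 x'"
            using adjacent_block[OF r_pos s_eq B1(1,2) W1(1,2) near(1)] by blast
          obtain c2 where c2: "c2 \<in> {0, 1}" "block n c2 y = block n c2 y'"
            using adjacent_block[OF r_pos s_eq B1(3,4) W1(3,4) near(2)] by blast
          have "block2 n c1 c2 \<in> set (blocks n)" using c1(1) c2(1) by (auto simp: blocks_def)
          moreover have "block2 n c1 c2 q = block2 n c1 c2 q'" using c1(2) c2(2) by (simp add: c)
          moreover have "N1 (fst \<omega>) (True, q) \<noteq> 0" using q(2) by auto
          ultimately have "N2 (fst \<omega>) (False, q') = 0"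
            using link qc unfolding linked_def separated_def by blast
          then show False using q'(2) by simp
        qed
        then show ?thesis by simp
      qed
      ultimately show "\<exists>b'\<in>X2 \<omega>. \<exists>w\<in>Y1 \<omega>. above 0 b b' \<and> above 0 w' w \<and> (above ?g b b' \<or> above ?g w' w \<or> far s r b w')"
        by blast
    qed
    then show "\<forall>\<omega>\<in>space M. improved s r ?g \<omega>"
      by (auto simp: M_def space_push_algebra)
  qed
qed

end

section \<open>Probability of covering\<close>

lemma cover_prob_limit:
  fixes k \<gamma> :: real
  assumes "0 < k" "0 < \<gamma>"
  shows "((\<lambda>s::real. (32 * s)\<^sup>2 * exp (- (k * s powr \<gamma>))) \<longlongrightarrow> 0) at_top"
  using assms by real_asymp

lemma cover_box:
  assumes N: "flat_norm N" and q: "0 < q" "s = q * real m" and x: "0 \<le> x1" "x1 < s" "0 \<le> x2" "x2 < s"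
    and X: "\<And>i j. i \<in> {0..<int m} \<Longrightarrow> j \<in> {0..<int m} \<Longrightarrow> card (X \<inter> box3 (q * real_of_int i, q * real_of_int j, 0) (q, q, q)) \<noteq> 0"
  shows "\<exists>b\<in>X. tdist N s (x1, x2, 0) b \<le> 3 * q"
proof -
  let ?i = "\<lfloor>x1 / q\<rfloor>" and ?j = "\<lfloor>x2 / q\<rfloor>"
  have xs: "x1 < q * real m" "x2 < q * real m" using x q by auto
  note g1 = grid_cell[OF q(1) x(1) xs(1)] and g2 = grid_cell[OF q(1) x(3) xs(2)]
  have "X \<inter> box3 (q * real_of_int ?i, q * real_of_int ?j, 0) (q, q, q) \<noteq> {}"
    using X[OF g1(1) g2(1)] by (metis card.empty)
  then obtain b where bX: "b \<in> X" and bb: "b \<in> box3 (q * real_of_int ?i, q * real_of_int ?j, 0) (q, q, q)" by blast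
  obtain b1 b2 b3 where b: "b = (b1, b2, b3)" by (cases b)
  have bd: "q * real_of_int ?i \<le> b1" "b1 < q * real_of_int ?i + q" "q * real_of_int ?j \<le> b2" "b2 < q * real_of_int ?j + q" "0 \<le> b3" "b3 < q"
    using bb unfolding b box3_def by simp_all
  have "tdist N s (x1, x2, 0) b \<le> N (x1 - b1, x2 - b2, 0 - b3)"
    using tdist_le[OF N, of s x1 x2 0 b1 b2 b3 0 0] by (simp add: b)
  also have "\<dots> \<le> \<bar>x1 - b1\<bar> + \<bar>x2 - b2\<bar> + \<bar>0 - b3\<bar>" by (rule flat_norm_le[OF N])
  also have "\<dots> \<le> 3 * q" using bd g1(2,3) g2(2,3) by linarith
  finally show ?thesis using bX by blast
qed

text \<open>A union bound over the \<open>m * m\<close> bottom cubes of side \<open>q\<close>, each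
  empty with probability \<open>exp (- (lam * q ^ 3))\<close>.\<close>

lemma poisson_cover:
  assumes pp: "poisson_process M X (region s) lam" and q: "0 < q" "s = q * real m" and m: "1 \<le> m"
  defines "G \<equiv> {\<omega> \<in> space M. \<forall>i\<in>{0..<int m}. \<forall>j\<in>{0..<int m}. card (X \<omega> \<inter> box3 (q * real_of_int i, q * real_of_int j, 0) (q, q, q)) \<noteq> 0}"
  shows "G \<in> sets M" "1 - (real m)\<^sup>2 * exp (- (lam * q ^ 3)) \<le> measure M G"
proof -
  interpret prob_space M using pp unfolding poisson_process_def by blast
  have XM: "X \<in> M \<rightarrow>\<^sub>M cfg_space" using pp unfolding poisson_process_def by blast
  let ?I = "{0..<int m} \<times> {0..<int m}"
  let ?B = "\<lambda>(i, j). box3 (q * real_of_int i, q * real_of_int j, 0) (q, q, q)"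
  define E where "E ij = {\<omega> \<in> space M. card (X \<omega> \<inter> ?B ij) = 0}" for ij
  have Bb: "?B ij \<in> sets borel" for ij by (cases ij) simp
  have E: "E ij \<in> sets M" for ij
  proof -
    have "{X. card (X \<inter> ?B ij) = 0} \<in> sets cfg_space"
      unfolding cfg_space_def by (rule sets_measure_of[THEN equalityD2, THEN subsetD], blast, rule sigma_sets.Basic) (use Bb in blast)
    from measurable_sets[OF XM this] show ?thesis by (simp add: E_def vimage_def Int_def conj_commute)
  qed
  have PE: "measure M (E ij) = exp (- (lam * q ^ 3))" if ij: "ij \<in> ?I" for ij
  proof -
    obtain i j where ij': "ij = (i, j)" "0 \<le> i" "i + 1 \<le> int m" "0 \<le> j" "j + 1 \<le> int m" using ij by (cases ij) auto
    have b: "0 \<le> q * real_of_int k" "q * real_of_int k + q \<le> s" if "0 \<le> k" "k + 1 \<le> int m" for k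
    proof -
      show "0 \<le> q * real_of_int k" using q that by simp
      have "real_of_int (k + 1) \<le> real m" using that(2) by linarith
      then have "q * real_of_int (k + 1) \<le> q * real m" using q by (intro mult_left_mono) auto
      then show "q * real_of_int k + q \<le> s" using q by (simp add: algebra_simps)
    qed
    have qs: "q \<le> s" using b[of 0] m by simp
    have sub: "?B ij \<subseteq> region s"
      using b[OF ij'(2,3)] b[OF ij'(4,5)] qs unfolding ij' region_def box3_def by auto
    have "emeasure lborel (?B ij) = ennreal (vol3 (q, q, q))"
      unfolding ij' prod.case using q by (intro emeasure_box3) (simp add: pos3_def)
    then have "measure lborel (?B ij) = q ^ 3"
      using q by (simp add: measure_def vol3_def power3_eq_cube)
    then show ?thesis
      using pp Bb[of ij] sub unfolding poisson_process_def E_def by simp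
  qed
  have G_eq: "G = space M - (\<Union>ij\<in>?I. E ij)"
    by (auto simp: G_def E_def) (metis atLeastLessThan_iff less_numeral_extra(3))
  have UE: "(\<Union>ij\<in>?I. E ij) \<in> sets M" using E by auto
  show "G \<in> sets M" unfolding G_eq using UE by auto
  have "measure M (\<Union>ij\<in>?I. E ij) \<le> (\<Sum>ij\<in>?I. measure M (E ij))"
    using E by (intro finite_measure_subadditive_finite) auto
  also have "\<dots> = (\<Sum>ij\<in>?I. exp (- (lam * q ^ 3)))" by (intro sum.cong refl PE)
  also have "\<dots> = (real m)\<^sup>2 * exp (- (lam * q ^ 3))"
    by (simp add: card_cartesian_product power2_eq_square)
  finally show "1 - (real m)\<^sup>2 * exp (- (lam * q ^ 3)) \<le> measure M G"
    unfolding G_eq using prob_compl[OF UE] by simp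
qed

lemma two_configs_half: "0 < s \<Longrightarrow> 0 < p1 \<Longrightarrow> p1 < p2 \<Longrightarrow> p2 < 1 \<Longrightarrow> 0 < kb \<Longrightarrow> kb < 1 \<Longrightarrow> 0 < kw \<Longrightarrow> kw < 1 \<Longrightarrow>
    two_configs s (s / 2) p1 p2 kb kw 1"
  by unfold_locales auto

definition poisson_quadruple :: "real \<Rightarrow> real \<Rightarrow> real \<Rightarrow> (pt set \<times> pt set \<times> pt set \<times> pt set) measure \<Rightarrow> bool" where
  "poisson_quadruple s p1 p2 M \<longleftrightarrow>
     poisson_process M (\<lambda>\<omega>. fst \<omega>) (region s) p1 \<and>
     poisson_process M (\<lambda>\<omega>. fst (snd \<omega>)) (region s) (1 - p1) \<and>
     poisson_process M (\<lambda>\<omega>. fst (snd (snd \<omega>))) (region s) p2 \<and>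
     poisson_process M (\<lambda>\<omega>. snd (snd (snd \<omega>))) (region s) (1 - p2) \<and>
     prob_space.indep_var M cfg_space (\<lambda>\<omega>. fst \<omega>) cfg_space (\<lambda>\<omega>. fst (snd \<omega>)) \<and>
     prob_space.indep_var M cfg_space (\<lambda>\<omega>. fst (snd (snd \<omega>))) cfg_space (\<lambda>\<omega>. snd (snd (snd \<omega>)))"

text \<open>The processes are required for every positive \<open>s\<close>, also where the
  asymptotic estimates do not yet hold; there any admissible parameters and the trivial relation
  suffice.\<close>

lemma poisson_quadruple_exists:
  assumes "0 < s" "0 < p1" "p1 < p2" "p2 < 1"
  shows "\<exists>M. poisson_quadruple s p1 p2 M"
proof -
  interpret two_configs s "s / 2" p1 p2 "1 / 2" "1 / 2" 1
    using assms by (intro two_configs_half) auto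
  show ?thesis
    unfolding poisson_quadruple_def by (rule construction[OF rel_pmf_True]) blast
qed

lemma (in two_configs) improved_quadruple:
  assumes "rel_pmf (separated (set (blocks n)) (cells n)) (count_pmf (r\<^sup>2 * h) p1 ((1 - p1) * \<kappa>w) (cells n))
    (count_pmf (r\<^sup>2 * h) (p2 * \<kappa>b) (1 - p2) (cells n))"
  shows "\<exists>M. poisson_quadruple s p1 p2 M \<and> (\<forall>\<omega>\<in>space M. improved s r (min ((1 - \<kappa>b) * h) ((1 - \<kappa>w) * h)) \<omega>)"
  unfolding poisson_quadruple_def by (rule construction[OF linked_coupling[OF assms]]) blast

text \<open>Covering cubes of side \<open>r / 8\<close> put a black point within
  \<open>3 * (r / 8)\<close> of each torus point. Twice this distance plus \<open>2 * \<eta>\<close>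
  is at most \<open>r\<close> as soon as \<open>\<eta> \<le> r / 8\<close>, so only adjacent cells
  can interact. The set \<open>G\<close> is the covering event; it is measurable because it speaks
  of counts only.\<close>

lemma (in two_configs) cover_E_gl:
  assumes N: "flat_norm N"
    and rel: "rel_pmf (separated (set (blocks n)) (cells n)) (count_pmf (r\<^sup>2 * h) p1 ((1 - p1) * \<kappa>w) (cells n))
      (count_pmf (r\<^sup>2 * h) (p2 * \<kappa>b) (1 - p2) (cells n))"
    and s1: "1 \<le> s"
    and \<eta>: "0 < \<eta>" "\<eta> \<le> 1" "\<eta> \<le> r / 8" "\<eta> \<le> (min ((1 - \<kappa>b) * h) ((1 - \<kappa>w) * h))\<^sup>2 / (2 * (3 * (r / 8) + 1))"
    and \<delta>: "2 * C_d N * \<delta> \<le> \<eta>"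
  shows "\<exists>M G. poisson_quadruple s p1 p2 M \<and> G \<in> sets M \<and> G \<subseteq> {\<omega> \<in> space M. E_gl N s \<delta> \<omega>} \<and>
    1 - (real (16 * n))\<^sup>2 * exp (- (p1 * (r / 8) ^ 3)) \<le> measure M G"
proof -
  obtain M where M: "poisson_quadruple s p1 p2 M"
    and imp: "\<And>\<omega>. \<omega> \<in> space M \<Longrightarrow> improved s r (min ((1 - \<kappa>b) * h) ((1 - \<kappa>w) * h)) \<omega>"
    using improved_quadruple[OF rel] by blast
  let ?q = "r / 8" and ?m = "16 * n"
  have "?q * real ?m = r * real (2 * n)" by simp
  then have q: "0 < ?q" "s = ?q * real ?m" using r_pos s_eq by linarith+
  have m: "1 \<le> ?m" using n by simp
  have pp: "poisson_process M (\<lambda>\<omega>. fst \<omega>) (region s) p1" using M by (simp add: poisson_quadruple_def)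
  define G where "G = {\<omega> \<in> space M. \<forall>i\<in>{0..<int ?m}. \<forall>j\<in>{0..<int ?m}.
      card (fst \<omega> \<inter> box3 (?q * real_of_int i, ?q * real_of_int j, 0) (?q, ?q, ?q)) \<noteq> 0}"
  have G: "G \<in> sets M" "1 - (real ?m)\<^sup>2 * exp (- (p1 * ?q ^ 3)) \<le> measure M G"
    unfolding G_def by (rule poisson_cover[OF pp q m])+
  have "E_gl N s \<delta> \<omega>" if \<omega>: "\<omega> \<in> G" for \<omega>
  proof -
    obtain P1p P1m P2p P2m where \<omega>_eq: "\<omega> = (P1p, P1m, P2p, P2m)" by (metis prod_cases4)
    have \<omega>M: "\<omega> \<in> space M" using \<omega> by (simp add: G_def)
    have cov: "\<exists>b\<in>P1p. tdist N s (x1, x2, 0) b \<le> 3 * ?q" if x: "0 \<le> x1" "x1 < s" "0 \<le> x2" "x2 < s" for x1 x2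
    proof (rule cover_box[OF N q x])
      fix i j assume "i \<in> {0..<int ?m}" "j \<in> {0..<int ?m}"
      then have "card (fst \<omega> \<inter> box3 (?q * real_of_int i, ?q * real_of_int j, 0) (?q, ?q, ?q)) \<noteq> 0"
        using \<omega> unfolding G_def by blast
      then show "card (P1p \<inter> box3 (?q * real_of_int i, ?q * real_of_int j, 0) (?q, ?q, ?q)) \<noteq> 0"
        by (simp only: \<omega>_eq fst_conv not_False_eq_True)
    qed
    have "0 \<le> min ((1 - \<kappa>b) * h) ((1 - \<kappa>w) * h)" using \<kappa>b \<kappa>w h by simp
    then show ?thesis
      unfolding \<omega>_eq using q \<eta> s1 \<delta>
      by (intro improved_E_gl[OF N imp[OF \<omega>M, unfolded \<omega>_eq] cov]) auto
  qed
  then show ?thesis using M G by (intro exI[of _ M] exI[of _ G]) (auto simp: G_def)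
qed

section \<open>Choice of the scales for large s\<close>

lemma eventually_powr_neg_le:
  fixes a c :: real
  assumes "0 < a" "0 < c"
  shows "eventually (\<lambda>s. s powr (- a) \<le> c) at_top"
proof -
  have "((\<lambda>s::real. s powr (- a)) \<longlongrightarrow> 0) at_top"
    using assms by (intro tendsto_neg_powr filterlim_ident) auto
  then have "eventually (\<lambda>s::real. s powr (- a) < c) at_top"
    using assms(2) by (rule order_tendstoD)
  then show ?thesis by eventually_elim simp
qed

text \<open>The side of a cell should be about \<open>s powr g\<close>, but an even number of cells
  must fit into \<open>s\<close>; rounding up at most doubles a number that is at least 1.\<close>

lemma mesh_bounds:
  fixes s g :: real
  assumes s: "1 \<le> s" and g: "0 < g" "g < 1"
  defines "n \<equiv> nat \<lceil>s powr (1 - g)\<rceil>"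
  shows "1 \<le> n" "real n \<le> 2 * s" "s powr g / 4 \<le> s / (2 * real n)" "s / (2 * real n) \<le> s powr g / 2"
proof -
  have y1: "1 \<le> s powr (1 - g)" using s g by (simp add: ge_one_powr_ge_zero)
  have ge: "s powr (1 - g) \<le> real n" unfolding n_def using y1 by linarith
  have le: "real n \<le> 2 * s powr (1 - g)" unfolding n_def using y1 by linarith
  show "1 \<le> n" using ge y1 by linarith
  have "s powr (1 - g) \<le> s powr 1" using s g by (intro powr_mono) auto
  then show "real n \<le> 2 * s" using le s by simp
  have n0: "0 < real n" using ge y1 by linarith
  have eq: "s powr g * s powr (1 - g) = s" using s by (simp add: powr_add[symmetric])
  have "s powr g * (2 * real n) \<le> s powr g * (4 * s powr (1 - g))"
    using le by (intro mult_left_mono) auto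
  also have "\<dots> = 4 * s" using eq by simp
  finally show "s powr g / 4 \<le> s / (2 * real n)" using n0 by (simp add: field_simps)
  have "s = s powr g * s powr (1 - g)" using eq by simp
  also have "\<dots> \<le> s powr g * real n" using ge by (intro mult_left_mono) auto
  finally show "s / (2 * real n) \<le> s powr g / 2" using n0 by (simp add: field_simps)
qed

lemma large_scale:
  fixes N :: "pt \<Rightarrow> real" and p1 p2 \<epsilon> :: real and \<delta> :: "real \<Rightarrow> real"
  assumes N: "flat_norm N" and p: "0 < p1" "p1 < p2" "p2 < 1" and \<epsilon>: "0 < \<epsilon>"
    and \<delta>: "\<And>s. s > 0 \<Longrightarrow> 0 < \<delta> s \<and> \<delta> s \<le> s powr (- \<epsilon>)"
  shows "\<exists>b. (b \<longlongrightarrow> 0) at_top \<and> eventually (\<lambda>s. \<exists>M G. poisson_quadruple s p1 p2 M \<and> G \<in> sets M \<and>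
     G \<subseteq> {\<omega> \<in> space M. E_gl N s (\<delta> s) \<omega>} \<and> 1 - b s \<le> measure M G) at_top"
proof -
  \<comment> \<open>Midpoints between the ratio of the intensities and 1: strictly below 1, so that
    points move, and strictly above the ratio, so that \<open>rates\<close> holds and counts can be
    coupled.\<close>
  define \<kappa>b where "\<kappa>b = (1 + p1 / p2) / 2"
  define \<kappa>w where "\<kappa>w = (1 + (1 - p2) / (1 - p1)) / 2"
  have quot: "0 < p1 / p2" "p1 / p2 < 1" "0 < (1 - p2) / (1 - p1)" "(1 - p2) / (1 - p1) < 1" using p by auto
  have \<kappa>: "0 < \<kappa>b" "\<kappa>b < 1" "0 < \<kappa>w" "\<kappa>w < 1" using quot by (simp_all add: \<kappa>b_def \<kappa>w_def)
  have "p2 * \<kappa>b = (p2 + p1) / 2" "(1 - p1) * \<kappa>w = ((1 - p1) + (1 - p2)) / 2"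
    using p by (simp_all add: \<kappa>b_def \<kappa>w_def field_simps)
  then have rates: "p1 < p2 * \<kappa>b" "1 - p2 < (1 - p1) * \<kappa>w" using p by auto
  \<comment> \<open>The argument 3 stands for \<open>Suc 3 = 4\<close> tilings, and 16 is the bound
    on the cells in a block.\<close>
  obtain a0 where a0: "0 < a0"
    and coup: "\<And>a (I :: piece set) (\<gamma>s :: (piece \<Rightarrow> int \<times> int) list). 0 < a \<Longrightarrow> a \<le> a0 \<Longrightarrow> finite I \<Longrightarrow> length \<gamma>s = 4 \<Longrightarrow>
       (\<forall>\<gamma>\<in>set \<gamma>s. \<forall>g. real (card {c\<in>I. \<gamma> c = g}) \<le> 16) \<Longrightarrow>
       rel_pmf (separated (set \<gamma>s) I) (count_pmf a p1 ((1 - p1) * \<kappa>w) I) (count_pmf a (p2 * \<kappa>b) (1 - p2) I)"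
    using separated_coupling[of 16 p1 "p2 * \<kappa>b" "1 - p2" "(1 - p1) * \<kappa>w" 3, where 'c=piece and 'g="int \<times> int"] p rates
    by auto
  \<comment> \<open>The tolerance is then of order at most \<open>1 / y ^ 8\<close>, one power of
    \<open>y\<close> below the gain of order \<open>1 / y ^ 7\<close>; the spare factor absorbs all
    constants.\<close>
  define g where "g = min \<epsilon> 1 / 8"
  have g: "0 < g" "g < 1" "8 * g \<le> \<epsilon>" using \<epsilon> by (auto simp: g_def)
  define c where "c = min (1 - \<kappa>b) (1 - \<kappa>w)"
  have c: "0 < c" using \<kappa> by (auto simp: c_def)
  then have c24: "0 < c\<^sup>2 / 24" by simp
  \<comment> \<open>There are \<open>16 * n \<le> 32 * s\<close> covering cubes per side, and their
    side \<open>r / 8\<close> is at least \<open>y / 32\<close>.\<close>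
  define b where "b s = (32 * s)\<^sup>2 * exp (- (p1 / 32 ^ 3 * s powr (3 * g)))" for s :: real
  have "(b \<longlongrightarrow> 0) at_top"
    unfolding b_def using p g by (intro cover_prob_limit) auto
  moreover have "eventually (\<lambda>s. \<exists>M G. poisson_quadruple s p1 p2 M \<and> G \<in> sets M \<and>
     G \<subseteq> {\<omega> \<in> space M. E_gl N s (\<delta> s) \<omega>} \<and> 1 - b s \<le> measure M G) at_top"
    using eventually_gt_at_top[of 1] eventually_powr_neg_le[OF g(1) a0]
      eventually_powr_neg_le[OF g(1) c24] eventually_powr_neg_le[OF \<epsilon>, of "1 / 192", simplified]
  proof eventually_elim
    case (elim s)
    define y where "y = s powr g"
    have y1: "1 \<le> y" using elim g by (simp add: y_def ge_one_powr_ge_zero)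
    have yp: "s powr (real k * g) = y ^ k" for k :: nat
    proof -
      have "y ^ k = y powr real k" using y1 by (simp add: powr_realpow)
      also have "\<dots> = s powr (g * real k)" by (simp only: y_def powr_powr)
      finally show ?thesis by (simp only: mult.commute)
    qed
    have yk: "s powr (- (real k * g)) = 1 / y ^ k" for k :: nat
      by (simp only: powr_minus_divide yp)
    have "s powr (- g) = 1 / y" by (simp only: powr_minus_divide y_def)
    then have y_inv: "1 / y \<le> a0" "1 / y \<le> c\<^sup>2 / 24" using elim(2,3) by simp_all
    define n where "n = nat \<lceil>s powr (1 - g)\<rceil>"
    have nb: "1 \<le> n" "real n \<le> 2 * s" "y / 4 \<le> s / (2 * real n)" "s / (2 * real n) \<le> y / 2"
      unfolding n_def y_def using mesh_bounds[of s g] elim g by auto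
    \<comment> \<open>The power 3 beats the base area of a cell, of order \<open>y ^ 2\<close>, so
      that the expected count in a low cell tends to 0.\<close>
    define h where "h = 1 / y ^ 3"
    have "1 \<le> y ^ 3" using y1 by simp
    then have h: "0 < h" "h \<le> 1" using y1 by (simp_all add: h_def)
    interpret two_configs s h p1 p2 \<kappa>b \<kappa>w n
      using elim nb h p \<kappa> by unfold_locales auto
    have r: "y / 4 \<le> r" "r \<le> y / 2" unfolding r_def by (fact nb(3), fact nb(4))
    have rel: "rel_pmf (separated (set (blocks n)) (cells n)) (count_pmf (r\<^sup>2 * h) p1 ((1 - p1) * \<kappa>w) (cells n))
      (count_pmf (r\<^sup>2 * h) (p2 * \<kappa>b) (1 - p2) (cells n))"
    proof (rule coup)
      show "0 < r\<^sup>2 * h" using r_pos h by simp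
      have "r\<^sup>2 * h \<le> y\<^sup>2 * h"
        using r r_pos y1 h by (intro mult_right_mono power_mono) auto
      also have "\<dots> = 1 / y" using y1 by (simp add: h_def power2_eq_square power3_eq_cube)
      finally show "r\<^sup>2 * h \<le> a0" using y_inv by linarith
      show "length (blocks n) = 4" by (simp add: blocks_def)
      show "\<forall>\<gamma>\<in>set (blocks n). \<forall>g. real (card {q \<in> cells n. \<gamma> q = g}) \<le> 16"
        using card_blocks_fibre[OF nb(1)] by blast
    qed simp
    \<comment> \<open>The factor 6 comes from \<open>2 * C_d N \<le> 6\<close>. The threshold 1/192
      used for \<open>s powr (- \<epsilon>)\<close> gives \<open>\<eta> \<le> 1 / 32\<close>, which
      is at most \<open>r / 8\<close> because \<open>r \<ge> y / 4 \<ge> 1 / 4\<close>.\<close>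
    define \<eta> where "\<eta> = 6 * s powr (- \<epsilon>)"
    have \<eta>: "0 < \<eta>" "\<eta> \<le> 1 / 32" using elim by (auto simp: \<eta>_def)
    have "s powr (- \<epsilon>) \<le> s powr (- (real 8 * g))" using elim g by (intro powr_mono) auto
    then have \<eta>8: "\<eta> \<le> 6 * (1 / y ^ 8)" unfolding yk by (simp add: \<eta>_def)
    \<comment> \<open>The constant 24 is \<open>6 * 4\<close>: the 6 from \<open>\<eta>\<close>
      cancels, and the 4 appears in \<open>2 * (3 * (r / 8) + 1) \<le> 4 * y\<close>.\<close>
    have gain: "\<eta> \<le> (min ((1 - \<kappa>b) * h) ((1 - \<kappa>w) * h))\<^sup>2 / (2 * (3 * (r / 8) + 1))"
    proof -
      have ch: "min ((1 - \<kappa>b) * h) ((1 - \<kappa>w) * h) = c * h"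
        using h by (simp add: c_def min_mult_distrib_right)
      have "\<eta> \<le> 6 * (1 / y) * (1 / y ^ 7)" using \<eta>8 by (simp add: power_Suc[of y 7, simplified])
      also have "\<dots> \<le> 6 * (c\<^sup>2 / 24) * (1 / y ^ 7)"
        using y_inv y1 by (intro mult_right_mono mult_left_mono) auto
      also have "\<dots> = (c * h)\<^sup>2 / (2 * (2 * y))"
        using y1 by (simp add: h_def power_divide power_mult_distrib power_mult[symmetric] power_Suc[of y 6, simplified])
      also have "\<dots> \<le> (c * h)\<^sup>2 / (2 * (3 * (r / 8) + 1))"
        using r y1 r_pos by (intro divide_left_mono) auto
      finally show ?thesis unfolding ch .
    qed
    have d: "2 * C_d N * \<delta> s \<le> \<eta>"
    proof -
      have "C_d N * \<delta> s \<le> 3 * s powr (- \<epsilon>)"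
        using C_d_le[OF N] \<delta>[of s] elim by (intro mult_mono) auto
      then show ?thesis by (simp add: \<eta>_def)
    qed
    obtain M G where M: "poisson_quadruple s p1 p2 M" and G: "G \<in> sets M" "G \<subseteq> {\<omega> \<in> space M. E_gl N s (\<delta> s) \<omega>}"
      "1 - (real (16 * n))\<^sup>2 * exp (- (p1 * (r / 8) ^ 3)) \<le> measure M G"
      using cover_E_gl[OF N rel _ \<eta>(1) _ _ gain d] elim \<eta> r y1 by auto
    have "(real (16 * n))\<^sup>2 * exp (- (p1 * (r / 8) ^ 3)) \<le> b s"
      unfolding b_def
    proof (intro mult_mono power_mono)
      have "(y / 32) ^ 3 \<le> (r / 8) ^ 3" using r y1 by (intro power_mono) auto
      then have "p1 * (y / 32) ^ 3 \<le> p1 * (r / 8) ^ 3" using p by (intro mult_left_mono) auto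
      moreover have "s powr (3 * g) = y ^ 3" using yp[of 3] by simp
      ultimately show "exp (- (p1 * (r / 8) ^ 3)) \<le> exp (- (p1 / 32 ^ 3 * s powr (3 * g)))"
        by (simp add: power_divide)
    qed (use nb in auto)
    then show ?case using M G by (intro exI[of _ M] exI[of _ G]) auto
  qed
  ultimately show ?thesis by blast
qed


theorem theorem3p5:
  fixes N :: "pt \<Rightarrow> real" and p1 p2 \<epsilon> :: real and \<delta> :: "real \<Rightarrow> real"
  assumes "N = JM_norm \<or> N = eucl_norm"
    and "0 < p1" and "p1 < p2" and "p2 < 1" and "\<epsilon> > 0"
    and "\<And>s. s > 0 \<Longrightarrow> 0 < \<delta> s \<and> \<delta> s \<le> s powr (- \<epsilon>)"
  shows "\<exists>M :: real \<Rightarrow> (pt set \<times> pt set \<times> pt set \<times> pt set) measure.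
           (\<forall>s > 0.
              poisson_process (M s) (\<lambda>\<omega>. fst \<omega>) (region s) p1 \<and>
              poisson_process (M s) (\<lambda>\<omega>. fst (snd \<omega>)) (region s) (1 - p1) \<and>
              poisson_process (M s) (\<lambda>\<omega>. fst (snd (snd \<omega>))) (region s) p2 \<and>
              poisson_process (M s) (\<lambda>\<omega>. snd (snd (snd \<omega>))) (region s) (1 - p2) \<and>
              prob_space.indep_var (M s) cfg_space (\<lambda>\<omega>. fst \<omega>) cfg_space (\<lambda>\<omega>. fst (snd \<omega>)) \<and>
              prob_space.indep_var (M s) cfg_space (\<lambda>\<omega>. fst (snd (snd \<omega>))) cfg_space (\<lambda>\<omega>. snd (snd (snd \<omega>)))) \<and>
           (\<exists>G :: real \<Rightarrow> (pt set \<times> pt set \<times> pt set \<times> pt set) set.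
              (\<forall>s > 0. G s \<in> sets (M s) \<and> G s \<subseteq> {\<omega> \<in> space (M s). E_gl N s (\<delta> s) \<omega>}) \<and>
              ((\<lambda>s. measure (M s) (G s)) \<longlongrightarrow> 1) at_top)"
proof -
  have N: "flat_norm N" using assms(1) flat_norm_JM flat_norm_eucl by auto
  define good where "good s bs M G \<longleftrightarrow> poisson_quadruple s p1 p2 M \<and> G \<in> sets M \<and>
      G \<subseteq> {\<omega> \<in> space M. E_gl N s (\<delta> s) \<omega>} \<and> 1 - bs \<le> measure M G" for s bs :: real and M G
  obtain b where b: "(b \<longlongrightarrow> 0) at_top" and ev: "eventually (\<lambda>s. \<exists>M G. good s (b s) M G) at_top"
    using large_scale[OF N assms(2-6)] unfolding good_def by blast
  \<comment> \<open>A choice for all \<open>s\<close> at once: a measure and event with the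
    probability bound whenever they exist, and otherwise, for positive \<open>s\<close>, any
    quadruple of processes with an admissible event such as \<open>{}\<close>.\<close>
  define best where "best s M G \<longleftrightarrow>
      (0 < s \<longrightarrow> poisson_quadruple s p1 p2 M \<and> G \<in> sets M \<and> G \<subseteq> {\<omega> \<in> space M. E_gl N s (\<delta> s) \<omega>}) \<and>
      ((\<exists>M G. good s (b s) M G) \<longrightarrow> good s (b s) M G)" for s M G
  have ex: "\<exists>M G. best s M G" for s
  proof (cases "\<exists>M G. good s (b s) M G")
    case True
    then show ?thesis unfolding best_def good_def by blast
  next
    case False
    show ?thesis
    proof (cases "0 < s")
      case True
      then obtain M where "poisson_quadruple s p1 p2 M" using poisson_quadruple_exists[of s p1 p2] assms by blast
      then show ?thesis unfolding best_def using False by (intro exI[of _ M] exI[of _ "{}"]) auto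
    qed (use False in \<open>auto simp: best_def\<close>)
  qed
  have "\<exists>MG. best s (fst MG) (snd MG)" for s
  proof -
    obtain M G where "best s M G" using ex by blast
    then show ?thesis by (intro exI[of _ "(M, G)"]) simp
  qed
  then obtain F where F: "\<forall>s. best s (fst (F s)) (snd (F s))"
    using choice[of "\<lambda>s MG. best s (fst MG) (snd MG)"] by blast
  define M where "M s = fst (F s)" for s
  define G where "G s = snd (F s)" for s
  have best: "best s (M s) (G s)" for s using F by (simp add: M_def G_def)
  have MG: "poisson_quadruple s p1 p2 (M s) \<and> G s \<in> sets (M s) \<and> G s \<subseteq> {\<omega> \<in> space (M s). E_gl N s (\<delta> s) \<omega>}"
    if "0 < s" for s using best[of s] that unfolding best_def by blast
  have lb: "good s (b s) (M s) (G s)" if "\<exists>M G. good s (b s) M G" for s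
    using best[of s] that unfolding best_def by blast
  have "((\<lambda>s. measure (M s) (G s)) \<longlongrightarrow> 1) at_top"
  proof (rule tendsto_sandwich)
    show "eventually (\<lambda>s. 1 - b s \<le> measure (M s) (G s)) at_top"
      using ev
    proof eventually_elim
      case (elim s)
      then show ?case using lb[OF elim] unfolding good_def by blast
    qed
    show "eventually (\<lambda>s. measure (M s) (G s) \<le> 1) at_top"
      using eventually_gt_at_top[of 0]
    proof eventually_elim
      case (elim s)
      then have "prob_space (M s)" using MG[OF elim] unfolding poisson_quadruple_def poisson_process_def by blast
      then show ?case by (rule prob_space.prob_le_1)
    qed
    have "((\<lambda>s. 1 - b s) \<longlongrightarrow> 1 - 0) at_top" by (intro tendsto_diff tendsto_const b)
    then show "((\<lambda>s. 1 - b s) \<longlongrightarrow> 1) at_top" by simp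
  qed simp
  then show ?thesis
    using MG unfolding poisson_quadruple_def by (intro exI[of _ M] conjI exI[of _ G]) blast+
qed

end
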